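(* Let $\lambda_1=1$ and, for each odd $q\ge3$, let $\lambda_q$ be the largest root of the polynomial $x^q-2x^{q-2}-1$. Assume that $F\in\mathcal{S}(\Omega)$ has a periodic orbit of strips of period $2^nq$ with $n\ge0$ and $q\ge1$ odd. Then $$h(F)\ge\frac{\log(\lambda_q)}{2^n}.$$ Moreover, for every $m=2^nq$ with $n\ge0$ and $q\ge1$ odd, there exists a map $F_m\in\mathcal{S}(\Omega)$ with a periodic orbit of bands of period $m$ such that $h(F_m)=\frac{\log(\lambda_q)}{2^n}$.
   Context: Let $\mathbb{S}^1=\mathbb{R}/\mathbb{Z}$, $\mathbb{I}=[0,1]$, $\Omega=\mathbb{S}^1\times\mathbb{I}$, and let $\pi:\Omega\to\mathbb{S}^1$ be the projection. $\mathcal{S}(\Omega)$ is the class of all maps $F:\Omega\to\Omega$ of the form $F(\theta,x)=(R_\omega(\theta),f(\theta,x))$, where $R_\omega(\theta)=\theta+\omega \pmod 1$ with $\omega\in\mathbb{R}\setminus\mathbb{Q}$ and $f:\Omega\to\mathbb{I}$ is continuous. $h$ denotes topological entropy. A set is residual if it contains the intersection of a countable family of open dense sets. A strip is a closed set $B\subset\Omega$ with $\pi(B)=\mathbb{S}^1$ such that $\pi^{-1}(\theta)\cap B$ is a closed interval (possibly a point) for every $\theta$ in a residual subset of $\mathbb{S}^1$. The core of $A\subset\Omega$ is $A^c=\bigcap_{G}\overline{A\cap\pi^{-1}(G)}$, over all residual $G\subset\mathbb{S}^1$; a band is a strip $A$ with $A^c=A$. For a strip $A$ put $M_A(\theta)=\max\{x:(\theta,x)\in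 A\}$ and $m_A(\theta)=\min\{x:(\theta,x)\in A\}$. For strips $A,B$ write $A<B$ if there is a residual set $G\subset\mathbb{S}^1$ with $M_A(\theta)<m_B(\theta)$ for all $\theta\in G$; $A,B$ are ordered if $A<B$ or $B<A$. For $F\in\mathcal{S}(\Omega)$, a strip $A$ is $p$-periodic if $F^p(A)=A$ and $A,F(A),\dots,F^{p-1}(A)$ are pairwise disjoint and pairwise ordered strips; then $\{A,F(A),\dots,F^{p-1}(A)\}$ is a periodic orbit of strips of period $p$. It is a periodic orbit of bands if its elements are bands. *)

theory Defs
  imports "HOL-Analysis.Analysis"
begin

quotient_type circle = real / "\<lambda>x y::real. x - y \<in> \<int>"
proof (rule equivpI)
  show "reflp (\<lambda>x y::real. x - y \<in> \<int>)"
    by (simp add: reflp_def)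
  show "symp (\<lambda>x y::real. x - y \<in> \<int>)"
    by (metis (mono_tags, lifting) Ints_minus minus_diff_eq sympI)
  show "transp (\<lambda>x y::real. x - y \<in> \<int>)"
  proof (rule transpI)
    fix x y z :: real
    assume "x - y \<in> \<int>" "y - z \<in> \<int>"
    then have "(x - y) + (y - z) \<in> \<int>" by (rule Ints_add)
    then show "x - z \<in> \<int>" by simp
  qed
qed

text \<open>The topology is the quotient topology of the real line.\<close>

instantiation circle :: topological_space
begin

definition open_circle :: "circle set \<Rightarrow> bool"
  where "open_circle U \<longleftrightarrow> open (abs_circle -` U)"

instance
proof
  show "open (UNIV :: circle set)"
    by (simp add: open_circle_def)
  show "open (S \<inter> T)" if "open S" "open T" for S T :: "circle set"
    using that by (simp add: open_circle_def vimage_Int open_Int)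
  show "open (\<Union>K)" if "\<forall>S\<in>K. open S" for K :: "circle set set"
    using that by (auto simp: open_circle_def vimage_Union)
qed

end

lift_definition rotation :: "real \<Rightarrow> circle \<Rightarrow> circle" is "\<lambda>\<omega> x. x + \<omega>"
  by simp

definition Omega :: "(circle \<times> real) set"
  where "Omega = UNIV \<times> {0..1}"

text \<open>Maps of the cylinder are represented by functions on the whole product type;
  only their values on \<^term>\<open>Omega\<close> are relevant.\<close>

definition skew_products :: "(circle \<times> real \<Rightarrow> circle \<times> real) set"
  where "skew_products =
    {F. \<exists>\<omega> f. \<omega> \<notin> \<rat> \<and> continuous_on Omega f \<and> f ` Omega \<subseteq> {0..1} \<and>
          (\<forall>\<theta> x. (\<theta>, x) \<in> Omega \<longrightarrow> F (\<theta>, x) = (rotation \<omega> \<theta>, f (\<theta>, x)))}"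

text \<open>The definition of Adler, Konheim and McAndrew by open covers, for a continuous self-map
  of a compact space. The sequence in \<open>cover_entropy\<close> converges by subadditivity, so that
  the upper limit is a limit. Its term of index 0 is irrelevant.\<close>

definition open_cover :: "'a topology \<Rightarrow> 'a set set \<Rightarrow> bool"
  where "open_cover X \<U> \<longleftrightarrow> (\<forall>U\<in>\<U>. openin X U) \<and> \<Union>\<U> = topspace X"

definition min_subcover_card :: "'a topology \<Rightarrow> 'a set set \<Rightarrow> nat"
  where "min_subcover_card X \<U> =
    (LEAST k. \<exists>\<V>. \<V> \<subseteq> \<U> \<and> finite \<V> \<and> card \<V> = k \<and> \<Union>\<V> = topspace X)"

text \<open>The common refinement of \<open>\<U>, T\<^sup>-\<^sup>1\<U>, \<dots>, T\<^sup>-\<^sup>(\<^sup>n\<^sup>-\<^sup>1\<^sup>)\<U>\<close>.\<close>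

definition iterated_join :: "'a topology \<Rightarrow> ('a \<Rightarrow> 'a) \<Rightarrow> 'a set set \<Rightarrow> nat \<Rightarrow> 'a set set"
  where "iterated_join X T \<U> n =
    {{x \<in> topspace X. \<forall>i<n. (T ^^ i) x \<in> s i} | s. \<forall>i<n. s i \<in> \<U>}"

definition cover_entropy :: "'a topology \<Rightarrow> ('a \<Rightarrow> 'a) \<Rightarrow> 'a set set \<Rightarrow> ereal"
  where "cover_entropy X T \<U> =
    limsup (\<lambda>n. ereal (ln (real (min_subcover_card X (iterated_join X T \<U> n))) / real n))"

definition topological_entropy :: "'a topology \<Rightarrow> ('a \<Rightarrow> 'a) \<Rightarrow> ereal"
  where "topological_entropy X T = (SUP \<U>\<in>Collect (open_cover X). cover_entropy X T \<U>)"

definition residual :: "'a::topological_space set \<Rightarrow> bool"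
  where "residual G \<longleftrightarrow>
    (\<exists>\<G>. countable \<G> \<and> (\<forall>U\<in>\<G>. open U \<and> closure U = UNIV) \<and> \<Inter>\<G> \<subseteq> G)"

definition fibre :: "(circle \<times> real) set \<Rightarrow> circle \<Rightarrow> real set"
  where "fibre A \<theta> = {x. (\<theta>, x) \<in> A}"

definition strip :: "(circle \<times> real) set \<Rightarrow> bool"
  where "strip B \<longleftrightarrow> B \<subseteq> Omega \<and> closed B \<and> fst ` B = UNIV \<and>
    (\<exists>G. residual G \<and> (\<forall>\<theta>\<in>G. \<exists>a b. a \<le> b \<and> fibre B \<theta> = {a..b}))"

definition core :: "(circle \<times> real) set \<Rightarrow> (circle \<times> real) set"
  where "core A = (\<Inter>G\<in>Collect residual. closure (A \<inter> fst -` G))"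

definition band :: "(circle \<times> real) set \<Rightarrow> bool"
  where "band A \<longleftrightarrow> strip A \<and> core A = A"

text \<open>The fibres of a strip are compact and nonempty, so that the maximum and the minimum
  exist.\<close>

definition upper_bd :: "(circle \<times> real) set \<Rightarrow> circle \<Rightarrow> real"
  where "upper_bd A \<theta> = (GREATEST x. x \<in> fibre A \<theta>)"

definition lower_bd :: "(circle \<times> real) set \<Rightarrow> circle \<Rightarrow> real"
  where "lower_bd A \<theta> = (LEAST x. x \<in> fibre A \<theta>)"

definition strip_less :: "(circle \<times> real) set \<Rightarrow> (circle \<times> real) set \<Rightarrow> bool"
  where "strip_less A B \<longleftrightarrow> (\<exists>G. residual G \<and> (\<forall>\<theta>\<in>G. upper_bd A \<theta> < lower_bd B \<theta>))"

definition strips_ordered :: "(circle \<times> real) set \<Rightarrow> (circle \<times> real) set \<Rightarrow> bool"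
  where "strips_ordered A B \<longleftrightarrow> strip_less A B \<or> strip_less B A"

definition periodic_strip ::
    "(circle \<times> real \<Rightarrow> circle \<times> real) \<Rightarrow> nat \<Rightarrow> (circle \<times> real) set \<Rightarrow> bool"
  where "periodic_strip F p A \<longleftrightarrow> p \<ge> 1 \<and> (F ^^ p) ` A = A \<and>
    (\<forall>i<p. strip ((F ^^ i) ` A)) \<and>
    (\<forall>i<p. \<forall>j<p. i \<noteq> j \<longrightarrow>
       (F ^^ i) ` A \<inter> (F ^^ j) ` A = {} \<and> strips_ordered ((F ^^ i) ` A) ((F ^^ j) ` A))"

definition periodic_orbit_of_strips ::
    "(circle \<times> real \<Rightarrow> circle \<times> real) \<Rightarrow> nat \<Rightarrow> (circle \<times> real) set set \<Rightarrow> bool"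
  where "periodic_orbit_of_strips F p P \<longleftrightarrow>
    (\<exists>A. periodic_strip F p A \<and> P = (\<lambda>i. (F ^^ i) ` A) ` {..<p})"

definition periodic_orbit_of_bands ::
    "(circle \<times> real \<Rightarrow> circle \<times> real) \<Rightarrow> nat \<Rightarrow> (circle \<times> real) set set \<Rightarrow> bool"
  where "periodic_orbit_of_bands F p P \<longleftrightarrow> periodic_orbit_of_strips F p P \<and> (\<forall>B\<in>P. band B)"

text \<open>Only the values at odd \<open>q\<close> are meaningful. The polynomial is nonzero of odd degree, so
  that its set of real roots is finite and nonempty.\<close>

definition lambda :: "nat \<Rightarrow> real"
  where "lambda q = (if q = 1 then 1 else Max {x. x ^ q - 2 * x ^ (q - 2) - 1 = 0})"

end

theory Submission
  imports Defs "HOL-Real_Asymp.Real_Asymp"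
begin

text \<open>Lower bound. Replacing \<open>F\<close> by \<open>F ^^ 2^n\<close>, the strips have odd period \<open>q \<ge> 3\<close>. By Baire's theorem there
  is a fibre along whose forward orbit the strips are ordered in the same way; picking one orbit in
  each strip gives a nonautonomous system of interval maps with \<open>q\<close> points that are permuted by a
  \<open>q\<close>-cycle \<open>\<sigma>\<close> of the ranks and, the strips being disjoint and compact, stay \<open>\<delta>\<close>-separated. By the
  intermediate value theorem and uniform continuity its orbits are at least as numerous as the paths
  in the Markov graph of \<open>\<sigma>\<close>. If there were fewer than \<open>\<lambda>\<^sub>q\<^sup>m\<close> paths of length \<open>m\<close>, then
  \<open>\<sigma>\<close> would be realized by an \<open>s\<close>-Lipschitz map of the line with \<open>s < \<lambda>\<^sub>q\<close>. But a Lipschitz map with an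
  orbit of odd period \<open>q\<close> has \<open>s^q \<ge> 2 s^(q-2) + 1\<close>: around a suitable fixed point some orbit point stays
  on its side, whereas a point closer to the fixed point changes sides, and the slope of this fold is
  estimated through the distances to the fixed point, which grow at most by the factor \<open>s\<close> in each step.

  Sharpness. The tent map of slope \<open>\<lambda>\<^sub>q\<close> has a turning point of period \<open>q\<close>; \<open>n\<close> successive doublings
  give an interval map of period \<open>2^n q\<close>, and \<open>F\<^sub>m\<close> is its product with a rotation. Only the upper
  bound of its entropy has to be computed, by counting orbits.\<close>

section \<open>Lipschitz maps with an orbit of odd period\<close>

text \<open>Only the fibre maps along one orbit of the rotation are at hand, and they may all
  differ, so results on the entropy of a single interval map do not apply. What the fibres share is
  the cycle \<open>\<sigma>\<close> and the constant \<delta>; the growth has to be read off from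
  the Markov graph alone. The bound on that growth avoids both a classification of cycles and
  spectral theory. If path counts grow too slowly, summing them with weights
  \<open>s ^ (- n)\<close> gives a positive vector \<open>l\<close> that the transition operator
  maps below \<open>s * l\<close>. Taken as gap lengths, \<open>l\<close> turns the combinatorial
  question into a metric one about a single Lipschitz map. There the polynomial comes from one fold:
  its two laps give \<open>2 * A + B \<le> s * D\<close>, where \<open>A\<close> is the overshoot
  beyond the fixed point, \<open>B\<close> the distance of an orbit point to it, and
  \<open>D\<close> the width. With \<open>A \<ge> D / s\<close> and
  \<open>B \<ge> D / s ^ (q - 1)\<close> this is
  \<open>2 * s ^ (q - 2) + 1 \<le> s ^ q\<close>.\<close>

lemma first_zero:
  fixes h :: "real \<Rightarrow> real"
  assumes "continuous_on {c..d} h" "c \<le> d" "h c > 0" "h d \<le> 0"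
  obtains z where "c < z" "z \<le> d" "h z = 0" "\<And>u. c \<le> u \<Longrightarrow> u < z \<Longrightarrow> h u > 0"
proof -
  define S where "S = {u \<in> {c..d}. h u = 0}"
  have zero: "\<exists>u. c \<le> u \<and> u \<le> e \<and> h u = 0" if "c \<le> e" "e \<le> d" "h e \<le> 0" for e
  proof -
    have "continuous_on {c..e} h" by (rule continuous_on_subset[OF assms(1)]) (use that in auto)
    then show ?thesis using IVT2'[of h e 0 c] assms(3) that by auto
  qed
  have ne: "S \<noteq> {}" using zero[of d] assms by (auto simp: S_def)
  have "closed S" unfolding S_def
    using continuous_closed_preimage_constant[OF assms(1)] by simp
  moreover have "bounded S"
    by (rule bounded_subset[OF bounded_closed_interval[of c d]]) (auto simp: S_def)
  ultimately have "compact S" by (simp add: compact_eq_bounded_closed)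
  then obtain z where z: "z \<in> S" "\<And>u. u \<in> S \<Longrightarrow> z \<le> u"
    using compact_attains_inf[OF _ ne] by blast
  show ?thesis
  proof (rule that[of z])
    show pos: "h u > 0" if u: "c \<le> u" "u < z" for u
    proof (rule ccontr)
      assume "\<not> h u > 0"
      then obtain v where "c \<le> v" "v \<le> u" "h v = 0"
        using zero[of u] u z(1) by (auto simp: S_def)
      then show False using z u by (force simp: S_def)
    qed
    show "c < z" using z(1) assms(3) by (cases "c = z") (auto simp: S_def)
  qed (use z in \<open>auto simp: S_def\<close>)
qed

section \<open>An orbit of odd period under a map with too small a Lipschitz constant\<close>

locale slow_odd_orbit =
  fixes g :: "real \<Rightarrow> real" and x :: "nat \<Rightarrow> real" and q :: nat and s :: real
  assumes lip: "\<bar>g u - g v\<bar> \<le> s * \<bar>u - v\<bar>"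
    and orbit_step: "g (x k) = x (Suc k)"
    and periodic: "x (k + q) = x k"
    and inj: "inj_on x {..<q}"
    and odd_q: "odd q" and q_ge_3: "q \<ge> 3"
    and slow: "s ^ q < 2 * s ^ (q - 2) + 1"
begin

text \<open>Conjugation by \<open>u \<mapsto> - u\<close> preserves all assumptions, so that each
  one-sided estimate below also yields its mirror image.\<close>

lemma reflection: "slow_odd_orbit (\<lambda>u. - g (- u)) (\<lambda>k. - x k) q s"
proof
  show "\<bar>- g (- u) - - g (- v)\<bar> \<le> s * \<bar>u - v\<bar>" for u v
    using lip[of "-v" "-u"] by (simp add: abs_minus_commute)
  show "inj_on (\<lambda>k. - x k) {..<q}"
    using inj by (simp add: inj_on_def)
qed (use orbit_step periodic odd_q q_ge_3 slow in auto)

lemma x_mod: "x (k mod q) = x k"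
proof -
  have "x (j + m * q) = x j" for j m
  proof (induction m)
    case (Suc m)
    then show ?case using periodic[of "j + m * q"] by (simp add: ac_simps)
  qed auto
  from this[of "k mod q" "k div q"] show ?thesis by simp
qed

lemma range_x: "range x = x ` {..<q}"
proof -
  have "x k \<in> x ` {..<q}" for k
    using x_mod[of k] q_ge_3 by (intro image_eqI[of _ _ "k mod q"]) auto
  then show ?thesis by auto
qed

lemma finite_orbit: "finite (range x)" and card_orbit: "card (range x) = q"
  using range_x inj by (auto simp: card_image)

lemma g_range: "u \<in> range x \<Longrightarrow> g u \<in> range x"
  using orbit_step by auto

lemma reach:
  assumes "u \<in> range x" "v \<in> range x"
  shows "\<exists>k<q. v = (g ^^ k) u"
proof -
  obtain i where i: "u = x i" "i < q" using assms(1) range_x by auto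
  obtain j where j: "v = x j" "j < q" using assms(2) range_x by auto
  have it: "(g ^^ k) (x i) = x (i + k)" for k
    by (induction k) (use orbit_step in auto)
  show ?thesis
  proof (cases "i \<le> j")
    case True
    then show ?thesis using it[of "j - i"] i j by (intro exI[of _ "j - i"]) auto
  next
    case False
    then show ?thesis using it[of "j + q - i"] i j periodic[of j]
      by (intro exI[of _ "j + q - i"]) auto
  qed
qed

text \<open>A periodic orbit is transitive on itself. Most contradictions below have this form: a
  set traps the orbit but misses one of its extreme points or a preimage of one.\<close>

lemma invariant:
  assumes "u \<in> range x" "u \<in> V" "\<And>v. v \<in> range x \<Longrightarrow> v \<in> V \<Longrightarrow> g v \<in> V"
  shows "range x \<subseteq> V"
proof
  fix v assume "v \<in> range x"
  then obtain k where k: "v = (g ^^ k) u" using reach[OF assms(1)] by blast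
  have "(g ^^ k) u \<in> V \<and> (g ^^ k) u \<in> range x" for k
    by (induction k) (use assms g_range in auto)
  then show "v \<in> V" using k by simp
qed

lemma pred_exists:
  assumes "v \<in> range x" shows "\<exists>u\<in>range x. g u = v"
proof -
  obtain j where j: "v = x j" using assms by auto
  have "g (x (j + (q - 1))) = x (j + q)"
    using orbit_step[of "j + (q - 1)"] q_ge_3 by simp
  then show ?thesis using j periodic[of j] by auto
qed

lemma g_inj: "inj_on g (range x)"
proof (rule eq_card_imp_inj_on[OF finite_orbit])
  have "g ` range x = range x"
  proof
    show "g ` range x \<subseteq> range x" using g_range by (intro image_subsetI)
    show "range x \<subseteq> g ` range x"
      using pred_exists by (intro subsetI) (metis imageI)
  qed
  then show "card (g ` range x) = card (range x)" by simp
qed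

lemma no_fixed_point: "u \<in> range x \<Longrightarrow> g u \<noteq> u"
proof
  assume u: "u \<in> range x" and "g u = u"
  then have "range x \<subseteq> {u}" using invariant[of u "{u}"] by auto
  then have "card (range x) \<le> card {u}" by (intro card_mono) auto
  then show False using card_orbit q_ge_3 by simp
qed

text \<open>Both ends of the hull of the orbit are images of orbit points, so the hull cannot
  shrink.\<close>

lemma s_ge_1: "s \<ge> 1"
proof -
  let ?a = "Min (range x)" and ?b = "Max (range x)"
  have mem: "?a \<in> range x" "?b \<in> range x" using finite_orbit by (auto intro!: Min_in Max_in)
  have bd: "?a \<le> u" "u \<le> ?b" if "u \<in> range x" for u using finite_orbit that by auto
  obtain a' b' where a': "a' \<in> range x" "g a' = ?a" and b': "b' \<in> range x" "g b' = ?b"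
    using pred_exists mem by metis
  have "?a \<noteq> ?b"
  proof
    assume "?a = ?b"
    then have "g ?a = ?a" using bd[of ?a] bd[of "g ?a"] g_range[OF mem(1)] by auto
    then show False using no_fixed_point mem by blast
  qed
  with bd mem have lt: "?a < ?b" by (meson order_less_le)
  have s0: "s \<ge> 0" using lip[of 1 0] by auto
  have "?b - ?a \<le> s * \<bar>b' - a'\<bar>" using lip[of b' a'] a' b' by auto
  also have "\<dots> \<le> s * (?b - ?a)"
    using bd[OF a'(1)] bd[OF b'(1)] s0 by (intro mult_left_mono) auto
  finally show ?thesis using lt by simp
qed

lemma s_less_2: "s < 2"
proof (rule ccontr)
  assume "\<not> s < 2"
  then have s: "s \<ge> 2" by simp
  have "q - 2 + 2 = q" using q_ge_3 by simp
  then have "s ^ q = s ^ (q - 2) * s ^ 2" by (metis power_add)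
  also have "\<dots> \<ge> s ^ (q - 2) * 4"
    using s power_mono[of 2 s 2] by (intro mult_left_mono) auto
  finally have "s ^ q \<ge> 4 * s ^ (q - 2)" by simp
  moreover have "s ^ (q - 2) \<ge> 1" using s by (intro one_le_power) auto
  ultimately show False using slow by linarith
qed

text \<open>Two adjacent intervals inside one of length \<open>D\<close> cannot both have end points
  whose images are at least \<open>D\<close> apart. Several arguments below end with this.\<close>

lemma s_double: "0 < D \<Longrightarrow> s * D < 2 * D"
  using s_less_2 by (rule mult_strict_right_mono)

text \<open>The orbit gets from \<open>u\<close> to \<open>v\<close> in at most \<open>q - 1\<close>
  steps, each of which multiplies the distance to the fixed point by at most
  \<open>s\<close>.\<close>

lemma far:
  assumes "g z = z" "u \<in> range x" "v \<in> range x"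
  shows "\<bar>v - z\<bar> \<le> s ^ (q - 1) * \<bar>u - z\<bar>"
proof -
  obtain k where k: "v = (g ^^ k) u" "k < q" using reach[OF assms(2,3)] by blast
  have "\<bar>(g ^^ k) u - z\<bar> \<le> s ^ k * \<bar>u - z\<bar>" for k
  proof (induction k)
    case (Suc k)
    have "\<bar>(g ^^ Suc k) u - z\<bar> \<le> s * \<bar>(g ^^ k) u - z\<bar>"
      using lip[of "(g ^^ k) u" z] assms(1) by simp
    also have "\<dots> \<le> s * (s ^ k * \<bar>u - z\<bar>)"
      using Suc s_ge_1 by (intro mult_left_mono) auto
    finally show ?case by (simp add: mult.assoc)
  qed auto
  from this[of k] have "\<bar>v - z\<bar> \<le> s ^ k * \<bar>u - z\<bar>" using k by simp
  also have "\<dots> \<le> s ^ (q - 1) * \<bar>u - z\<bar>"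
    using k s_ge_1 by (intro mult_right_mono power_increasing) auto
  finally show ?thesis .
qed

text \<open>The source of the polynomial. The laps from \<open>y\<close> to \<open>w\<close> and
  from \<open>w\<close> to \<open>z\<close> add up to
  \<open>2 * (g w - z) + (z - g y) \<le> s * (z - y)\<close>. By \<open>far\<close>,
  \<open>z - g y\<close> is at least \<open>(z - y) / s ^ (q - 1)\<close>, so that
  \<open>g w - z \<ge> (z - y) / s\<close> would contradict \<open>slow\<close>.\<close>

lemma no_fold:
  assumes "g z = z" "y \<in> range x" "y < w" "w < z" "g y < z" "z < g w"
  shows "s * (g w - z) < z - y"
proof (rule ccontr)
  assume "\<not> ?thesis"
  then have le: "z - y \<le> s * (g w - z)" by simp
  have 1: "g w - g y \<le> s * (w - y)" using lip[of w y] assms by auto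
  have 2: "g w - z \<le> s * (z - w)" using lip[of w z] assms by auto
  have 3: "z - y \<le> s ^ (q - 1) * (z - g y)"
    using far[of z "g y" y] assms g_range by auto
  have 4: "2 * (g w - z) + (z - g y) \<le> s * (z - y)" using 1 2 by (simp add: algebra_simps)
  define D where "D = z - y"
  have D: "D > 0" using assms by (simp add: D_def)
  have sp: "s > 0" using s_ge_1 by simp
  have e1: "s ^ (q - 1) = s ^ (q - 2) * s" "s ^ q = s ^ (q - 1) * s"
    using q_ge_3 by (simp_all flip: power_Suc2 add: Suc_diff_le numeral_2_eq_2 Suc_diff_Suc)
  have "s ^ (q - 1) * (2 * (g w - z)) + s ^ (q - 1) * (z - g y) \<le> s ^ (q - 1) * (s * D)"
    using mult_left_mono[OF 4, of "s ^ (q - 1)"] sp by (simp add: D_def algebra_simps)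
  moreover have "s ^ (q - 1) * (2 * (g w - z)) \<ge> 2 * s ^ (q - 2) * D"
  proof -
    have "2 * s ^ (q - 2) * D \<le> 2 * s ^ (q - 2) * (s * (g w - z))"
      using le sp by (intro mult_left_mono) (auto simp: D_def)
    also have "\<dots> = s ^ (q - 1) * (2 * (g w - z))" unfolding e1(1) by (simp only: mult_ac)
    finally show ?thesis .
  qed
  ultimately have "2 * s ^ (q - 2) * D + D \<le> s ^ q * D"
    using 3 by (simp add: e1 D_def algebra_simps)
  then have "(2 * s ^ (q - 2) + 1) * D \<le> s ^ q * D" by (simp add: algebra_simps)
  then show False using slow D by simp
qed

lemma no_fold':
  assumes "g z = z" "y \<in> range x" "w < y" "z < w" "z < g y" "g w < z"
  shows "s * (z - g w) < y - z"
proof -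
  interpret r: slow_odd_orbit "\<lambda>u. - g (- u)" "\<lambda>k. - x k" q s by (rule reflection)
  show ?thesis using r.no_fold[of "-z" "-y" "-w"] assms by auto
qed

lemma cont: "continuous_on S g"
proof (rule continuous_on_subset[OF _ subset_UNIV])
  have "s-lipschitz_on UNIV g"
    using lip s_ge_1 by (intro lipschitz_onI) (auto simp: dist_real_def)
  then show "continuous_on UNIV g" by (rule lipschitz_on_continuous_on)
qed

end


section \<open>Extremes of the orbit, their preimages, and the fixed points between these\<close>

locale slow_odd_orbit_extremes = slow_odd_orbit +
  fixes a b a' b' :: real
  assumes a_le: "u \<in> range x \<Longrightarrow> a \<le> u" and le_b: "u \<in> range x \<Longrightarrow> u \<le> b"
    and a': "a' \<in> range x" "g a' = a" and b': "b' \<in> range x" "g b' = b"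
begin

lemma extremes_reflection:
  "slow_odd_orbit_extremes (\<lambda>u. - g (- u)) (\<lambda>k. - x k) q s (- b) (- a) (- b') (- a')"
proof -
  interpret r: slow_odd_orbit "\<lambda>u. - g (- u)" "\<lambda>k. - x k" q s by (rule reflection)
  show ?thesis by standard (use a_le le_b a' b' in auto)
qed

lemma ab_range: "a \<in> range x" "b \<in> range x"
  using g_range a' b' by auto

lemma b'_less_b: "b' < b" and a_less_a': "a < a'"
proof -
  show "b' < b" using le_b[OF b'(1)] no_fixed_point[OF b'(1)] b'(2) by auto
  show "a < a'" using a_le[OF a'(1)] no_fixed_point[OF a'(1)] a'(2) by auto
qed

text \<open>Otherwise let \<open>z\<close> be the first fixed point to the right of
  \<open>a'\<close>. The orbit has to get beyond \<open>z\<close>, and the point \<open>p\<close>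
  that jumps over it lies to the left of \<open>a'\<close>. The laps from \<open>p\<close> to
  \<open>a'\<close> and from \<open>a'\<close> to \<open>z\<close> then both have images of length
  at least \<open>z - a\<close>, inside an interval of that length.\<close>

lemma b'_less_a': "b' < a'"
proof (rule ccontr)
  assume "\<not> b' < a'"
  then have le: "a' \<le> b'" by simp
  have c: "continuous_on {a'..b'} (\<lambda>u. u - g u)" by (intro continuous_intros cont)
  have "a' - g a' > 0" "b' - g b' \<le> 0" using a_less_a' b'_less_b a' b' by auto
  from first_zero[OF c le this] obtain z where z: "a' < z" "z \<le> b'" "z - g z = 0"
      "\<And>u. a' \<le> u \<Longrightarrow> u < z \<Longrightarrow> u - g u > 0"
    by blast
  have "\<exists>p\<in>range x. p \<le> z \<and> g p > z"
  proof (rule ccontr)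
    assume "\<not> ?thesis"
    then have "range x \<subseteq> {..z}" using invariant[of a' "{..z}"] a' z(1) by force
    then show False using ab_range(2) b'_less_b z by force
  qed
  then obtain p where p: "p \<in> range x" "p \<le> z" "g p > z" by blast
  have "p \<noteq> z" using p z(3) by auto
  have "p < a'"
  proof (rule ccontr)
    assume "\<not> p < a'"
    then show False using z(4)[of p] p \<open>p \<noteq> z\<close> by auto
  qed
  then have "g p - a \<le> s * (a' - p)" using lip[of p a'] a' by auto
  also have "\<dots> \<le> s * (a' - a)" using a_le[OF p(1)] s_ge_1 by (intro mult_left_mono) auto
  finally have 1: "z - a < s * (a' - a)" using p by simp
  have 2: "z - a \<le> s * (z - a')" using lip[of z a'] a' z by auto
  have "2 * (z - a) < s * (z - a)" using 1 2 by (simp add: algebra_simps)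
  then show False using s_double[of "z - a"] z(1) a_less_a' by simp
qed

text \<open>Otherwise \<open>y < b' < z\<close> is a fold with peak value \<open>b\<close>, and
  \<open>no_fold\<close> gives \<open>s * (b - z) < z - a\<close>. But \<open>a'\<close> is mapped
  to \<open>a\<close>, so \<open>z - a\<close> is at most \<open>s * (a' - z)\<close>, and
  \<open>a' \<le> b\<close>.\<close>

lemma left_of_b':
  assumes "g z = z" "b' < z" "z < a'" "y \<in> range x" "y \<le> b'"
  shows "z < g y"
proof (rule ccontr)
  assume "\<not> z < g y"
  moreover have "g y \<noteq> z"
    using no_fixed_point[OF g_range[OF assms(4)]] assms(1) by metis
  ultimately have gy: "g y < z" by simp
  have bz: "b > z" using le_b[OF a'(1)] assms by simp
  have az: "a < z" using a_le[OF b'(1)] assms by simp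
  have "y \<noteq> b'" using gy bz b' by auto
  then have "s * (g b' - z) < z - y"
    using no_fold[of z y b'] assms gy bz b' by auto
  also have "\<dots> \<le> z - a" using a_le[OF assms(4)] by simp
  also have "\<dots> \<le> s * (a' - z)" using lip[of a' z] a' assms az by auto
  also have "\<dots> \<le> s * (b - z)" using le_b[OF a'(1)] s_ge_1 by (intro mult_left_mono) auto
  finally show False using b' by simp
qed

lemma right_of_a':
  assumes "g z = z" "b' < z" "z < a'" "y \<in> range x" "a' \<le> y"
  shows "g y < z"
proof -
  interpret r: slow_odd_orbit_extremes "\<lambda>u. - g (- u)" "\<lambda>k. - x k" q s "-b" "-a" "-b'" "-a'"
    by (rule extremes_reflection)
  show ?thesis using r.left_of_b'[of "-z" "-y"] assms by auto
qed

text \<open>In the application \<open>{d..e}\<close> is the hull of the fixed points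
  \<open>zl\<close>, \<open>zr\<close> and of the images of the orbit points between them. If
  \<open>v\<close> were mapped below \<open>d\<close>, there would be two adjacent laps that are too
  long for \<open>s_double\<close>: those of \<open>w < y < v\<close>, both with images of length at
  least \<open>e - d\<close>, or those of \<open>zl < y < w\<close>, both with images of length at
  least \<open>e - zl\<close>.\<close>

lemma middle_trap:
  assumes zl: "g zl = zl" "b' < zl" "zl \<le> zr" and zr: "g zr = zr" "zr < a'"
    and inward: "\<And>u. zr < u \<Longrightarrow> u \<le> a' \<Longrightarrow> g u < u"
    and d: "d \<le> zl" "d = zl \<or> (\<exists>w\<in>{zl<..<zr}. d = g w)"
    and e: "zr \<le> e" "e = zr \<or> (\<exists>y\<in>{zl<..<zr}. e = g y)"
    and v: "v \<in> range x" "zr < v" "v \<le> e"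
  shows "d \<le> g v" "g v \<le> e"
proof -
  show "g v \<le> e"
    using inward[of v] right_of_a'[of zr v] zl zr v by (cases "v \<le> a'") auto
  show "d \<le> g v"
  proof (rule ccontr)
    assume "\<not> d \<le> g v"
    then have gv: "g v < d" by simp
    obtain y where y: "zl < y" "y < zr" "e = g y" using e v by auto
    have "\<exists>w\<ge>zl. w < zr \<and> d = g w"
    proof (cases "d = zl")
      case True
      then show ?thesis using zl y by (intro exI[of _ zl]) auto
    next
      case False
      then obtain w where "zl < w" "w < zr" "d = g w" using d(2) by auto
      then show ?thesis by (intro exI[of _ w]) auto
    qed
    then obtain w where w: "zl \<le> w" "w < zr" "d = g w" by blast
    have "w \<noteq> y" using w y d e zl by auto
    then consider "w < y" | "y < w" by linarith
    then show False
    proof cases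
      case 1
      have "e - d \<le> s * (y - w)" using lip[of y w] 1 w y by auto
      moreover have "e - g v \<le> s * (v - y)" using lip[of y v] w y v by auto
      ultimately have "2 * (e - d) < s * (v - w)" using gv by (simp add: algebra_simps)
      also have "\<dots> \<le> s * (e - d)" using s_ge_1 v w d by (intro mult_left_mono) auto
      finally show False using s_double[of "e - d"] e(1) v d(1) zl by simp
    next
      case 2
      have "e - zl \<le> s * (y - zl)" using lip[of y zl] y zl by auto
      moreover have "e - d \<le> s * (w - y)" using lip[of y w] 2 w y by auto
      ultimately have "2 * (e - zl) \<le> s * (w - zl)" using d by (simp add: algebra_simps)
      also have "\<dots> \<le> s * (e - zl)" using s_ge_1 e w by (intro mult_left_mono) auto
      finally show False using s_double[of "e - zl"] e(1) v zl by simp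
    qed
  qed
qed

lemma middle_trap':
  assumes zl: "g zl = zl" "b' < zl" "zl \<le> zr" and zr: "g zr = zr" "zr < a'"
    and inward: "\<And>u. b' \<le> u \<Longrightarrow> u < zl \<Longrightarrow> u < g u"
    and d: "d \<le> zl" "d = zl \<or> (\<exists>w\<in>{zl<..<zr}. d = g w)"
    and e: "zr \<le> e" "e = zr \<or> (\<exists>y\<in>{zl<..<zr}. e = g y)"
    and v: "v \<in> range x" "v < zl" "d \<le> v"
  shows "d \<le> g v" "g v \<le> e"
proof -
  interpret r: slow_odd_orbit_extremes "\<lambda>u. - g (- u)" "\<lambda>k. - x k" q s "-b" "-a" "-b'" "-a'"
    by (rule extremes_reflection)
  have neg: "(\<exists>w\<in>{-zr<..<-zl}. - t = - g (- w)) \<longleftrightarrow> (\<exists>w\<in>{zl<..<zr}. t = g w)" for t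
  proof
    assume "\<exists>w\<in>{zl<..<zr}. t = g w"
    then obtain w where "w \<in> {zl<..<zr}" "t = g w" by blast
    then show "\<exists>w\<in>{-zr<..<-zl}. - t = - g (- w)" by (intro bexI[of _ "-w"]) auto
  next
    assume "\<exists>w\<in>{-zr<..<-zl}. - t = - g (- w)"
    then obtain w where "w \<in> {-zr<..<-zl}" "- t = - g (- w)" by blast
    then show "\<exists>w\<in>{zl<..<zr}. t = g w" by (intro bexI[of _ "-w"]) auto
  qed
  have inw: "- g (- u) < u" if "- zl < u" "u \<le> - b'" for u
    using inward[of "-u"] that by simp
  have "- e \<le> - g (- (- v)) \<and> - g (- (- v)) \<le> - d"
    using r.middle_trap[of "-zr" "-zl" "-e" "-d" "-v"] assms inw unfolding neg by auto
  then show "d \<le> g v" "g v \<le> e" by auto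
qed

text \<open>If there were orbit points in between, the hull \<open>{d..e}\<close> of
  \<open>zl\<close>, \<open>zr\<close> and their images would trap the orbit and hence reach down to
  \<open>a\<close>. Since \<open>a < zl\<close>, the bound \<open>d\<close> is then an image of one
  of these points, which by injectivity is \<open>a'\<close>; but \<open>a'\<close> lies to the
  right of \<open>zr\<close>.\<close>

lemma middle_empty:
  assumes zl: "g zl = zl" "b' < zl" "zl \<le> zr" and zr: "g zr = zr" "zr < a'"
    and inward_left: "\<And>u. b' \<le> u \<Longrightarrow> u < zl \<Longrightarrow> u < g u"
    and inward_right: "\<And>u. zr < u \<Longrightarrow> u \<le> a' \<Longrightarrow> g u < u"
  shows "range x \<inter> {zl<..<zr} = {}"
proof (rule ccontr)
  assume ne: "range x \<inter> {zl<..<zr} \<noteq> {}"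
  define M where "M = range x \<inter> {zl<..<zr}"
  have fin: "finite M" unfolding M_def using finite_orbit by simp
  define d where "d = Min (insert zl (g ` M))"
  define e where "e = Max (insert zr (g ` M))"
  have d_in: "d \<in> insert zl (g ` M)" unfolding d_def using fin by (intro Min_in) auto
  have e_in: "e \<in> insert zr (g ` M)" unfolding e_def using fin by (intro Max_in) auto
  have d_le: "d \<le> zl" "\<And>v. v \<in> M \<Longrightarrow> d \<le> g v" unfolding d_def using fin by auto
  have e_ge: "zr \<le> e" "\<And>v. v \<in> M \<Longrightarrow> g v \<le> e" unfolding e_def using fin by auto
  have d_ex: "d = zl \<or> (\<exists>w\<in>{zl<..<zr}. d = g w)" using d_in by (auto simp: M_def)
  have e_ex: "e = zr \<or> (\<exists>w\<in>{zl<..<zr}. e = g w)" using e_in by (auto simp: M_def)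
  have step: "g v \<in> {d..e}" if v: "v \<in> range x" "v \<in> {d..e}" for v
  proof -
    have "v \<noteq> zl" "v \<noteq> zr" using no_fixed_point v zl zr by auto
    then consider "v < zl" | "v \<in> M" | "v > zr"
      using v(1) unfolding M_def by (metis IntI greaterThanLessThan_iff linorder_cases)
    then show ?thesis
    proof cases
      case 1
      then show ?thesis
        using middle_trap'[OF zl zr inward_left d_le(1) d_ex e_ge(1) e_ex v(1)] v(2) by auto
    next
      case 3
      then show ?thesis
        using middle_trap[OF zl zr inward_right d_le(1) d_ex e_ge(1) e_ex v(1)] v(2) by auto
    qed (use d_le e_ge in auto)
  qed
  obtain u where u: "u \<in> M" using ne unfolding M_def by blast
  then have "range x \<subseteq> {d..e}"
    using invariant[of u "{d..e}"] step d_le(1) e_ge(1) by (auto simp: M_def)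
  then have "d \<le> a" using ab_range by auto
  then have "d < zl" using a_le[OF b'(1)] zl by simp
  then obtain w where w: "w \<in> M" "d = g w" using d_in by auto
  then have "d \<in> range x" using g_range by (auto simp: M_def)
  then have "g w = g a'" using \<open>d \<le> a\<close> a_le[of d] a' w by simp
  then have "w = a'" using inj_onD[OF g_inj] w a' by (auto simp: M_def)
  then show False using w zr by (auto simp: M_def)
qed

text \<open>Among the orbit points that stay on their side of \<open>z\<close>, \<open>y\<close> is
  the farthest from \<open>z\<close>. Those points move inward, and the points closer to
  \<open>z\<close> that change sides overshoot little by \<open>no_fold\<close>. The orbit is thus
  trapped near \<open>z\<close> and cannot contain \<open>b'\<close>, which lies to the left of
  \<open>y\<close>.\<close>

lemma inward_left_false:
  assumes z: "g z = z" "b' < z" "z < a'"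
    and left: "\<And>v. v \<in> range x \<Longrightarrow> v < z \<Longrightarrow> g v < z \<Longrightarrow> b' < v \<and> v < g v"
    and right: "\<And>v. v \<in> range x \<Longrightarrow> z < v \<Longrightarrow> z < g v \<Longrightarrow> v < a' \<and> g v < v"
    and y: "y \<in> range x" "y < z" "g y < z"
    and y_far_left: "\<And>v. v \<in> range x \<Longrightarrow> v < z \<Longrightarrow> g v < z \<Longrightarrow> y \<le> v"
    and y_far_right: "\<And>v. v \<in> range x \<Longrightarrow> z < v \<Longrightarrow> z < g v \<Longrightarrow> v - z \<le> z - y"
  shows False
proof -
  have neq: "v \<noteq> z" if "v \<in> range x" for v using no_fixed_point[OF that] z by auto
  \<comment> \<open>The two kinds of points on the right are those that a change of sides takes back
    into \<open>{y..z}\<close> by the Lipschitz bound alone, and those for which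
    \<open>no_fold'\<close> with the point \<open>w\<close> does so.\<close>
  define V where "V = {y..z} \<union>
    {v. z < v \<and> (s * (v - z) \<le> z - y \<or> (\<exists>w\<in>range x. z < w \<and> z < g w \<and> v \<le> w))}"
  have "g v \<in> V" if v: "v \<in> range x" "v \<in> V" for v
  proof (cases "v < z")
    case True
    then have yv: "y \<le> v" using v by (auto simp: V_def)
    show ?thesis
    proof (cases "g v < z")
      case True
      then show ?thesis using left[OF v(1) \<open>v < z\<close>] yv by (auto simp: V_def)
    next
      case False
      then have gv: "z < g v" using neq[OF g_range[OF v(1)]] by simp
      then have "y < v" using yv y by (cases "y = v") auto
      then have "s * (g v - z) < z - y" using no_fold[OF z(1) y(1)] True y gv by auto
      then show ?thesis using gv by (auto simp: V_def)
    qed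
  next
    case False
    then have zv: "z < v" using neq[OF v(1)] by simp
    show ?thesis
    proof (cases "z < g v")
      case True
      then have "g v < v" using right v zv by blast
      then have "\<exists>w\<in>range x. z < w \<and> z < g w \<and> g v \<le> w"
        using True v(1) zv by (intro bexI[of _ v]) auto
      then show ?thesis using True by (simp add: V_def)
    next
      case False
      then have gv: "g v < z" using neq[OF g_range[OF v(1)]] by simp
      have "z - g v \<le> z - y"
      proof (cases "s * (v - z) \<le> z - y")
        case True
        then show ?thesis using lip[of z v] z gv zv by auto
      next
        case False
        then obtain w where w: "w \<in> range x" "z < w" "z < g w" "v \<le> w"
          using v zv by (auto simp: V_def)
        have "v < w" using w gv by (cases "v = w") auto
        then have "s * (z - g v) < w - z" using no_fold'[OF z(1) w(1) _ zv w(3) gv] by simp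
        also have "\<dots> \<le> z - y" using y_far_right w by blast
        finally show ?thesis
          using mult_right_mono[OF s_ge_1, of "z - g v"] gv
          by (smt (verit, best) mult_1)
      qed
      then show ?thesis using gv by (auto simp: V_def)
    qed
  qed
  moreover have "y \<in> V" using y by (simp add: V_def)
  ultimately have "range x \<subseteq> V" using invariant[OF y(1), of V] by blast
  then have "b' \<in> V" using b' by blast
  then show False using left[OF y] z by (auto simp: V_def)
qed

lemma inward_right_false:
  assumes z: "g z = z" "b' < z" "z < a'"
    and left: "\<And>v. v \<in> range x \<Longrightarrow> v < z \<Longrightarrow> g v < z \<Longrightarrow> b' < v \<and> v < g v"
    and right: "\<And>v. v \<in> range x \<Longrightarrow> z < v \<Longrightarrow> z < g v \<Longrightarrow> v < a' \<and> g v < v"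
    and y: "y \<in> range x" "z < y" "z < g y"
    and y_far_left: "\<And>v. v \<in> range x \<Longrightarrow> v < z \<Longrightarrow> g v < z \<Longrightarrow> z - v \<le> y - z"
    and y_far_right: "\<And>v. v \<in> range x \<Longrightarrow> z < v \<Longrightarrow> z < g v \<Longrightarrow> v \<le> y"
  shows False
proof -
  interpret r: slow_odd_orbit_extremes "\<lambda>u. - g (- u)" "\<lambda>k. - x k" q s "-b" "-a" "-b'" "-a'"
    by (rule extremes_reflection)
  have mem: "v \<in> range (\<lambda>k. - x k) \<longleftrightarrow> - v \<in> range x" for v
    by (auto simp: image_iff) (metis minus_minus)
  show False
  proof (rule r.inward_left_false[of "-z" "-y"], unfold mem)
    fix v assume v: "- v \<in> range x"
    show "- a' < v \<and> v < - g (- v)" if "v < - z" "- g (- v) < - z"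
      using right[OF v] that by auto
    show "v < - b' \<and> - g (- v) < v" if "- z < v" "- z < - g (- v)"
      using left[OF v] that by auto
    show "- y \<le> v" if "v < - z" "- g (- v) < - z"
      using y_far_right[OF v] that by auto
    show "v - - z \<le> - z - - y" if "- z < v" "- z < - g (- v)"
      using y_far_left[OF v] that by auto
  qed (use z y in auto)
qed

lemma contradiction: False
proof -
  have c: "continuous_on {b'..a'} (\<lambda>u. g u - u)" by (intro continuous_intros cont)
  have "b' \<le> a'" "g b' - b' > 0" "g a' - a' \<le> 0"
    using b'_less_a' a_less_a' b'_less_b a' b' by auto
  from first_zero[OF c this] obtain zl where zl: "b' < zl" "zl \<le> a'" "g zl - zl = 0"
      "\<And>u. b' \<le> u \<Longrightarrow> u < zl \<Longrightarrow> g u - u > 0"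
    by blast
  \<comment> \<open>The last fixed point \<open>zr\<close> in \<open>{b'..a'}\<close> is obtained as
    the first one of the reflected map.\<close>
  have c: "continuous_on {-a'..-b'} (\<lambda>u. - u - g (- u))"
    by (intro continuous_intros continuous_on_compose2[OF cont[of UNIV]]) auto
  have "- a' \<le> - b'" "- (- a') - g (- (- a')) > 0" "- (- b') - g (- (- b')) \<le> 0"
    using b'_less_a' a_less_a' b'_less_b a' b' by auto
  from first_zero[OF c this] obtain m where m: "- a' < m" "m \<le> - b'" "- m - g (- m) = 0"
      "\<And>u. - a' \<le> u \<Longrightarrow> u < m \<Longrightarrow> - u - g (- u) > 0"
    by blast
  define zr where "zr = - m"
  have zr: "zr < a'" "b' \<le> zr" "g zr = zr" "\<And>u. zr < u \<Longrightarrow> u \<le> a' \<Longrightarrow> g u < u"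
    using m(1-3) m(4)[of "- u" for u] by (auto simp: zr_def)
  have zlr: "zl \<le> zr" using zl(4)[of zr] zr zl by force
  have z: "g zl = zl" "b' < zl" "zl < a'" using zl zlr zr by auto
  have empty: "range x \<inter> {zl<..<zr} = {}"
    using middle_empty[OF z(1,2) zlr zr(3,1) _ zr(4)] zl(4) by auto
  have neq: "v \<noteq> zl" "v \<noteq> zr" if "v \<in> range x" for v using no_fixed_point[OF that] z zr by auto
  have left: "b' < v \<and> v < g v" if "v \<in> range x" "v < zl" "g v < zl" for v
    using left_of_b'[OF z that(1)] that zl(4)[of v] by force
  have right: "v < a' \<and> g v < v" if v: "v \<in> range x" "zl < v" "zl < g v" for v
  proof -
    have "zr < v" using neq[OF v(1)] empty v by force
    moreover have "v < a'" using right_of_a'[OF z v(1)] v by force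
    ultimately show ?thesis using zr(4)[of v] by simp
  qed
  define N where "N = {v \<in> range x. (v < zl \<and> g v < zl) \<or> (zl < v \<and> zl < g v)}"
  \<comment> \<open>The only place where the parity is used: if every orbit point changed sides,
    \<open>g\<close> would interchange the points to the left and to the right of \<open>zl\<close>,
    and \<open>q\<close> would be even.\<close>
  have "N \<noteq> {}"
  proof
    assume "N = {}"
    then have sw: "v < zl \<longleftrightarrow> zl < g v" if "v \<in> range x" for v
      using neq that neq[OF g_range[OF that]] unfolding N_def by force
    define L where "L = range x \<inter> {..<zl}"
    define R where "R = range x \<inter> {zl<..}"
    have LR: "L \<union> R = range x" "L \<inter> R = {}" 
      using neq by (auto simp: L_def R_def) (metis linorder_less_linear rangeI)
    have fin: "finite L" "finite R" using finite_orbit by (auto simp: L_def R_def)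
    have "g ` L \<subseteq> R" using sw g_range by (auto simp: L_def R_def)
    then have 1: "card L \<le> card R"
      using card_inj_on_le[OF inj_on_subset[OF g_inj] _ fin(2), of L] by (auto simp: L_def)
    have "g ` R \<subseteq> L"
    proof (rule image_subsetI)
      fix v assume "v \<in> R"
      then have v: "v \<in> range x" "zl < v" by (auto simp: R_def)
      then show "g v \<in> L"
        using sw[OF v(1)] g_range[OF v(1)] neq[OF g_range[OF v(1)]] unfolding L_def by force
    qed
    then have "card R \<le> card L"
      using card_inj_on_le[OF inj_on_subset[OF g_inj] _ fin(1), of R] by (auto simp: R_def)
    then have "q = 2 * card L" using 1 card_orbit card_Un_disjoint[OF fin LR(2)] LR by simp
    then show False using odd_q by simp
  qed
  moreover have "finite N" using finite_orbit by (simp add: N_def)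
  ultimately obtain y where "y \<in> N" "\<bar>y - zl\<bar> = Max ((\<lambda>v. \<bar>v - zl\<bar>) ` N)"
    using obtains_MAX[of N "\<lambda>v. \<bar>v - zl\<bar>"] by metis
  then have y: "y \<in> N" "\<And>v. v \<in> N \<Longrightarrow> \<bar>v - zl\<bar> \<le> \<bar>y - zl\<bar>"
    using \<open>finite N\<close> by auto
  show False
  proof (cases "y < zl")
    case True
    show False
    proof (rule inward_left_false[OF z left right])
      show "y \<in> range x" "y < zl" "g y < zl" using y(1) True by (auto simp: N_def)
      show "y \<le> v" if "v \<in> range x" "v < zl" "g v < zl" for v
        using y(2)[of v] that True by (auto simp: N_def)
      show "v - zl \<le> zl - y" if "v \<in> range x" "zl < v" "zl < g v" for v
        using y(2)[of v] that True by (auto simp: N_def)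
    qed
  next
    case False
    show False
    proof (rule inward_right_false[OF z left right])
      show "y \<in> range x" "zl < y" "zl < g y" using y(1) False by (auto simp: N_def)
      show "zl - v \<le> y - zl" if "v \<in> range x" "v < zl" "g v < zl" for v
        using y(2)[of v] that False by (auto simp: N_def)
      show "v \<le> y" if "v \<in> range x" "zl < v" "zl < g v" for v
        using y(2)[of v] that False by (auto simp: N_def)
    qed
  qed
qed

end

lemma lipschitz_odd_orbit:
  fixes g :: "real \<Rightarrow> real"
  assumes "\<And>u v. \<bar>g u - g v\<bar> \<le> s * \<bar>u - v\<bar>" "\<And>k. g (x k) = x (Suc k)" "\<And>k. x (k + q) = x k"
    and "inj_on x {..<q}" "odd q" "q \<ge> 3"
  shows "2 * s ^ (q - 2) + 1 \<le> s ^ q"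
proof (rule ccontr)
  assume "\<not> ?thesis"
  then interpret slow_odd_orbit g x q s
    using assms by unfold_locales auto
  have ne: "range x \<noteq> {}" by auto
  have "Min (range x) \<in> range x" "Max (range x) \<in> range x"
    using finite_orbit ne by (auto intro!: Min_in Max_in)
  then obtain a' b' where "a' \<in> range x" "g a' = Min (range x)"
      "b' \<in> range x" "g b' = Max (range x)"
    using pred_exists by metis
  then interpret slow_odd_orbit_extremes g x q s "Min (range x)" "Max (range x)" a' b'
    using finite_orbit by unfold_locales auto
  show False by (rule contradiction)
qed

section \<open>Path counts of cyclic permutations\<close>

lemma power_split_2:
  fixes x :: real
  assumes "q \<ge> 3"
  shows "x ^ q = x ^ (q - 2) * x\<^sup>2"
proof -
  have "q - 2 + 2 = q" using assms by simp
  then show ?thesis by (metis power_add)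
qed

text \<open>In the form \<open>x ^ (q - 2) * (x ^ 2 - 2) = 1\<close> the equation has a root between
  \<open>sqrt 2\<close> and 2 by the intermediate value theorem, and none above 2, where the product
  exceeds 1.\<close>

lemma lambda_root:
  assumes "q \<ge> 3"
  shows "lambda q ^ q = 2 * lambda q ^ (q - 2) + 1" "sqrt 2 \<le> lambda q" "lambda q \<le> 2"
proof -
  define P :: "real \<Rightarrow> real" where "P x = x ^ q - 2 * x ^ (q - 2) - 1" for x
  have P: "P x = x ^ (q - 2) * (x\<^sup>2 - 2) - 1" for x
    unfolding P_def power_split_2[OF assms, of x] by (simp add: algebra_simps)
  define p :: "real poly" where "p = monom 1 q - monom 2 (q - 2) - 1"
  have "coeff p q = 1" unfolding p_def using assms by simp
  then have "p \<noteq> 0" by auto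
  then have "finite {x. poly p x = 0}" by (rule poly_roots_finite)
  moreover have "poly p x = P x" for x by (simp add: p_def P_def poly_monom)
  ultimately have fin: "finite {x. P x = 0}" by simp
  have "P (sqrt 2) \<le> 0" by (simp add: P)
  moreover have "0 \<le> P 2"
    by (simp add: P) (use one_le_power[of "2::real" "q - 2"] in linarith)
  moreover have "continuous_on {sqrt 2..2} P" unfolding P_def by (intro continuous_intros)
  moreover have "sqrt 2 \<le> 2" using sqrt2_less_2 by simp
  ultimately obtain z where z: "sqrt 2 \<le> z" "z \<le> 2" "P z = 0"
    using IVT'[of P "sqrt 2" 0 2] by auto
  have l: "lambda q = Max {x. P x = 0}" using assms by (simp add: lambda_def P_def)
  have in_roots: "lambda q \<in> {x. P x = 0}" unfolding l by (rule Max_in[OF fin]) (use z in auto)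
  then show "lambda q ^ q = 2 * lambda q ^ (q - 2) + 1" by (simp add: P_def)
  have "z \<le> lambda q" unfolding l using fin z by (intro Max_ge) auto
  then show "sqrt 2 \<le> lambda q" using z by simp
  show "lambda q \<le> 2"
  proof (rule ccontr)
    assume "\<not> ?thesis"
    then have "lambda q > 2" by simp
    then have "lambda q ^ (q - 2) \<ge> 1" "(lambda q)\<^sup>2 - 2 > 1"
      using power_strict_mono[of 2 "lambda q" 2] by auto
    then have "lambda q ^ (q - 2) * ((lambda q)\<^sup>2 - 2) > 1" by (metis less_1_mult mult_1 order_le_less)
    then show False using in_roots by (simp add: P)
  qed
qed

lemma lambda_gt_1: "q \<ge> 3 \<Longrightarrow> lambda q > 1"
  using lambda_root(2)[of q] by (smt (verit) real_sqrt_gt_1_iff)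

text \<open>The function \<open>x ^ (q - 2) * (x ^ 2 - 2)\<close> is strictly increasing as soon as
  it is positive, and it equals 1 at \<open>lambda q\<close>.\<close>

lemma lambda_le:
  assumes "q \<ge> 3" "s > 0" "2 * s ^ (q - 2) + 1 \<le> s ^ q"
  shows "lambda q \<le> s"
proof (rule ccontr)
  assume "\<not> ?thesis"
  then have less: "s < lambda q" by simp
  note f = power_split_2[OF assms(1)]
  have 1: "1 \<le> s ^ (q - 2) * (s\<^sup>2 - 2)" using assms(3) by (simp add: f algebra_simps)
  then have "s\<^sup>2 - 2 > 0" using assms(2)
    by (smt (verit) mult_nonneg_nonpos zero_le_power)
  moreover have "s ^ (q - 2) < lambda q ^ (q - 2)" using less assms by (intro power_strict_mono) auto
  moreover have "s\<^sup>2 < (lambda q)\<^sup>2" using less assms by (intro power_strict_mono) auto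
  ultimately have "s ^ (q - 2) * (s\<^sup>2 - 2) < lambda q ^ (q - 2) * ((lambda q)\<^sup>2 - 2)"
    using assms lambda_gt_1[OF assms(1)] by (intro mult_strict_mono) auto
  then show False using 1 lambda_root(1)[OF assms(1)] by (simp add: f algebra_simps)
qed

text \<open>The transition operator of the Markov graph of the permutation \<open>\<sigma>\<close> of \<open>{0..<q}\<close>: vertex \<open>i\<close>
  is the gap between the points \<open>i\<close> and \<open>i + 1\<close>, with an arrow to every gap between
  \<open>\<sigma> i\<close> and \<open>\<sigma> (i + 1)\<close>.\<close>

definition gap_sum :: "(nat \<Rightarrow> real) \<Rightarrow> nat \<Rightarrow> nat \<Rightarrow> real"
  where "gap_sum \<phi> i j = sum \<phi> {min i j..<max i j}"

definition transition :: "(nat \<Rightarrow> nat) \<Rightarrow> (nat \<Rightarrow> real) \<Rightarrow> nat \<Rightarrow> real"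
  where "transition \<sigma> \<phi> i = gap_sum \<phi> (\<sigma> i) (\<sigma> (Suc i))"

text \<open>\<open>e\<close> lists the points of the cycle in the order of time, each given by its
  rank on the line; \<open>\<sigma>\<close> acts on the ranks. The value \<open>paths m i\<close>
  below counts the paths of length \<open>m\<close> that start at gap \<open>i\<close>.\<close>

locale cycle =
  fixes \<sigma> :: "nat \<Rightarrow> nat" and e :: "nat \<Rightarrow> nat" and q :: nat
  assumes e_step: "\<sigma> (e k) = e (Suc k)" and e_periodic: "e (k + q) = e k"
    and e_bij: "bij_betw e {..<q} {..<q}" and odd_q: "odd q" and q_ge_3: "q \<ge> 3"
begin

abbreviation paths :: "nat \<Rightarrow> nat \<Rightarrow> real"
  where "paths m \<equiv> (transition \<sigma> ^^ m) (\<lambda>_. 1)"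

lemma \<sigma>_less: "i < q \<Longrightarrow> \<sigma> i < q"
proof -
  assume "i < q"
  then obtain k where "k < q" "i = e k" using e_bij by (auto simp: bij_betw_def image_iff)
  then have "\<sigma> i = e (Suc k)" using e_step by simp
  moreover have "e (Suc k) < q"
  proof (cases "Suc k < q")
    case False
    then have "Suc k = 0 + q" using \<open>k < q\<close> by simp
    then have "e (Suc k) = e 0" using e_periodic[of 0] by simp
    then show ?thesis using e_bij q_ge_3 by (auto simp: bij_betw_def)
  qed (use e_bij in \<open>auto simp: bij_betw_def\<close>)
  ultimately show ?thesis by simp
qed

lemma transition_sum:
  "transition \<sigma> (\<lambda>i. \<Sum>n\<in>A. c n * \<phi> n i) j = (\<Sum>n\<in>A. c n * transition \<sigma> (\<phi> n) j)"
  unfolding transition_def gap_sum_def by (subst sum.swap) (simp add: sum_distrib_left)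

text \<open>Were all path counts of length \<open>m\<close> below \<open>\<lambda>\<^sub>q\<^sup>m\<close>, then for some \<open>s < \<lambda>\<^sub>q\<close> the gaps could be
  given lengths for which \<open>\<sigma>\<close> is \<open>s\<close>-Lipschitz on the orbit.\<close>

lemma many_paths: "\<exists>i<q - 1. lambda q ^ m \<le> paths m i"
proof (rule ccontr)
  assume "\<not> ?thesis"
  then have small: "paths m i < lambda q ^ m" if "i < q - 1" for i using that by force
  have l1: "lambda q > 1" by (rule lambda_gt_1[OF q_ge_3])
  have "m \<noteq> 0" using small[of 0] q_ge_3 by (cases m) auto
  \<comment> \<open>The entry 1 keeps \<open>s\<close> positive and is itself below
    \<open>lambda q ^ m\<close>, since \<open>m \<noteq> 0\<close>.\<close>
  define M where "M = Max (insert 1 (paths m ` {..<q - 1}))"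
  have fin: "finite (insert 1 (paths m ` {..<q - 1}))" by simp
  have "M \<ge> 1" "\<And>i. i < q - 1 \<Longrightarrow> paths m i \<le> M" unfolding M_def using fin by auto
  note M = this
  have "M \<in> insert 1 (paths m ` {..<q - 1})" unfolding M_def by (intro Max_in) auto
  then have "M < lambda q ^ m" using small l1 \<open>m \<noteq> 0\<close> by (auto intro: one_less_power)
  define s where "s = root m M"
  have s: "s > 0" "s ^ m = M" using M \<open>m \<noteq> 0\<close> by (auto simp: s_def real_root_pow_pos2)
  have s_less: "s < lambda q"
    using \<open>M < lambda q ^ m\<close> s l1 by (intro power_less_imp_less_base[of s m]) auto
  \<comment> \<open>A truncated Neumann series of the transition operator. Applying the operator
    shifts the sum: the term of index 0, which is 1, is lost, and the new term of index
    \<open>m\<close> is at most 1 by the choice of \<open>s\<close>. Hence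
    \<open>l_sub\<close>.\<close>
  define l where "l i = (\<Sum>n<m. (1 / s) ^ n * paths n i)" for i
  have nonneg: "paths n i \<ge> 0" for n i
  proof (induction n arbitrary: i)
    case (Suc n)
    then show ?case by (auto simp: transition_def gap_sum_def intro!: sum_nonneg)
  qed auto
  have l_pos: "l i > 0" for i
  proof -
    have "(1 / s) ^ 0 * paths 0 i \<le> l i"
      unfolding l_def using nonneg s \<open>m \<noteq> 0\<close> by (intro member_le_sum) auto
    then show ?thesis by simp
  qed
  have l_sub: "transition \<sigma> l i \<le> s * l i" if i: "i < q - 1" for i
  proof -
    have "transition \<sigma> l i = (\<Sum>n<m. (1 / s) ^ n * paths (Suc n) i)"
      unfolding l_def transition_sum by simp
    also have "\<dots> = s * (\<Sum>n<m. (1 / s) ^ Suc n * paths (Suc n) i)"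
      using s by (simp add: sum_distrib_left)
    also have "(\<Sum>n<m. (1 / s) ^ Suc n * paths (Suc n) i) = l i + (1 / s) ^ m * paths m i - 1"
      unfolding l_def using sum.lessThan_Suc_shift[of "\<lambda>n. (1 / s) ^ n * paths n i" m]
      by simp
    also have "(1 / s) ^ m * paths m i \<le> 1"
      using M(2)[OF i] s M(1) by (simp add: power_divide divide_le_eq)
    then have "s * (l i + (1 / s) ^ m * paths m i - 1) \<le> s * l i" using s by (intro mult_left_mono) auto
    finally show ?thesis .
  qed
  define pos where "pos i = sum l {..<i}" for i
  have diff: "\<bar>pos i - pos j\<bar> = gap_sum l i j" for i j
  proof -
    have "pos (max i j) - pos (min i j) = gap_sum l i j"
      unfolding pos_def gap_sum_def by (simp add: sum_diff_nat_ivl flip: atLeast0LessThan)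
    moreover have "gap_sum l i j \<ge> 0" unfolding gap_sum_def using l_pos by (intro sum_nonneg) (auto intro: less_imp_le)
    ultimately show ?thesis by (auto simp: max_def min_def split: if_splits)
  qed
  have lip: "\<bar>pos (\<sigma> i) - pos (\<sigma> j)\<bar> \<le> s * \<bar>pos i - pos j\<bar>" if "i \<le> j" "j < q" for i j
    using that
  proof (induction j)
    case (Suc j)
    show ?case
    proof (cases "i = Suc j")
      case False
      then have IH: "\<bar>pos (\<sigma> i) - pos (\<sigma> j)\<bar> \<le> s * \<bar>pos i - pos j\<bar>" using Suc by simp
      have "\<bar>pos (\<sigma> j) - pos (\<sigma> (Suc j))\<bar> \<le> s * l j"
        using l_sub[of j] Suc.prems by (simp add: diff transition_def)
      then have "\<bar>pos (\<sigma> i) - pos (\<sigma> (Suc j))\<bar> \<le> s * (\<bar>pos i - pos j\<bar> + l j)"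
        using IH by (simp add: algebra_simps)
      also have "\<bar>pos i - pos j\<bar> + l j = \<bar>pos i - pos (Suc j)\<bar>"
        using False Suc.prems by (simp add: diff gap_sum_def min_def max_def)
      finally show ?thesis .
    qed auto
  qed auto
  have lip: "\<bar>pos (\<sigma> i) - pos (\<sigma> j)\<bar> \<le> s * \<bar>pos i - pos j\<bar>" if "i < q" "j < q" for i j
    using lip[of i j] lip[of j i] that by (cases "i \<le> j") (auto simp: abs_minus_commute)
  \<comment> \<open>McShane's extension: a minimum of \<open>s\<close>-Lipschitz cones over the
    points \<open>pos i\<close>, which keeps the prescribed values because these are already
    \<open>s\<close>-Lipschitz.\<close>
  define h where "h i u = pos (\<sigma> i) + s * \<bar>u - pos i\<bar>" for i u
  define g where "g u = Min ((\<lambda>i. h i u) ` {..<q})" for u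
  have h_le: "g u \<le> h i u" if "i < q" for i u unfolding g_def using that by (intro Min_le) auto
  have g_in: "\<exists>i<q. g u = h i u" for u
  proof -
    have "g u \<in> (\<lambda>i. h i u) ` {..<q}" 
      unfolding g_def using q_ge_3 by (intro Min_in) (auto simp: lessThan_empty_iff)
    then show ?thesis by auto
  qed
  have g_pos: "g (pos i) = pos (\<sigma> i)" if "i < q" for i
  proof (rule antisym)
    show "g (pos i) \<le> pos (\<sigma> i)" using h_le[OF that, of "pos i"] by (simp add: h_def)
    obtain j where "j < q" "g (pos i) = h j (pos i)" using g_in by blast
    then show "pos (\<sigma> i) \<le> g (pos i)" using lip[OF that, of j] by (simp add: h_def)
  qed
  have g_le: "g u \<le> g v + s * \<bar>u - v\<bar>" for u v
  proof -
    obtain j where j: "j < q" "g v = h j v" using g_in by blast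
    have "s * \<bar>u - pos j\<bar> \<le> s * (\<bar>v - pos j\<bar> + \<bar>u - v\<bar>)" using s by (intro mult_left_mono) auto
    then show ?thesis using h_le[OF j(1), of u] j by (simp add: h_def algebra_simps)
  qed
  have e_less: "e k < q" for k
  proof (induction k)
    case 0
    then show ?case using e_bij q_ge_3 by (auto simp: bij_betw_def)
  next
    case (Suc k)
    then show ?case using \<sigma>_less e_step by metis
  qed
  have "strict_mono pos" unfolding pos_def by (rule strict_mono_Suc_iff[THEN iffD2]) (use l_pos in simp)
  then have "inj pos" by (rule strict_mono_imp_inj_on)
  have "2 * s ^ (q - 2) + 1 \<le> s ^ q"
  proof (rule lipschitz_odd_orbit[of g s "\<lambda>k. pos (e k)" q])
    show "\<bar>g u - g v\<bar> \<le> s * \<bar>u - v\<bar>" for u v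
      using g_le[of u v] g_le[of v u] by (auto simp: abs_minus_commute)
    show "g (pos (e k)) = pos (e (Suc k))" for k using g_pos[OF e_less] e_step by simp
    show "inj_on (\<lambda>k. pos (e k)) {..<q}"
      using e_bij \<open>inj pos\<close> by (auto simp: bij_betw_def inj_on_def)
  qed (use e_periodic odd_q q_ge_3 in auto)
  then show False using lambda_le[OF q_ge_3 s(1)] s_less by simp
qed

end

section \<open>Nonautonomous interval maps with a forced cycle\<close>

definition crosses :: "(nat \<Rightarrow> real) \<Rightarrow> (real \<Rightarrow> real) \<Rightarrow> real \<Rightarrow> real \<Rightarrow> nat \<Rightarrow> bool"
  where "crosses p H a b i \<longleftrightarrow> {H a, H b} = {p i, p (Suc i)}"

text \<open>A segment \<open>(a, b, i)\<close> runs over gap \<open>i\<close> in either direction,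
  and only the images of its end points are prescribed. Consecutive segments may share an end
  point.\<close>

definition chain ::
    "nat \<Rightarrow> (nat \<Rightarrow> real) \<Rightarrow> (real \<Rightarrow> real) \<Rightarrow> real \<Rightarrow> real \<Rightarrow> (real \<times> real \<times> nat) list \<Rightarrow> bool"
  where "chain q p H u v ss \<longleftrightarrow> sorted_wrt (\<lambda>(a, b, i) (a', b', i'). b \<le> a') ss \<and>
    (\<forall>(a, b, i) \<in> set ss. u \<le> a \<and> a \<le> b \<and> b \<le> v \<and> Suc i < q \<and> crosses p H a b i)"

abbreviation weight :: "(nat \<Rightarrow> real) \<Rightarrow> (real \<times> real \<times> nat) list \<Rightarrow> real"
  where "weight \<phi> ss \<equiv> sum_list (map (\<lambda>(a, b, i). \<phi> i) ss)"

lemma chain_mono: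
  assumes "chain q p H a b ss" "u \<le> a" "b \<le> v"
  shows "chain q p H u v ss"
proof -
  have "a \<le> a'" "b' \<le> b" if "(a', b', i') \<in> set ss" for a' b' i'
    using assms(1) that unfolding chain_def by auto
  then have "u \<le> a'" "b' \<le> v" if "(a', b', i') \<in> set ss" for a' b' i'
    using assms(2,3) that by (meson order_trans)+
  then show ?thesis using assms(1) unfolding chain_def by auto
qed

lemma chain_append:
  assumes "chain q p H u w ss" "chain q p H w v ss'" "u \<le> w" "w \<le> v"
  shows "chain q p H u v (ss @ ss')"
proof -
  have bd: "u \<le> a" "b \<le> w" if "(a, b, i) \<in> set ss" for a b i
    using assms(1) that unfolding chain_def by auto
  have bd': "w \<le> a" "b \<le> v" if "(a, b, i) \<in> set ss'" for a b i
    using assms(2) that unfolding chain_def by auto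
  have "b \<le> a'" if "(a, b, i) \<in> set ss" "(a', b', i') \<in> set ss'" for a b i a' b' i'
    using bd(2)[OF that(1)] bd'(1)[OF that(2)] by simp
  moreover have "b \<le> v" if "(a, b, i) \<in> set ss" for a b i
    using bd(2)[OF that] assms(4) by simp
  moreover have "u \<le> a" if "(a, b, i) \<in> set ss'" for a b i
    using bd'(1)[OF that] assms(3) by simp
  ultimately show ?thesis using assms(1,2) unfolding chain_def sorted_wrt_append by auto
qed

lemma chain_Cons:
  assumes "u \<le> a" "a \<le> b" "b \<le> v" "Suc i < q" "crosses p H a b i" "chain q p H b v ss"
  shows "chain q p H u v ((a, b, i) # ss)"
proof -
  have "b \<le> a'" if "(a', b', i') \<in> set ss" for a' b' i'
    using assms(6) that unfolding chain_def by auto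
  moreover have "chain q p H u v ss" using chain_mono[OF assms(6)] assms(1,2) by simp
  ultimately show ?thesis using assms(1-5) unfolding chain_def by auto
qed

lemma ivt_between:
  fixes H :: "real \<Rightarrow> real"
  assumes "continuous_on {u..v} H" "u \<le> v" "min (H u) (H v) \<le> y" "y \<le> max (H u) (H v)"
  obtains t where "u \<le> t" "t \<le> v" "H t = y"
proof (cases "H u \<le> H v")
  case True
  then show ?thesis using IVT'[of H u y v] assms that by auto
next
  case False
  then show ?thesis using IVT2'[of H v y u] assms that by auto
qed

text \<open>One gap at a time: the intermediate value theorem provides a point over the next
  position towards \<open>p j\<close>, and the remaining chain lies to its right. The weight is
  computed for all \<phi> at once, since path counts of a length fixed only later will be
  inserted.\<close>

lemma ivt_chain:
  assumes "continuous_on {u..v} H" "u \<le> v" "H u = p i" "H v = p j" "i < q" "j < q"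
    and mono: "\<And>i j. i \<le> j \<Longrightarrow> j < q \<Longrightarrow> p i \<le> p j"
  shows "\<exists>ss. chain q p H u v ss \<and> (\<forall>\<phi>. weight \<phi> ss = gap_sum \<phi> i j)"
  using assms(1-6)
proof (induction "max i j - min i j" arbitrary: i u)
  case 0
  then have "i = j" by (auto simp: max_def min_def split: if_splits)
  then show ?case by (intro exI[of _ "[]"]) (auto simp: chain_def gap_sum_def)
next
  case (Suc n)
  define i' where "i' = (if i < j then Suc i else i - 1)"
  have ne: "i \<noteq> j" using Suc.hyps(2) by auto
  have i': "i' < q" "n = max i' j - min i' j" using Suc.hyps(2) Suc.prems ne unfolding i'_def by auto
  have "min (p i) (p j) \<le> p i'" "p i' \<le> max (p i) (p j)"
  proof -
    have "(i \<le> i' \<and> i' \<le> j) \<or> (j \<le> i' \<and> i' \<le> i)" using ne by (auto simp: i'_def)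
    then have "(p i \<le> p i' \<and> p i' \<le> p j) \<or> (p j \<le> p i' \<and> p i' \<le> p i)"
      using mono i' Suc.prems by metis
    then show "min (p i) (p j) \<le> p i'" "p i' \<le> max (p i) (p j)" by auto
  qed
  then obtain t where t: "u \<le> t" "t \<le> v" "H t = p i'"
    using ivt_between[OF Suc.prems(1,2), of "p i'"] Suc.prems by auto
  have "continuous_on {t..v} H" by (rule continuous_on_subset[OF Suc.prems(1)]) (use t in auto)
  then obtain ss where ss: "chain q p H t v ss" "\<And>\<phi>. weight \<phi> ss = gap_sum \<phi> i' j"
    using Suc.hyps(1)[OF i'(2) _ t(2,3)] Suc.prems i' by blast
  have gs: "gap_sum \<phi> i j = \<phi> (min i i') + gap_sum \<phi> i' j" for \<phi>
  proof (cases "i < j")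
    case True
    then show ?thesis by (simp add: gap_sum_def i'_def sum.atLeast_Suc_lessThan)
  next
    case False
    then have "i = Suc i'" "j \<le> i'" using ne by (auto simp: i'_def)
    then show ?thesis by (simp add: gap_sum_def)
  qed
  have "chain q p H u v ((u, t, min i i') # ss)"
  proof (rule chain_Cons[OF _ t(1,2) _ _ ss(1)])
    show "Suc (min i i') < q" using Suc.prems ne by (auto simp: i'_def)
    show "crosses p H u t (min i i')"
      using Suc.prems t ne by (auto simp: crosses_def i'_def min_def)
  qed simp
  then show ?case using ss(2) gs by (intro exI[of _ "(u, t, min i i') # ss"]) auto
qed

text \<open>A further map \<open>g\<close> takes the end points of a segment over gap
  \<open>i\<close> to the positions \<open>\<sigma> i\<close> and \<open>\<sigma> (Suc i)\<close>,
  in some order, so \<open>ivt_chain\<close> subdivides the segment as the Markov graph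
  prescribes.\<close>

lemma chain_compose:
  assumes "chain q p H u v ss" "continuous_on {u..v} (g \<circ> H)" "u \<le> v"
    and "\<And>i. i < q \<Longrightarrow> g (p i) = p' (\<sigma> i)" "\<And>i. i < q \<Longrightarrow> \<sigma> i < q"
    and "\<And>i j. i \<le> j \<Longrightarrow> j < q \<Longrightarrow> p' i \<le> p' j"
  shows "\<exists>ss'. chain q p' (g \<circ> H) u v ss' \<and> (\<forall>\<phi>. weight \<phi> ss' = weight (transition \<sigma> \<phi>) ss)"
  using assms(1-3)
proof (induction ss arbitrary: u)
  case Nil
  then show ?case by (intro exI[of _ "[]"]) (auto simp: chain_def)
next
  case (Cons s ss)
  obtain a b i where s: "s = (a, b, i)" by (cases s)
  have ab: "u \<le> a" "a \<le> b" "b \<le> v" "Suc i < q" "crosses p H a b i"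
    and tl: "chain q p H b v ss"
    using Cons.prems(1) unfolding s chain_def by fastforce+
  have sub: "{a..b} \<subseteq> {u..v}" "{b..v} \<subseteq> {u..v}" using ab by auto
  note c = continuous_on_subset[OF Cons.prems(2) sub(1)] continuous_on_subset[OF Cons.prems(2) sub(2)]
  obtain ss2 where ss2: "chain q p' (g \<circ> H) b v ss2" "\<And>\<phi>. weight \<phi> ss2 = weight (transition \<sigma> \<phi>) ss"
    using Cons.IH[OF tl c(2) ab(3)] by blast
  have "\<exists>j k. {j, k} = {i, Suc i} \<and> H a = p j \<and> H b = p k"
    using ab(5) unfolding crosses_def doubleton_eq_iff by blast
  then obtain j k where jk: "{j, k} = {i, Suc i}" "H a = p j" "H b = p k" by blast
  then have less: "j < q" "k < q" using ab(4) by (auto simp: doubleton_eq_iff)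
  have "\<exists>ss. chain q p' (g \<circ> H) a b ss \<and> (\<forall>\<phi>. weight \<phi> ss = gap_sum \<phi> (\<sigma> j) (\<sigma> k))"
    by (rule ivt_chain[OF c(1) ab(2)]) (use jk less assms(4-6) in auto)
  then obtain ss1 where ss1: "chain q p' (g \<circ> H) a b ss1"
      "\<And>\<phi>. weight \<phi> ss1 = gap_sum \<phi> (\<sigma> j) (\<sigma> k)" by blast
  have "gap_sum \<phi> (\<sigma> j) (\<sigma> k) = transition \<sigma> \<phi> i" for \<phi>
    using jk(1) by (auto simp: doubleton_eq_iff transition_def gap_sum_def min.commute max.commute)
  moreover have "chain q p' (g \<circ> H) u v (ss1 @ ss2)"
  proof (rule chain_append[OF _ ss2(1)])
    show "chain q p' (g \<circ> H) u b ss1" using chain_mono[OF ss1(1) ab(1)] by simp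
  qed (use ab in auto)
  moreover have "weight \<phi> (ss1 @ ss2) = weight (transition \<sigma> \<phi>) (s # ss)" for \<phi>
    using ss1(2) ss2(2) calculation(1) by (simp add: s)
  ultimately show ?case by blast
qed

section \<open>Thinning a chain to separated segments\<close>

fun alternate :: "'a list \<Rightarrow> 'a list"
  where "alternate [] = []" | "alternate [x] = [x]" | "alternate (x # y # xs) = x # alternate xs"

lemma set_alternate: "set (alternate xs) \<subseteq> set xs"
  by (induction xs rule: alternate.induct) auto

lemma sum_alternate:
  fixes w :: "'a \<Rightarrow> real"
  shows "sum_list (map w (alternate xs)) + sum_list (map w (alternate (tl xs))) = sum_list (map w xs)"
proof (induction xs rule: alternate.induct)
  case (3 x y xs)
  then show ?case by (cases xs) auto
qed auto

lemma sorted_alternate: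
  fixes \<eta> :: real
  assumes "sorted_wrt (\<lambda>(a, b, i) (a', b', i'). b \<le> a') ss" "\<forall>(a, b, i)\<in>set ss. a + \<eta> \<le> b"
  shows "sorted_wrt (\<lambda>(a, b, i) (a', b', i'). b + \<eta> \<le> a') (alternate ss)"
  using assms
proof (induction ss rule: alternate.induct)
  case (3 x y xs)
  have "\<forall>z\<in>set xs. (\<lambda>(a, b, i) (a', b', i'). b + \<eta> \<le> a') x z"
    using 3(2,3) by fastforce
  then show ?case using 3 set_alternate[of xs] by auto
qed auto

text \<open>The segments in even places and those in odd places are both separated, because an
  omitted segment of length at least \<eta> lies between any two of them. One of the two lists
  carries at least half of the weight.\<close>

lemma separated_sublist:
  fixes \<eta> :: real
  assumes "sorted_wrt (\<lambda>(a, b, i) (a', b', i'). b \<le> a') ss" "\<forall>(a, b, i)\<in>set ss. a + \<eta> \<le> b"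
  shows "\<exists>ts. set ts \<subseteq> set ss \<and> sorted_wrt (\<lambda>(a, b, i) (a', b', i'). b + \<eta> \<le> a') ts \<and>
    weight \<phi> ss \<le> 2 * weight \<phi> ts"
proof (cases "weight \<phi> ss \<le> 2 * weight \<phi> (alternate ss)")
  case True
  then show ?thesis using sorted_alternate[OF assms] set_alternate[of ss]
    by (intro exI[of _ "alternate ss"] conjI)
next
  case False
  have "sorted_wrt (\<lambda>(a, b, i) (a', b', i'). b \<le> a') (tl ss)" using assms(1) by (cases ss) auto
  moreover have "\<forall>(a, b, i)\<in>set (tl ss). a + \<eta> \<le> b" using assms(2) by (cases ss) auto
  ultimately have "sorted_wrt (\<lambda>(a, b, i) (a', b', i'). b + \<eta> \<le> a') (alternate (tl ss))"
    by (rule sorted_alternate)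
  moreover have "set (alternate (tl ss)) \<subseteq> set ss"
    using set_alternate[of "tl ss"] by (cases ss) auto
  moreover have "weight \<phi> ss \<le> 2 * weight \<phi> (alternate (tl ss))"
    using False sum_alternate[of "\<lambda>(a, b, i). \<phi> i" ss] by simp
  ultimately show ?thesis by (intro exI[of _ "alternate (tl ss)"] conjI)
qed

lemma distinct_if_sorted_wrt: "sorted_wrt R xs \<Longrightarrow> (\<And>x. x \<in> set xs \<Longrightarrow> \<not> R x x) \<Longrightarrow> distinct xs"
  by (induction xs) auto

lemma sorted_wrt_total: "sorted_wrt R xs \<Longrightarrow> x \<in> set xs \<Longrightarrow> y \<in> set xs \<Longrightarrow> x \<noteq> y \<Longrightarrow> R x y \<or> R y x"
  by (induction xs) auto

text \<open>The index \<open>k\<close> is time: \<open>g k\<close> acts from the fibre at time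
  \<open>k\<close> to the next one, and \<open>p k i\<close> is the marked point of rank
  \<open>i\<close> there. The maps may depend on \<open>k\<close> arbitrarily, but
  \<open>\<sigma>\<close> and \<delta> do not.\<close>

locale forced_cycle = cycle +
  fixes p :: "nat \<Rightarrow> nat \<Rightarrow> real" and g :: "nat \<Rightarrow> real \<Rightarrow> real" and \<delta> :: real
  assumes g_cont: "continuous_on {0..1} (g k)" and g_maps: "x \<in> {0..1} \<Longrightarrow> g k x \<in> {0..1}"
    and p_range: "i < q \<Longrightarrow> p k i \<in> {0..1}" and p_gap: "Suc i < q \<Longrightarrow> p k i + \<delta> \<le> p k (Suc i)"
    and \<delta>_pos: "\<delta> > 0" and g_p: "i < q \<Longrightarrow> g k (p k i) = p (Suc k) (\<sigma> i)"
begin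

fun G :: "nat \<Rightarrow> nat \<Rightarrow> real \<Rightarrow> real"
  where "G k 0 = id" | "G k (Suc n) = g (k + n) \<circ> G k n"

lemma G_add: "G k (m + n) = G (k + m) n \<circ> G k m"
  by (induction n) (auto simp: comp_assoc add.assoc)

lemma G_maps: "x \<in> {0..1} \<Longrightarrow> G k n x \<in> {0..1}"
  by (induction n) (use g_maps in \<open>auto simp del: atLeastAtMost_iff\<close>)

lemma G_cont: "continuous_on {0..1} (G k n)"
proof (induction n)
  case (Suc n)
  have "continuous_on (G k n ` {0..1}) (g (k + n))"
    by (rule continuous_on_subset[OF g_cont]) (use G_maps in blast)
  then show ?case unfolding G.simps by (rule continuous_on_compose[OF Suc])
qed auto

lemma p_mono:
  assumes "i \<le> j" "j < q" shows "p k i \<le> p k j"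
  using assms
proof (induction j)
  case (Suc j)
  show ?case
  proof (cases "i = Suc j")
    case False
    then have "p k i \<le> p k j" using Suc by simp
    also have "\<dots> \<le> p k (Suc j)" using p_gap[of j k] \<delta>_pos Suc.prems by simp
    finally show ?thesis .
  qed simp
qed auto

lemma chain_exists:
  assumes "Suc i < q"
  shows "\<exists>ss. chain q (p (k + n)) (G k n) (p k i) (p k (Suc i)) ss \<and>
    (\<forall>\<phi>. weight \<phi> ss = (transition \<sigma> ^^ n) \<phi> i)"
proof (induction n)
  case 0
  have "p k i \<le> p k (Suc i)" using p_mono assms by simp
  then show ?case using assms by (intro exI[of _ "[(p k i, p k (Suc i), i)]"]) (auto simp: chain_def crosses_def)
next
  case (Suc n)
  then obtain ss where ss: "chain q (p (k + n)) (G k n) (p k i) (p k (Suc i)) ss"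
      "\<And>\<phi>. weight \<phi> ss = (transition \<sigma> ^^ n) \<phi> i" by blast
  have c: "continuous_on {p k i..p k (Suc i)} (g (k + n) \<circ> G k n)"
    using G_cont[of k "Suc n"] p_range[of i k] p_range[of "Suc i" k] assms
    by (auto elim: continuous_on_subset)
  have le: "p k i \<le> p k (Suc i)" using p_mono assms by simp
  have "\<exists>ss'. chain q (p (k + Suc n)) (g (k + n) \<circ> G k n) (p k i) (p k (Suc i)) ss' \<and>
      (\<forall>\<phi>. weight \<phi> ss' = weight (transition \<sigma> \<phi>) ss)"
    by (rule chain_compose[OF ss(1) c le]) (use p_mono g_p[of _ "k + n"] \<sigma>_less in auto)
  moreover have "G k (Suc n) = g (k + n) \<circ> G k n" by simp
  ultimately show ?case using ss(2) by (simp only: funpow.simps(2) funpow_swap1 comp_def)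
qed

text \<open>Two segments of a chain of \<open>G k n\<close> that have a third one in between are \<open>\<eta>\<close>-separated, since
  \<open>G k n\<close> maps the latter to a set of diameter at least \<open>\<delta>\<close>. Keeping every other segment thus costs a
  factor of 2 for every \<open>n\<close> steps.\<close>

lemma separated_set:
  assumes \<eta>: "\<eta> > 0"
    and uniform: "\<And>k x y. x \<in> {0..1} \<Longrightarrow> y \<in> {0..1} \<Longrightarrow> \<bar>x - y\<bar> < \<eta> \<Longrightarrow> \<bar>G k n x - G k n y\<bar> < \<delta>"
    and i: "Suc i < q"
  shows "\<exists>E. finite E \<and> E \<subseteq> {p k i..p k (Suc i)} \<and> paths (n * m) i \<le> 2 ^ m * real (card E) \<and>
    (\<forall>x\<in>E. \<forall>y\<in>E. x \<noteq> y \<longrightarrow> (\<exists>j<m. \<eta> \<le> \<bar>G k (n * j) x - G k (n * j) y\<bar>))"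
  using i
proof (induction m arbitrary: i k)
  case 0
  then show ?case using p_mono[of i "Suc i" k] by (intro exI[of _ "{p k i}"]) auto
next
  case (Suc m)
  define \<phi> where "\<phi> = paths (n * m)"
  define good where "good k E j \<longleftrightarrow> finite E \<and> E \<subseteq> {p k j..p k (Suc j)} \<and> \<phi> j \<le> 2 ^ m * real (card E) \<and>
    (\<forall>x\<in>E. \<forall>y\<in>E. x \<noteq> y \<longrightarrow> (\<exists>l<m. \<eta> \<le> \<bar>G k (n * l) x - G k (n * l) y\<bar>))" for k E j
  \<comment> \<open>The remaining \<open>m\<close> blocks start at time \<open>k + n\<close>, hence
    the generalization over \<open>k\<close>. The sets \<open>D j\<close> found there are pulled
    back along the segments of a chain.\<close>
  have "\<forall>j. Suc j < q \<longrightarrow> (\<exists>E. good (k + n) E j)" using Suc.IH unfolding good_def \<phi>_def by blast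
  then obtain D where D: "\<And>j. Suc j < q \<Longrightarrow> good (k + n) (D j) j" by metis
  obtain ss where ss: "chain q (p (k + n)) (G k n) (p k i) (p k (Suc i)) ss"
      "weight \<phi> ss = (transition \<sigma> ^^ n) \<phi> i" using chain_exists[OF Suc.prems] by blast
  have sub: "{p k i..p k (Suc i)} \<subseteq> {0..1}"
    using p_range[of i k] p_range[of "Suc i" k] Suc.prems by auto
  have seg: "p k i \<le> a" "a \<le> b" "b \<le> p k (Suc i)" "Suc j < q"
      "crosses (p (k + n)) (G k n) a b j" if "(a, b, j) \<in> set ss" for a b j
    using ss(1) that unfolding chain_def by fastforce+
  have wide: "a + \<eta> \<le> b" if "(a, b, j) \<in> set ss" for a b j
  proof (rule ccontr)
    assume "\<not> a + \<eta> \<le> b"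
    then have "\<bar>G k n a - G k n b\<bar> < \<delta>" using seg[OF that] sub by (intro uniform) auto
    then show False using p_gap[OF seg(4)[OF that], of "k + n"] seg(5)[OF that]
      by (auto simp: crosses_def doubleton_eq_iff)
  qed
  obtain ts where ts: "set ts \<subseteq> set ss" "sorted_wrt (\<lambda>(a, b, i) (a', b', i'). b + \<eta> \<le> a') ts"
      "weight \<phi> ss \<le> 2 * weight \<phi> ts"
    using separated_sublist[of ss \<eta> \<phi>] ss(1) wide unfolding chain_def by force
  have "\<exists>x. a \<le> x \<and> x \<le> b \<and> G k n x = y" if "(a, b, j) \<in> set ss" "y \<in> D j" for a b j y
  proof -
    have c: "continuous_on {a..b} (G k n)"
      by (rule continuous_on_subset[OF G_cont]) (use seg[OF that(1)] sub in auto)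
    have y: "y \<in> {p (k + n) j..p (k + n) (Suc j)}"
      using D[OF seg(4)[OF that(1)]] that(2) unfolding good_def by blast
    have "min (G k n a) (G k n b) \<le> y" "y \<le> max (G k n a) (G k n b)"
      using seg(5)[OF that(1)] y by (auto simp: crosses_def doubleton_eq_iff)
    then show ?thesis using ivt_between[OF c seg(2)[OF that(1)]] by blast
  qed
  note ex = this
  define pre where "pre s y = (SOME x. fst s \<le> x \<and> x \<le> fst (snd s) \<and> G k n x = y)" for s :: "real \<times> real \<times> nat" and y
  have pre: "a \<le> pre (a, b, j) y \<and> pre (a, b, j) y \<le> b \<and> G k n (pre (a, b, j) y) = y"
    if "(a, b, j) \<in> set ss" "y \<in> D j" for a b j y
    using someI_ex[OF ex[OF that]] by (simp add: pre_def)
  define X where "X s = pre s ` D (snd (snd s))" for s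
  have X_props: "X (a, b, j) \<subseteq> {a..b}" "finite (X (a, b, j))" "card (X (a, b, j)) = card (D j)"
    "\<And>x. x \<in> X (a, b, j) \<Longrightarrow> G k n x \<in> D j" "inj_on (G k n) (X (a, b, j))"
    if s: "(a, b, j) \<in> set ss" for a b j
  proof -
    have "inj_on (pre (a, b, j)) (D j)" using pre[OF s] by (metis inj_onI)
    then show "card (X (a, b, j)) = card (D j)" by (simp add: X_def card_image)
    show "finite (X (a, b, j))" using D[OF seg(4)[OF s]] by (simp add: X_def good_def)
    show "X (a, b, j) \<subseteq> {a..b}" "\<And>x. x \<in> X (a, b, j) \<Longrightarrow> G k n x \<in> D j"
      using pre[OF s] by (auto simp: X_def)
    show "inj_on (G k n) (X (a, b, j))" using pre[OF s] by (auto simp: X_def intro!: inj_onI)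
  qed
  define E where "E = (\<Union>s\<in>set ts. X s)"
  have apart: "\<eta> \<le> \<bar>x - y\<bar>" if "s \<in> set ts" "t \<in> set ts" "s \<noteq> t" "x \<in> X s" "y \<in> X t" for s t x y
  proof -
    obtain a b j a' b' j' where st: "s = (a, b, j)" "t = (a', b', j')" by (cases s, cases t)
    have "b + \<eta> \<le> a' \<or> b' + \<eta> \<le> a"
      using sorted_wrt_total[OF ts(2) that(1-3)] by (simp add: st)
    moreover have "x \<in> {a..b}" "y \<in> {a'..b'}"
      using X_props(1)[of a b j] X_props(1)[of a' b' j'] ts(1) that unfolding st by blast+
    ultimately show ?thesis by auto
  qed
  have fin: "finite (X s)" if "s \<in> set ts" for s
  proof -
    obtain a b j where "s = (a, b, j)" by (cases s)
    then show ?thesis using X_props(2)[of a b j] ts(1) that by auto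
  qed
  have "distinct ts"
    by (rule distinct_if_sorted_wrt[OF ts(2)]) (use ts(1) wide \<eta> in force)
  have disj: "X s \<inter> X t = {}" if "s \<in> set ts" "t \<in> set ts" "s \<noteq> t" for s t
    using apart[OF that] \<eta> by fastforce
  have "card E = (\<Sum>s\<in>set ts. card (X s))"
    unfolding E_def by (rule card_UN_disjoint) (use fin disj in auto)
  then have card_E: "real (card E) = (\<Sum>s\<leftarrow>ts. real (card (X s)))"
    using \<open>distinct ts\<close> by (simp add: sum_list_distinct_conv_sum_set)
  have "weight \<phi> ts \<le> (\<Sum>s\<leftarrow>ts. 2 ^ m * real (card (X s)))"
  proof (rule sum_list_mono)
    fix s assume s: "s \<in> set ts"
    obtain a b j where abj: "s = (a, b, j)" by (cases s)
    then have mem: "(a, b, j) \<in> set ss" using s ts(1) by auto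
    show "(case s of (a, b, i) \<Rightarrow> \<phi> i) \<le> 2 ^ m * real (card (X s))"
      using X_props(3)[OF mem] D[OF seg(4)[OF mem]] by (simp add: abj good_def)
  qed
  also have "\<dots> = 2 ^ m * real (card E)" by (simp add: card_E sum_list_const_mult)
  finally have "weight \<phi> ts \<le> 2 ^ m * real (card E)" .
  moreover have "paths (n * Suc m) i = (transition \<sigma> ^^ n) \<phi> i"
    by (simp add: \<phi>_def funpow_add)
  ultimately have "paths (n * Suc m) i \<le> 2 ^ Suc m * real (card E)"
    using ts(3) ss(2) by simp
  moreover have "finite E" unfolding E_def using fin by auto
  moreover have "E \<subseteq> {p k i..p k (Suc i)}"
  proof
    fix x assume "x \<in> E"
    then obtain a b j where abj: "(a, b, j) \<in> set ts" "x \<in> X (a, b, j)" by (auto simp: E_def)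
    then have mem: "(a, b, j) \<in> set ss" using ts(1) by auto
    then show "x \<in> {p k i..p k (Suc i)}"
      using X_props(1)[OF mem] seg(1,3)[OF mem] abj(2) by auto
  qed
  \<comment> \<open>Points of different segments are apart at time 0. Points of the same segment
    have different images in one set \<open>D j\<close>, which separate after \<open>n * l\<close>
    further steps.\<close>
  moreover have "\<exists>l<Suc m. \<eta> \<le> \<bar>G k (n * l) x - G k (n * l) y\<bar>"
    if xy: "x \<in> E" "y \<in> E" "x \<noteq> y" for x y
  proof -
    obtain s t where st: "s \<in> set ts" "t \<in> set ts" "x \<in> X s" "y \<in> X t" using xy by (auto simp: E_def)
    show ?thesis
    proof (cases "s = t")
      case False
      then show ?thesis using apart[OF st(1,2) _ st(3,4)] by (intro exI[of _ 0]) auto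
    next
      case True
      obtain a b j where s: "s = (a, b, j)" by (cases s)
      then have mem: "(a, b, j) \<in> set ss" "x \<in> X (a, b, j)" "y \<in> X (a, b, j)" using st ts(1) True by auto
      then have "G k n x \<noteq> G k n y" "G k n x \<in> D j" "G k n y \<in> D j"
        using X_props(4,5)[OF mem(1)] xy(3) by (auto dest: inj_onD)
      then obtain l where l: "l < m" "\<eta> \<le> \<bar>G (k + n) (n * l) (G k n x) - G (k + n) (n * l) (G k n y)\<bar>"
        using D[OF seg(4)[OF mem(1)]] unfolding good_def by blast
      then show ?thesis using G_add[of k n "n * l"] by (intro exI[of _ "Suc l"]) auto
    qed
  qed
  ultimately show ?case by blast
qed

end

section \<open>The circle\<close>

lemma abs_circle_eq_iff: "abs_circle s = abs_circle t \<longleftrightarrow> s - t \<in> \<int>"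
  by (rule circle.abs_eq_iff)

lemma continuous_abs_circle: "continuous_on S abs_circle"
proof (rule continuous_on_subset[OF _ subset_UNIV])
  show "continuous_on UNIV abs_circle"
    by (subst continuous_on_open_vimage) (auto simp: open_circle_def)
qed

lemma abs_circle_unit_interval: "\<exists>t\<in>{0..1}. abs_circle t = \<theta>"
proof -
  obtain s where s: "\<theta> = abs_circle s"
    by (induction \<theta> rule: circle.abs_induct) blast
  have "abs_circle (frac s) = \<theta>" unfolding s abs_circle_eq_iff by (simp add: frac_def)
  then show ?thesis using frac_ge_0[of s] frac_lt_1[of s] by (intro bexI[of _ "frac s"]) auto
qed

lemma surj_abs_circle: "\<exists>t. abs_circle t = \<theta>"
  using abs_circle_unit_interval by blast

lemma open_image_abs_circle:
  assumes "open U" shows "open (abs_circle ` U)"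
proof -
  have "abs_circle -` abs_circle ` U = (\<Union>n\<in>\<int>. (\<lambda>t. t - n) -` U)" (is "?L = ?R")
  proof
    show "?L \<subseteq> ?R"
    proof
      fix t assume "t \<in> ?L"
      then obtain u where "u \<in> U" "t - u \<in> \<int>" by (auto simp: abs_circle_eq_iff)
      then show "t \<in> ?R" by (intro UN_I[of "t - u"]) auto
    qed
    show "?R \<subseteq> ?L"
    proof
      fix t assume "t \<in> ?R"
      then obtain n where "n \<in> \<int>" "t - n \<in> U" by auto
      then show "t \<in> ?L" by (auto simp: abs_circle_eq_iff intro!: image_eqI[of _ _ "t - n"])
    qed
  qed
  moreover have "open ((\<lambda>t. t - n) -` U)" for n
    by (rule open_vimage[OF assms]) (intro continuous_intros)
  ultimately show ?thesis by (auto simp: open_circle_def)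
qed

lemma rotation_abs_circle: "rotation \<omega> (abs_circle t) = abs_circle (t + \<omega>)"
  by (rule rotation.abs_eq)

lemma rotation_rotation: "rotation \<omega> (rotation \<omega>' \<theta>) = rotation (\<omega>' + \<omega>) \<theta>"
  using surj_abs_circle[of \<theta>] by (auto simp: rotation_abs_circle add.assoc)

lemma rotation_0: "rotation 0 \<theta> = \<theta>"
  using surj_abs_circle[of \<theta>] by (auto simp: rotation_abs_circle)

lemma surj_rotation: "surj (rotation \<omega>)"
  by (rule surjI[of _ "rotation (- \<omega>)"]) (simp add: rotation_rotation rotation_0)

lemma continuous_rotation: "continuous_on S (rotation \<omega>)"
proof (rule continuous_on_subset[OF _ subset_UNIV])
  have "open (rotation \<omega> -` U)" if "open U" for U
  proof -
    have "abs_circle -` rotation \<omega> -` U = (\<lambda>t. t + \<omega>) -` (abs_circle -` U)"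
      by (auto simp: rotation_abs_circle)
    moreover have "open (abs_circle -` U)" using that by (simp add: open_circle_def)
    then have "open ((\<lambda>t. t + \<omega>) -` (abs_circle -` U))"
      by (rule open_vimage) (intro continuous_intros)
    ultimately show ?thesis by (simp add: open_circle_def)
  qed
  then show "continuous_on UNIV (rotation \<omega>)" by (subst continuous_on_open_vimage) auto
qed

text \<open>The circle carries only its quotient topology and no metric. Compactness, uniform
  continuity, distances and Lebesgue numbers on the cylinder are obtained in the plane, over the
  unit square, and transported by this map.\<close>

definition lift :: "real \<times> real \<Rightarrow> circle \<times> real"
  where "lift z = (abs_circle (fst z), snd z)"

lemma continuous_lift: "continuous_on S lift"
  unfolding lift_def
  by (intro continuous_intros continuous_on_compose2[OF continuous_abs_circle]) auto

lemma lift_square: "lift ` ({0..1} \<times> {0..1}) = Omega"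
proof
  show "Omega \<subseteq> lift ` ({0..1} \<times> {0..1})"
  proof
    fix z assume "z \<in> Omega"
    then obtain \<theta> x where z: "z = (\<theta>, x)" "x \<in> {0..1}" by (auto simp: Omega_def)
    obtain t where "t \<in> {0..1}" "abs_circle t = \<theta>" using abs_circle_unit_interval by blast
    then show "z \<in> lift ` ({0..1} \<times> {0..1})"
      using z by (intro image_eqI[of _ _ "(t, x)"]) (auto simp: lift_def)
  qed
qed (auto simp: lift_def Omega_def)

lemma compact_Omega: "compact Omega"
  using compact_continuous_image[OF continuous_lift compact_Times[OF compact_Icc compact_Icc]]
  unfolding lift_square[symmetric] .

section \<open>Residual sets on the line and on the circle\<close>

lemma dense_iff_meets_open: "closure U = UNIV \<longleftrightarrow> (\<forall>V. open V \<longrightarrow> V \<noteq> {} \<longrightarrow> V \<inter> U \<noteq> {})"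
proof
  assume "closure U = UNIV"
  then show "\<forall>V. open V \<longrightarrow> V \<noteq> {} \<longrightarrow> V \<inter> U \<noteq> {}" using open_Int_closure_eq_empty by blast
next
  assume m: "\<forall>V. open V \<longrightarrow> V \<noteq> {} \<longrightarrow> V \<inter> U \<noteq> {}"
  have "(- closure U) \<inter> U = {}" using closure_subset by auto
  then have "- closure U = {}" using m open_Compl[OF closed_closure[of U]] by blast
  then show "closure U = UNIV" by blast
qed

text \<open>Openness of \<open>h\<close> preserves density: a nonempty open \<open>V\<close> has a
  nonempty open image, which meets the dense set \<open>U\<close>.\<close>

lemma residual_vimage:
  fixes h :: "'a::topological_space \<Rightarrow> 'b::topological_space"
  assumes "residual G" "\<And>U. open U \<Longrightarrow> open (h -` U)" "\<And>U. open U \<Longrightarrow> open (h ` U)"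
  shows "residual (h -` G)"
proof -
  obtain \<G> where \<G>: "countable \<G>" "\<And>U. U \<in> \<G> \<Longrightarrow> open U" "\<And>U. U \<in> \<G> \<Longrightarrow> closure U = UNIV" "\<Inter>\<G> \<subseteq> G"
    using assms(1) unfolding residual_def by blast
  have "closure (h -` U) = UNIV" if "U \<in> \<G>" for U
    unfolding dense_iff_meets_open
  proof (intro allI impI)
    fix V :: "'a set" assume "open V" "V \<noteq> {}"
    then have "open (h ` V)" "h ` V \<noteq> {}" using assms(3) by auto
    then have "h ` V \<inter> U \<noteq> {}" using \<G>(3)[OF that] unfolding dense_iff_meets_open by blast
    then show "V \<inter> h -` U \<noteq> {}" by auto
  qed
  then show ?thesis unfolding residual_def
    using \<G> assms(2) by (intro exI[of _ "(\<lambda>U. h -` U) ` \<G>"]) auto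
qed

lemma residual_INT:
  assumes "countable I" "\<And>i. i \<in> I \<Longrightarrow> residual (G i)"
  shows "residual (\<Inter>i\<in>I. G i)"
proof -
  have "\<forall>i\<in>I. \<exists>\<G>. countable \<G> \<and> (\<forall>U\<in>\<G>. open U \<and> closure U = UNIV) \<and> \<Inter>\<G> \<subseteq> G i"
    using assms(2) unfolding residual_def by blast
  then obtain \<G> where \<G>: "\<forall>i\<in>I. countable (\<G> i) \<and> (\<forall>U\<in>\<G> i. open U \<and> closure U = UNIV) \<and> \<Inter>(\<G> i) \<subseteq> G i"
    by (rule bchoice[THEN exE])
  have "countable (\<Union>i\<in>I. \<G> i)" using assms(1) \<G> by (intro countable_UN) auto
  moreover have "\<forall>U\<in>\<Union>i\<in>I. \<G> i. open U \<and> closure U = UNIV" using \<G> by blast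
  moreover have "\<Inter>(\<Union>i\<in>I. \<G> i) \<subseteq> (\<Inter>i\<in>I. G i)"
  proof
    fix x assume x: "x \<in> \<Inter>(\<Union>i\<in>I. \<G> i)"
    have "x \<in> G i" if "i \<in> I" for i
    proof -
      have "x \<in> \<Inter>(\<G> i)" using x that by auto
      moreover have "\<Inter>(\<G> i) \<subseteq> G i" using \<G> that by blast
      ultimately show ?thesis by (rule rev_subsetD)
    qed
    then show "x \<in> (\<Inter>i\<in>I. G i)" by simp
  qed
  ultimately show ?thesis unfolding residual_def by (intro exI[of _ "\<Union>i\<in>I. \<G> i"] conjI)
qed

lemma residual_real_dense:
  assumes "residual (G :: real set)" shows "closure G = UNIV"
proof -
  obtain \<G> where \<G>: "countable \<G>" "\<And>U. U \<in> \<G> \<Longrightarrow> open U" "\<And>U. U \<in> \<G> \<Longrightarrow> closure U = UNIV" "\<Inter>\<G> \<subseteq> G"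
    using assms unfolding residual_def by blast
  have "UNIV \<subseteq> closure (\<Inter>\<G>)"
    using \<G> by (intro Baire) (auto simp: openin_open)
  then show ?thesis using closure_mono[OF \<G>(4)] by blast
qed

lemma residual_abs_circle: "residual G \<Longrightarrow> residual (abs_circle -` G)"
  by (rule residual_vimage[OF _ _ open_image_abs_circle]) (auto simp: open_circle_def)

text \<open>Baire's theorem on the line, transferred through the open quotient map
  \<open>abs_circle\<close>.\<close>

lemma residual_circle_dense:
  assumes "residual (G :: circle set)" shows "closure G = UNIV"
  unfolding dense_iff_meets_open
proof (intro allI impI)
  fix V :: "circle set" assume V: "open V" "V \<noteq> {}"
  then have "open (abs_circle -` V)" by (simp add: open_circle_def)
  moreover have "abs_circle -` V \<noteq> {}" using V(2) surj_abs_circle by blast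
  ultimately have "abs_circle -` V \<inter> abs_circle -` G \<noteq> {}"
    using residual_real_dense[OF residual_abs_circle[OF assms]] unfolding dense_iff_meets_open by blast
  then show "V \<inter> G \<noteq> {}" by auto
qed

lemma residual_rotation: "residual G \<Longrightarrow> residual (rotation \<omega> -` G)"
proof (erule residual_vimage)
  show vim: "open (rotation \<omega> -` U)" if "open U" for \<omega> U
    using continuous_rotation[of UNIV \<omega>] that by (simp add: continuous_on_open_vimage)
  have "rotation \<omega> ` U = rotation (- \<omega>) -` U" for U
  proof
    show "rotation (- \<omega>) -` U \<subseteq> rotation \<omega> ` U"
    proof
      fix \<theta> assume "\<theta> \<in> rotation (- \<omega>) -` U"
      then show "\<theta> \<in> rotation \<omega> ` U"
        by (intro image_eqI[of _ _ "rotation (- \<omega>) \<theta>"]) (auto simp: rotation_rotation rotation_0)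
    qed
  qed (auto simp: rotation_rotation rotation_0)
  then show "open (rotation \<omega> ` U)" if "open U" for U using vim[OF that] by simp
qed

lemma residual_orbit:
  assumes "residual G" obtains \<theta> where "\<And>k. rotation (real k * c) \<theta> \<in> G"
proof -
  have "residual (\<Inter>k::nat. rotation (real k * c) -` G)"
    by (rule residual_INT) (use assms residual_rotation in auto)
  then have "closure (\<Inter>k::nat. rotation (real k * c) -` G) = UNIV" by (rule residual_circle_dense)
  then have "(\<Inter>k::nat. rotation (real k * c) -` G) \<noteq> {}" by auto
  then show ?thesis using that by blast
qed

section \<open>Separated sets and entropy\<close>

text \<open>By compactness there are finite subcovers, so the \<open>LEAST\<close> is attained.
  Assigning to each point of \<open>E\<close> a member of a smallest subcover that contains it is
  injective.\<close>

lemma min_subcover_card_ge: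
  assumes S: "compact S" and cover: "open_cover (top_of_set S) \<U>" and E: "E \<subseteq> S"
    and sep: "\<And>U x y. U \<in> \<U> \<Longrightarrow> x \<in> E \<Longrightarrow> y \<in> E \<Longrightarrow> x \<in> U \<Longrightarrow> y \<in> U \<Longrightarrow> x = y"
  shows "card E \<le> min_subcover_card (top_of_set S) \<U>"
proof -
  define P where "P k \<longleftrightarrow> (\<exists>\<V>. \<V> \<subseteq> \<U> \<and> finite \<V> \<and> card \<V> = k \<and> \<Union>\<V> = S)" for k
  have open_U: "\<forall>U\<in>\<U>. openin (top_of_set S) U" and union: "\<Union>\<U> = S"
    using cover by (auto simp: open_cover_def)
  have "\<exists>\<V>\<subseteq>\<U>. finite \<V> \<and> S \<subseteq> \<Union>\<V>"
    using S[unfolded compact_eq_openin_cover] open_U union by (metis order_refl)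
  then obtain \<V> where \<V>: "\<V> \<subseteq> \<U>" "finite \<V>" "S \<subseteq> \<Union>\<V>" by blast
  have "\<Union>\<V> = S" using \<V> union by blast
  then have "P (card \<V>)" unfolding P_def using \<V> by blast
  then have "P (LEAST k. P k)" by (rule LeastI)
  then obtain \<W> where \<W>: "\<W> \<subseteq> \<U>" "finite \<W>" "card \<W> = (LEAST k. P k)" "\<Union>\<W> = S"
    unfolding P_def by blast
  have "\<forall>x\<in>E. \<exists>U\<in>\<W>. x \<in> U" using E \<W>(4) by blast
  then obtain c where c: "\<And>x. x \<in> E \<Longrightarrow> c x \<in> \<W> \<and> x \<in> c x" by metis
  have "inj_on c E"
  proof (rule inj_onI)
    fix x y assume xy: "x \<in> E" "y \<in> E" "c x = c y"
    then show "x = y" using sep[of "c x" x y] c[of x] c[of y] \<W>(1) by auto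
  qed
  then have "card E \<le> card \<W>" using c \<W>(2) by (intro card_inj_on_le[of c]) auto
  then show ?thesis using \<W>(3) by (simp add: min_subcover_card_def P_def)
qed

lemma funpow_mem: "T ` S \<subseteq> S \<Longrightarrow> x \<in> S \<Longrightarrow> (T ^^ n) x \<in> S"
  by (induction n) auto

lemma continuous_on_funpow:
  assumes "continuous_on S T" "T ` S \<subseteq> S"
  shows "continuous_on S (T ^^ n)"
proof (induction n)
  case (Suc n)
  have "(T ^^ n) ` S \<subseteq> S" using funpow_mem[OF assms(2)] by blast
  then have "continuous_on S (T \<circ> (T ^^ n))"
    using continuous_on_compose[OF Suc continuous_on_subset[OF assms(1)]] by blast
  then show ?case by simp
qed (simp add: id_def)

lemma open_cover_iterated_join:
  assumes T: "continuous_on S T" "T ` S \<subseteq> S" and cover: "open_cover (top_of_set S) \<U>"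
  shows "open_cover (top_of_set S) (iterated_join (top_of_set S) T \<U> n)"
  unfolding open_cover_def
proof
  have open_U: "\<And>U. U \<in> \<U> \<Longrightarrow> openin (top_of_set S) U" and union: "\<Union>\<U> = S"
    using cover by (auto simp: open_cover_def)
  have "openin (top_of_set S) {x \<in> S. \<forall>i<n. (T ^^ i) x \<in> s i}" if s: "\<forall>i<n. s i \<in> \<U>" for s
    using s
  proof (induction n)
    case (Suc n)
    have "openin (top_of_set S) (S \<inter> (T ^^ n) -` s n)"
      by (rule continuous_openin_preimage[of S "T ^^ n" S])
        (use continuous_on_funpow[OF T] funpow_mem[OF T(2)] open_U Suc.prems in auto)
    moreover have "{x \<in> S. \<forall>i<Suc n. (T ^^ i) x \<in> s i} =
        {x \<in> S. \<forall>i<n. (T ^^ i) x \<in> s i} \<inter> (S \<inter> (T ^^ n) -` s n)"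
      by (auto simp: less_Suc_eq)
    ultimately show ?case using Suc openin_Int by fastforce
  qed simp
  then show "\<forall>V\<in>iterated_join (top_of_set S) T \<U> n. openin (top_of_set S) V"
    unfolding iterated_join_def by auto
  have "x \<in> \<Union>(iterated_join (top_of_set S) T \<U> n)" if x: "x \<in> S" for x
  proof -
    have "\<exists>U\<in>\<U>. (T ^^ i) x \<in> U" for i using funpow_mem[OF T(2) x, of i] union by blast
    then have "\<forall>i. \<exists>U. U \<in> \<U> \<and> (T ^^ i) x \<in> U" by blast
    then obtain s where s: "\<forall>i. s i \<in> \<U> \<and> (T ^^ i) x \<in> s i" by (rule choice[THEN exE])
    have "{y \<in> S. \<forall>i<n. (T ^^ i) y \<in> s i} \<in> iterated_join (top_of_set S) T \<U> n"
      unfolding iterated_join_def using s by auto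
    moreover have "x \<in> {y \<in> S. \<forall>i<n. (T ^^ i) y \<in> s i}" using x s by simp
    ultimately show ?thesis by (rule UnionI)
  qed
  moreover have "\<Union>(iterated_join (top_of_set S) T \<U> n) \<subseteq> S" unfolding iterated_join_def by auto
  ultimately show "\<Union>(iterated_join (top_of_set S) T \<U> n) = topspace (top_of_set S)" by auto
qed

text \<open>Since the points separate in the second coordinate, the cover by open horizontal slabs
  of height \<eta> detects them: no member of its iterated join contains two points of
  \<open>E\<close>.\<close>

lemma topological_entropy_ge:
  fixes S :: "('a::topological_space \<times> real) set"
  assumes S: "compact S" and T: "continuous_on S T" "T ` S \<subseteq> S"
    and pos: "\<eta> > 0" "m \<ge> 1" "C > 0"
    and sep: "\<And>k. \<exists>E. finite E \<and> E \<subseteq> S \<and> C ^ k \<le> real (card E) \<and>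
      (\<forall>x\<in>E. \<forall>y\<in>E. x \<noteq> y \<longrightarrow> (\<exists>i<m * k. \<eta> \<le> \<bar>snd ((T ^^ i) x) - snd ((T ^^ i) y)\<bar>))"
  shows "ereal (ln C / real m) \<le> topological_entropy (top_of_set S) T"
proof -
  define \<U> where "\<U> = (\<lambda>c. S \<inter> (UNIV \<times> ball c (\<eta> / 2))) ` UNIV"
  have cover: "open_cover (top_of_set S) \<U>"
    unfolding open_cover_def
  proof
    show "\<forall>U\<in>\<U>. openin (top_of_set S) U" unfolding \<U>_def
      by (auto simp: openin_open intro!: open_Times exI[of _ "UNIV \<times> ball _ _"])
    have "z \<in> S \<inter> (UNIV \<times> ball (snd z) (\<eta> / 2))" if "z \<in> S" for z
      using that pos by (cases z) auto
    then show "\<Union>\<U> = topspace (top_of_set S)" unfolding \<U>_def by auto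
  qed
  define a where "a n = min_subcover_card (top_of_set S) (iterated_join (top_of_set S) T \<U> n)" for n
  have growth: "C ^ k \<le> real (a (m * k))" for k
  proof -
    from sep[of k] obtain E where E: "finite E" "E \<subseteq> S" "C ^ k \<le> real (card E)"
      "\<forall>x\<in>E. \<forall>y\<in>E. x \<noteq> y \<longrightarrow> (\<exists>i<m * k. \<eta> \<le> \<bar>snd ((T ^^ i) x) - snd ((T ^^ i) y)\<bar>)"
      by (elim exE conjE)
    have "card E \<le> a (m * k)" unfolding a_def
    proof (rule min_subcover_card_ge[OF S open_cover_iterated_join[OF T cover] E(2)])
      fix U x y assume U: "U \<in> iterated_join (top_of_set S) T \<U> (m * k)"
        and xy: "x \<in> E" "y \<in> E" "x \<in> U" "y \<in> U"
      show "x = y"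
      proof (rule ccontr)
        assume "x \<noteq> y"
        then obtain i where i: "i < m * k" "\<eta> \<le> \<bar>snd ((T ^^ i) x) - snd ((T ^^ i) y)\<bar>"
          using E(4)[rule_format, OF xy(1,2) \<open>x \<noteq> y\<close>] by blast
        obtain s where s: "\<forall>i<m * k. s i \<in> \<U>" "U = {x \<in> S. \<forall>i<m * k. (T ^^ i) x \<in> s i}"
          using U unfolding iterated_join_def topspace_euclidean_subtopology by blast
        then obtain c where "s i = S \<inter> (UNIV \<times> ball c (\<eta> / 2))" using i(1) by (auto simp: \<U>_def)
        then have "(T ^^ i) x \<in> UNIV \<times> ball c (\<eta> / 2)" "(T ^^ i) y \<in> UNIV \<times> ball c (\<eta> / 2)"
          using xy s(2) i(1) by auto
        then have "\<bar>c - snd ((T ^^ i) x)\<bar> < \<eta> / 2" "\<bar>c - snd ((T ^^ i) y)\<bar> < \<eta> / 2"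
          by (auto simp: mem_Times_iff dist_real_def)
        then show False using i(2) by linarith
      qed
    qed
    then show ?thesis using E(3) by linarith
  qed
  define X where "X n = ereal (ln (real (a n)) / real n)" for n
  \<comment> \<open>The subsequence starts at \<open>m\<close> instead of 0, to keep the
    denominators positive.\<close>
  have "strict_mono (\<lambda>k. m * Suc k)" using pos by (intro strict_monoI) simp
  then have "limsup (X \<circ> (\<lambda>k. m * Suc k)) \<le> limsup X" by (rule limsup_subseq_mono)
  moreover have "ereal (ln C / real m) \<le> (X \<circ> (\<lambda>k. m * Suc k)) k" for k
  proof -
    have "0 < C ^ Suc k" using pos by simp
    then have "ln (C ^ Suc k) \<le> ln (real (a (m * Suc k)))" using growth[of "Suc k"] by (subst ln_le_cancel_iff) auto
    then have "real (Suc k) * ln C \<le> ln (real (a (m * Suc k)))" using pos by (simp only: ln_realpow)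
    then have "real (Suc k) * ln C / real (m * Suc k) \<le> ln (real (a (m * Suc k))) / real (m * Suc k)"
      by (rule divide_right_mono) simp
    moreover have "real (m * Suc k) = real (Suc k) * real m" by (simp only: of_nat_mult mult.commute)
    then have "real (Suc k) * ln C / real (m * Suc k) = ln C / real m" by (simp del: of_nat_Suc)
    ultimately show ?thesis by (simp add: X_def)
  qed
  then have "ereal (ln C / real m) \<le> limsup (X \<circ> (\<lambda>k. m * Suc k))"
    by (intro le_Limsup) auto
  ultimately have "ereal (ln C / real m) \<le> cover_entropy (top_of_set S) T \<U>"
    unfolding cover_entropy_def X_def a_def by (rule order_trans[rotated])
  also have "\<dots> \<le> topological_entropy (top_of_set S) T"
    unfolding topological_entropy_def using cover by (intro SUP_upper) simp
  finally show ?thesis .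
qed

section \<open>Lower bound for skew products\<close>

lemma skew_product_cases:
  assumes "F \<in> skew_products"
  shows "\<exists>\<omega> f. continuous_on Omega f \<and> f ` Omega \<subseteq> {0..1} \<and>
    (\<forall>\<theta>. \<forall>x\<in>{0..1}. F (\<theta>, x) = (rotation \<omega> \<theta>, f (\<theta>, x)))"
proof -
  obtain \<omega> f where "continuous_on Omega f" "f ` Omega \<subseteq> {0..1}"
    "\<forall>\<theta> x. (\<theta>, x) \<in> Omega \<longrightarrow> F (\<theta>, x) = (rotation \<omega> \<theta>, f (\<theta>, x))"
    using assms unfolding skew_products_def by blast
  then show ?thesis by (intro exI[of _ \<omega>] exI[of _ f]) (simp add: Omega_def)
qed

lemma skew_product_maps:
  assumes "F \<in> skew_products" shows "F ` Omega \<subseteq> Omega"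
proof
  fix z assume "z \<in> F ` Omega"
  then obtain \<theta> x where z: "z = F (\<theta>, x)" "x \<in> {0..1}" by (auto simp: Omega_def)
  obtain \<omega> f where "f ` Omega \<subseteq> {0..1}"
    "\<forall>\<theta>. \<forall>x\<in>{0..1}. F (\<theta>, x) = (rotation \<omega> \<theta>, f (\<theta>, x))"
    using skew_product_cases[OF assms] by blast
  moreover have "f (\<theta>, x) \<in> f ` Omega" 
    by (rule imageI) (use z in \<open>simp add: Omega_def\<close>)
  ultimately have "F (\<theta>, x) = (rotation \<omega> \<theta>, f (\<theta>, x))" "f (\<theta>, x) \<in> {0..1}"
    using z(2) by blast+
  then show "z \<in> Omega" by (simp add: Omega_def z(1))
qed

lemma skew_product_continuous:
  assumes "F \<in> skew_products" shows "continuous_on Omega F"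
proof -
  obtain \<omega> f where f: "continuous_on Omega f"
    and F: "\<forall>\<theta>. \<forall>x\<in>{0..1}. F (\<theta>, x) = (rotation \<omega> \<theta>, f (\<theta>, x))"
    using skew_product_cases[OF assms] by blast
  have "continuous_on Omega (\<lambda>z. rotation \<omega> (fst z))"
    by (rule continuous_on_compose2[OF continuous_rotation[of UNIV] continuous_on_fst[OF continuous_on_id]])
      auto
  then have "continuous_on Omega (\<lambda>z. (rotation \<omega> (fst z), f z))"
    using f by (rule continuous_on_Pair)
  then show ?thesis
    by (rule continuous_on_eq) (use F in \<open>auto simp: Omega_def\<close>)
qed

lemma skew_product_fst:
  assumes "F \<in> skew_products"
  obtains \<omega> where "\<And>n z. z \<in> Omega \<Longrightarrow> fst ((F ^^ n) z) = rotation (real n * \<omega>) (fst z)"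
proof -
  obtain \<omega> f where F: "\<forall>\<theta>. \<forall>x\<in>{0..1}. F (\<theta>, x) = (rotation \<omega> \<theta>, f (\<theta>, x))"
    using skew_product_cases[OF assms] by blast
  have fst_F: "fst (F z) = rotation \<omega> (fst z)" if "z \<in> Omega" for z
    using F that by (auto simp: Omega_def)
  have "fst ((F ^^ n) z) = rotation (real n * \<omega>) (fst z)" if z: "z \<in> Omega" for n z
  proof (induction n)
    case (Suc n)
    have "fst ((F ^^ Suc n) z) = rotation \<omega> (fst ((F ^^ n) z))"
      using fst_F funpow_mem[OF skew_product_maps[OF assms] z] by simp
    then show ?case using Suc by (simp add: rotation_rotation algebra_simps)
  qed (simp add: rotation_0)
  then show ?thesis using that by blast
qed

lemma strip_closed: "strip A \<Longrightarrow> closed A"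
  unfolding strip_def by (elim conjE)

lemma strip_subset: "strip A \<Longrightarrow> A \<subseteq> Omega"
  unfolding strip_def by (elim conjE)

lemma fibre_bounds:
  assumes "strip A" "x \<in> fibre A \<theta>"
  shows "lower_bd A \<theta> \<le> x" "x \<le> upper_bd A \<theta>"
proof -
  note cl = strip_closed[OF assms(1)] and sub = strip_subset[OF assms(1)]
  have "fibre A \<theta> = (\<lambda>x. (\<theta>, x)) -` A" by (auto simp: fibre_def)
  then have "closed (fibre A \<theta>)"
    using closed_vimage[OF cl, of "\<lambda>x. (\<theta>, x)"] by (simp add: continuous_intros)
  moreover have "fibre A \<theta> \<subseteq> {0..1}" using sub by (auto simp: fibre_def Omega_def)
  ultimately have c: "compact (fibre A \<theta>)"
    using compact_Int_closed[OF compact_Icc, of "fibre A \<theta>" 0 1] by (simp add: Int_absorb1)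
  have ne: "fibre A \<theta> \<noteq> {}" using assms(2) by auto
  obtain u where u: "u \<in> fibre A \<theta>" "\<And>y. y \<in> fibre A \<theta> \<Longrightarrow> y \<le> u"
    using compact_attains_sup[OF c ne] by blast
  have "upper_bd A \<theta> = u" unfolding upper_bd_def using u by (intro Greatest_equality) auto
  then show "x \<le> upper_bd A \<theta>" using u assms(2) by simp
  obtain l where l: "l \<in> fibre A \<theta>" "\<And>y. y \<in> fibre A \<theta> \<Longrightarrow> l \<le> y"
    using compact_attains_inf[OF c ne] by blast
  have "lower_bd A \<theta> = l" unfolding lower_bd_def using l by (intro Least_equality) auto
  then show "lower_bd A \<theta> \<le> x" using l assms(2) by simp
qed

section \<open>Separation of strips and the choice of points in them\<close>

lemma strips_apart:
  assumes "strip A" "strip B" "A \<inter> B = {}"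
  shows "\<exists>\<delta>>0. \<forall>\<theta> x y. (\<theta>, x) \<in> A \<longrightarrow> (\<theta>, y) \<in> B \<longrightarrow> \<delta> \<le> \<bar>x - y\<bar>"
proof -
  have closed: "closed (lift -` C)" if "strip C" for C
    by (rule closed_vimage[OF _ continuous_lift]) (rule strip_closed[OF that])
  let ?A = "({0..1} \<times> {0..1}) \<inter> lift -` A"
  have c: "compact ?A"
    using compact_Int_closed[OF compact_Times[OF compact_Icc compact_Icc] closed[OF assms(1)]] .
  have "?A \<inter> lift -` B = {}" using assms(3) by auto
  then obtain \<delta> where \<delta>: "\<delta> > 0" "\<And>u v. u \<in> ?A \<Longrightarrow> v \<in> lift -` B \<Longrightarrow> \<delta> \<le> dist u v"
    using separate_compact_closed[OF c closed[OF assms(2)]] by blast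
  have "\<delta> \<le> \<bar>x - y\<bar>" if "(\<theta>, x) \<in> A" "(\<theta>, y) \<in> B" for \<theta> x y
  proof -
    obtain t where t: "t \<in> {0..1}" "abs_circle t = \<theta>" using abs_circle_unit_interval by blast
    have "x \<in> {0..1}" using strip_subset[OF assms(1)] that(1) by (auto simp: Omega_def)
    then have "\<delta> \<le> dist (t, x) (t, y)" using t that by (intro \<delta>(2)) (auto simp: lift_def)
    then show ?thesis by (simp add: dist_Pair_Pair dist_real_def)
  qed
  then show ?thesis using \<delta>(1) by blast
qed

lemma uniform_lower_bound:
  assumes "finite I" "\<And>i. i \<in> I \<Longrightarrow> \<exists>\<delta>>0::real. \<forall>z\<in>D i. \<delta> \<le> z"
  shows "\<exists>\<delta>>0. \<forall>i\<in>I. \<forall>z\<in>D i. \<delta> \<le> z"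
  using assms
proof (induction I)
  case empty
  then show ?case by (intro exI[of _ 1]) auto
next
  case (insert i I)
  obtain d where d: "d > 0" "\<forall>i\<in>I. \<forall>z\<in>D i. d \<le> z"
    using insert.IH[OF insert.prems[OF insertI2]] by blast
  obtain e where "e > 0" "\<forall>z\<in>D i. e \<le> z" using insert.prems[OF insertI1] by blast
  with d show ?case by (intro exI[of _ "min d e"]) force
qed

lemma fibre_uniformly_continuous:
  assumes "continuous_on Omega h" "\<delta> > 0"
  obtains \<eta> where "\<eta> > 0" "\<And>\<theta> x y. x \<in> {0..1} \<Longrightarrow> y \<in> {0..1} \<Longrightarrow> \<bar>x - y\<bar> < \<eta> \<Longrightarrow>
    \<bar>h (\<theta>, x) - h (\<theta>, y)\<bar> < (\<delta> :: real)"
proof -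
  let ?Q = "{0..1} \<times> {0..1} :: (real \<times> real) set"
  have "continuous_on ?Q (h \<circ> lift)"
    by (rule continuous_on_compose[OF continuous_lift]) (simp add: lift_square assms)
  then have uc: "uniformly_continuous_on ?Q (h \<circ> lift)"
    by (rule compact_uniformly_continuous) (intro compact_Times compact_Icc)
  obtain \<eta> where \<eta>: "\<eta> > 0"
    "\<forall>u\<in>?Q. \<forall>v\<in>?Q. dist v u < \<eta> \<longrightarrow> dist ((h \<circ> lift) v) ((h \<circ> lift) u) < \<delta>"
    using uc[unfolded uniformly_continuous_on_def, THEN spec, THEN mp, OF assms(2)] by (elim exE conjE)
  have "\<bar>h (\<theta>, x) - h (\<theta>, y)\<bar> < \<delta>" if "x \<in> {0..1}" "y \<in> {0..1}" "\<bar>x - y\<bar> < \<eta>" for \<theta> x y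
  proof -
    obtain t where t: "t \<in> {0..1}" "abs_circle t = \<theta>" using abs_circle_unit_interval by blast
    have "dist (t, x) (t, y) < \<eta>" using that(3) by (simp add: dist_Pair_Pair dist_real_def)
    then have "dist ((h \<circ> lift) (t, x)) ((h \<circ> lift) (t, y)) < \<delta>"
      using \<eta>(2)[rule_format, of "(t, y)" "(t, x)"] that t(1) by auto
    then show ?thesis by (simp add: lift_def t(2) dist_real_def)
  qed
  then show ?thesis using that \<eta>(1) by blast
qed

lemma increasing_enumeration:
  fixes f :: "nat \<Rightarrow> real"
  assumes "inj_on f {..<q}"
  shows "\<exists>\<rho>. bij_betw \<rho> {..<q} {..<q} \<and> (\<forall>i j. i < j \<and> j < q \<longrightarrow> f (\<rho> i) < f (\<rho> j))"
proof -
  define L where "L = sort_key f [0..<q]"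
  have L: "length L = q" "set L = {..<q}" "distinct L" "sorted (map f L)" by (auto simp: L_def)
  have "bij_betw ((!) L) {..<q} {..<q}" by (rule bij_betw_nth[OF L(3)]) (use L in simp_all)
  moreover have "f (L ! i) < f (L ! j)" if "i < j" "j < q" for i j
  proof -
    have le: "f (L ! i) \<le> f (L ! j)" using sorted_nth_mono[OF L(4), of i j] that L(1) by simp
    have "L ! i \<noteq> L ! j" using that L(1) nth_eq_iff_index_eq[OF L(3), of i j] by simp
    moreover have "L ! i \<in> {..<q}" "L ! j \<in> {..<q}"
      using that L(1,2) nth_mem[of i L] nth_mem[of j L] by auto
    ultimately have "f (L ! i) \<noteq> f (L ! j)" using inj_onD[OF assms] by blast
    with le show ?thesis by simp
  qed
  ultimately show ?thesis by blast
qed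

text \<open>\<open>P k j\<close> is labelled by the strip in which it lies, not by the strip in
  which its orbit began: from time \<open>k\<close> to \<open>k + 1\<close> the point moves from
  strip \<open>j\<close> to strip \<open>Suc j mod q\<close>. After \<open>q\<close> steps it is
  back in its strip but in general not at the same place, so the labels rather than the points are
  periodic.\<close>

lemma strip_orbit_points:
  assumes F: "F \<in> skew_products" and A: "periodic_strip F (h * q) A" and "h \<ge> 1"
    and T_def: "T = F ^^ h"
  obtains \<theta> P c \<delta> where
    "\<And>k j. j < q \<Longrightarrow> P k j \<in> {0..1}"
    "\<And>k z. z \<in> Omega \<Longrightarrow> fst ((T ^^ k) z) = rotation (real k * c) (fst z)"
    "\<And>k j. j < q \<Longrightarrow> snd (T (rotation (real k * c) \<theta>, P k j)) = P (Suc k) (Suc j mod q)"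
    "\<delta> > 0" "\<And>k i j. i < q \<Longrightarrow> j < q \<Longrightarrow> i \<noteq> j \<Longrightarrow> \<delta> \<le> \<bar>P k i - P k j\<bar>"
    "\<And>k i j. i < q \<Longrightarrow> j < q \<Longrightarrow> P k i < P k j \<longleftrightarrow> P 0 i < P 0 j"
proof -
  define B where "B i = (T ^^ i) ` A" for i
  have TB: "(T ^^ i) ` A = (F ^^ (h * i)) ` A" for i by (simp add: T_def funpow_mult)
  have q1: "q \<ge> 1" using A by (cases q) (auto simp: periodic_strip_def)
  have idx: "h * i < h * q" if "i < q" for i using that \<open>h \<ge> 1\<close> by simp
  have strip: "strip (B i)" if "i < q" for i
    using A idx[OF that] unfolding periodic_strip_def B_def TB by blast
  have pair: "B i \<inter> B j = {}" "strips_ordered (B i) (B j)" if "i < q" "j < q" "i \<noteq> j" for i j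
  proof -
    have "h * i \<noteq> h * j" using that \<open>h \<ge> 1\<close> by simp
    then show "B i \<inter> B j = {}" "strips_ordered (B i) (B j)"
      using A idx[OF that(1)] idx[OF that(2)] unfolding periodic_strip_def B_def TB by blast+
  qed
  have Bq: "(T ^^ q) ` A = A" using A unfolding periodic_strip_def TB by blast
  have T_B: "T z \<in> B (Suc i mod q)" if "z \<in> B i" "i < q" for z i
  proof -
    have "T z \<in> (T ^^ Suc i) ` A" using that(1) by (auto simp: B_def)
    also have "(T ^^ Suc i) ` A = B (Suc i mod q)"
    proof (cases "Suc i = q")
      case True
      then show ?thesis using Bq by (simp add: B_def)
    next
      case False
      then show ?thesis using that(2) by (simp add: B_def)
    qed
    finally show ?thesis .
  qed
  obtain \<omega> where \<omega>: "\<And>n z. z \<in> Omega \<Longrightarrow> fst ((F ^^ n) z) = rotation (real n * \<omega>) (fst z)"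
    using skew_product_fst[OF F] by blast
  define c where "c = real h * \<omega>"
  have fst_T: "fst ((T ^^ k) z) = rotation (real k * c) (fst z)" if "z \<in> Omega" for k z
    using \<omega>[OF that, of "h * k"] by (simp add: T_def funpow_mult c_def mult_ac)
  define less where "less i j \<longleftrightarrow> strip_less (B i) (B j)" for i j
  \<comment> \<open>The implication makes this set residual for every pair, whichever of the two
    strips is below, so that all pairs can be intersected.\<close>
  define Gs where "Gs i j = {\<theta>. less i j \<longrightarrow> upper_bd (B i) \<theta> < lower_bd (B j) \<theta>}" for i j
  have "residual (Gs i j)" for i j
  proof (cases "less i j")
    case True
    then obtain G where "residual G" "\<forall>\<theta>\<in>G. upper_bd (B i) \<theta> < lower_bd (B j) \<theta>"
      by (auto simp: less_def strip_less_def)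
    then have "G \<subseteq> Gs i j" by (auto simp: Gs_def)
    then show ?thesis using \<open>residual G\<close> unfolding residual_def by (meson order_trans)
  next
    case False
    then have "Gs i j = UNIV" by (simp add: Gs_def)
    then show ?thesis unfolding residual_def by (auto intro!: exI[of _ "{}"])
  qed
  then have "residual (\<Inter>p\<in>{..<q} \<times> {..<q}. Gs (fst p) (snd p))"
    by (intro residual_INT) (auto intro: countable_finite)
  then obtain \<theta> where \<theta>: "\<And>k. rotation (real k * c) \<theta> \<in> (\<Inter>p\<in>{..<q} \<times> {..<q}. Gs (fst p) (snd p))"
    using residual_orbit by blast
  define rot where "rot k = rotation (real k * c) \<theta>" for k
  have "\<exists>y. (\<theta>, y) \<in> B j" if "j < q" for j
  proof -
    have "\<theta> \<in> fst ` B j" using strip[OF that] unfolding strip_def by blast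
    then show ?thesis by force
  qed
  then obtain y where y: "\<And>j. j < q \<Longrightarrow> (\<theta>, y j) \<in> B j" by metis
  \<comment> \<open>\<open>(j + (q - 1)) mod q\<close> is the cyclic predecessor of
    \<open>j\<close>. The initial points \<open>y j\<close> are arbitrary points of the strips over
    \<open>\<theta>\<close>.\<close>
  define P where "P = rec_nat y (\<lambda>k p j. snd (T (rot k, p ((j + (q - 1)) mod q))))"
  have P_Suc: "P (Suc k) j = snd (T (rot k, P k ((j + (q - 1)) mod q)))" for k j
    by (simp add: P_def)
  have step: "snd (T (rot k, P k j)) = P (Suc k) (Suc j mod q)" if "j < q" for k j
  proof -
    have "(Suc j mod q + (q - 1)) mod q = (Suc j + (q - 1)) mod q" by (simp add: mod_add_left_eq)
    also have "Suc j + (q - 1) = j + q" using q1 by simp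
    finally show ?thesis using that by (simp add: P_Suc)
  qed
  have fst_T1: "fst (T (rot k, x)) = rot (Suc k)" if "x \<in> {0..1}" for k x
    using fst_T[of "(rot k, x)" 1] that by (simp add: Omega_def rot_def rotation_rotation algebra_simps)
  have mem: "(rot k, P k j) \<in> B j" if "j < q" for k j
    using that
  proof (induction k arbitrary: j)
    case 0
    then show ?case using y by (simp add: P_def rot_def rotation_0)
  next
    case (Suc k)
    define i where "i = (j + (q - 1)) mod q"
    have i: "i < q" using q1 by (simp add: i_def)
    have "Suc i mod q = (Suc (j + (q - 1))) mod q" unfolding i_def by (simp add: mod_Suc_eq)
    also have "Suc (j + (q - 1)) = j + q" using q1 by simp
    finally have j: "Suc i mod q = j" using Suc.prems by simp
    have "P k i \<in> {0..1}" using Suc.IH[OF i] strip_subset[OF strip[OF i]] by (auto simp: Omega_def)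
    then have "T (rot k, P k i) = (rot (Suc k), P (Suc k) j)"
      using fst_T1 by (simp add: prod_eq_iff P_Suc i_def)
    then show ?case using T_B[OF Suc.IH[OF i] i] j by simp
  qed
  have unit: "P k j \<in> {0..1}" if "j < q" for k j
  proof -
    have "(rot k, P k j) \<in> Omega" using mem[OF that] strip_subset[OF strip[OF that]] by blast
    then show ?thesis by (simp add: Omega_def)
  qed
  define D where "D p = {\<bar>x - x'\<bar> | \<theta> x x'. (\<theta>, x) \<in> B (fst p) \<and> (\<theta>, x') \<in> B (snd p)}" for p
  define I where "I = {p \<in> {..<q} \<times> {..<q}. fst p \<noteq> snd p}"
  have "\<exists>\<delta>>0. \<forall>p\<in>I. \<forall>z\<in>D p. \<delta> \<le> z"
  proof (rule uniform_lower_bound)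
    show "finite I" by (simp add: I_def)
    fix p assume "p \<in> I"
    then have p: "fst p < q" "snd p < q" "fst p \<noteq> snd p" by (auto simp: I_def)
    obtain \<delta> where "\<delta> > 0" "\<forall>\<theta> x y. (\<theta>, x) \<in> B (fst p) \<longrightarrow> (\<theta>, y) \<in> B (snd p) \<longrightarrow> \<delta> \<le> \<bar>x - y\<bar>"
      using strips_apart[OF strip[OF p(1)] strip[OF p(2)] pair(1)[OF p]] by blast
    then show "\<exists>\<delta>>0. \<forall>z\<in>D p. \<delta> \<le> z" unfolding D_def by blast
  qed
  then obtain \<delta> where \<delta>: "\<delta> > 0" "\<forall>p\<in>I. \<forall>z\<in>D p. \<delta> \<le> z" by blast
  have apart: "\<delta> \<le> \<bar>P k i - P k j\<bar>" if "i < q" "j < q" "i \<noteq> j" for k i j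
  proof -
    have "(i, j) \<in> I" using that by (simp add: I_def)
    moreover have "\<bar>P k i - P k j\<bar> \<in> D (i, j)" unfolding D_def
      by (rule CollectI, intro exI[of _ "rot k"] exI[of _ "P k i"] exI[of _ "P k j"]) (simp add: mem that)
    ultimately show ?thesis using \<delta>(2) by blast
  qed
  have less_P: "P k i < P k j" if "i < q" "j < q" "less i j" for k i j
  proof -
    have "rot k \<in> Gs i j" using \<theta>[of k] that(1,2) by (auto simp: rot_def)
    then have "upper_bd (B i) (rot k) < lower_bd (B j) (rot k)" using that(3) by (simp add: Gs_def)
    moreover have "P k i \<le> upper_bd (B i) (rot k)" "lower_bd (B j) (rot k) \<le> P k j"
      using fibre_bounds[OF strip] mem that by (auto simp: fibre_def)
    ultimately show ?thesis by linarith
  qed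
  have iff: "P k i < P k j \<longleftrightarrow> P 0 i < P 0 j" if ij: "i < q" "j < q" for k i j
  proof (cases "i = j")
    case False
    then consider "less i j" | "less j i"
      using pair(2)[OF ij False] by (auto simp: strips_ordered_def less_def)
    then show ?thesis
    proof cases
      case 1
      then show ?thesis using less_P[OF ij] by simp
    next
      case 2
      then show ?thesis using less_P[OF ij(2,1) 2, of k] less_P[OF ij(2,1) 2, of 0] by simp
    qed
  qed simp
  show ?thesis
  proof (rule that[of P c \<theta> \<delta>])
    show "snd (T (rotation (real k * c) \<theta>, P k j)) = P (Suc k) (Suc j mod q)" if "j < q" for k j
      using step[OF that] by (simp only: rot_def)
    show "\<delta> \<le> \<bar>P k i - P k j\<bar>" if "i < q" "j < q" "i \<noteq> j" for k i j by (rule apart[OF that])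
    show "P k i < P k j \<longleftrightarrow> P 0 i < P 0 j" if "i < q" "j < q" for k i j by (rule iff[OF that])
  qed (fact unit fst_T \<delta>(1))+
qed

text \<open>Some gap has at least \<open>lambda q ^ (n * k)\<close> paths of length
  \<open>n * k\<close>, and thinning costs \<open>2 ^ k\<close>. A block of \<open>n\<close> steps
  of \<open>T\<close>, that is, \<open>h * n\<close> steps of \<open>F\<close>, thus multiplies the
  number of separated orbits by \<open>C = lambda q ^ n / 2\<close>.\<close>

lemma forced_cycle_entropy:
  assumes F: "F \<in> skew_products" and h: "h \<ge> 1" and T_def: "T = F ^^ h"
    and fst_T: "\<And>k z. z \<in> Omega \<Longrightarrow> fst ((T ^^ k) z) = rotation (real k * c) (fst z)"
    and g_def: "\<And>k x. g k x = snd (T (rotation (real k * c) \<theta>, x))"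
    and forced: "forced_cycle \<sigma> e q p g \<delta>" and n: "n \<ge> 1"
  shows "ereal (ln (lambda q) / real h - ln 2 / (real h * real n)) \<le> topological_entropy (top_of_set Omega) F"
proof -
  interpret forced_cycle \<sigma> e q p g \<delta> by (rule forced)
  note maps = skew_product_maps[OF F] and cont = skew_product_continuous[OF F]
  define rot where "rot k = rotation (real k * c) \<theta>" for k
  have T_maps: "(T ^^ m) z \<in> Omega" if "z \<in> Omega" for m z
    using funpow_mem[OF maps that] by (simp add: T_def funpow_mult)
  have G_eq: "(T ^^ m) (rot k, x) = (rot (k + m), G k m x)" if x: "x \<in> {0..1}" for k m x
  proof (induction m)
    case (Suc m)
    have "(rot (k + m), G k m x) \<in> Omega" using G_maps[OF x] by (simp add: Omega_def)
    then have "fst ((T ^^ 1) (rot (k + m), G k m x)) = rotation (real 1 * c) (rot (k + m))"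
      using fst_T by (metis fst_conv)
    then have "fst (T (rot (k + m), G k m x)) = rot (k + Suc m)"
      by (simp add: rot_def rotation_rotation algebra_simps)
    moreover have "snd (T (rot (k + m), G k m x)) = G k (Suc m) x"
      using g_def[of "k + m" "G k m x"] by (simp add: rot_def)
    ultimately have "T (rot (k + m), G k m x) = (rot (k + Suc m), G k (Suc m) x)"
      by (simp only: prod_eq_iff fst_conv snd_conv)
    then show ?case using Suc by (simp only: funpow.simps(2) o_apply)
  qed simp
  have "continuous_on Omega (\<lambda>z. snd ((T ^^ n) z))"
    using continuous_on_funpow[OF cont maps, of "h * n"]
    by (intro continuous_on_snd) (simp add: T_def funpow_mult)
  then obtain \<eta> where \<eta>: "\<eta> > 0" "\<And>\<theta> x y. x \<in> {0..1} \<Longrightarrow> y \<in> {0..1} \<Longrightarrow> \<bar>x - y\<bar> < \<eta> \<Longrightarrow>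
      \<bar>snd ((T ^^ n) (\<theta>, x)) - snd ((T ^^ n) (\<theta>, y))\<bar> < \<delta>"
    using fibre_uniformly_continuous[OF _ \<delta>_pos] by blast
  have uniform: "\<bar>G k n x - G k n y\<bar> < \<delta>" if "x \<in> {0..1}" "y \<in> {0..1}" "\<bar>x - y\<bar> < \<eta>" for k x y
    using \<eta>(2)[OF that, of "rot k"] G_eq that by simp
  define C where "C = lambda q ^ n / 2"
  have C: "C > 0" using lambda_gt_1[OF q_ge_3] by (simp add: C_def)
  have "ereal (ln C / real (h * n)) \<le> topological_entropy (top_of_set Omega) F"
  proof (rule topological_entropy_ge[OF compact_Omega cont maps \<eta>(1) _ C])
    show "h * n \<ge> 1" using h n by simp
    fix k
    obtain i where i: "i < q - 1" "lambda q ^ (n * k) \<le> paths (n * k) i" using many_paths by blast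
    then have i': "Suc i < q" by simp
    have "\<exists>E. finite E \<and> E \<subseteq> {p 0 i..p 0 (Suc i)} \<and> paths (n * k) i \<le> 2 ^ k * real (card E) \<and>
      (\<forall>x\<in>E. \<forall>y\<in>E. x \<noteq> y \<longrightarrow> (\<exists>j<k. \<eta> \<le> \<bar>G 0 (n * j) x - G 0 (n * j) y\<bar>))"
      by (rule separated_set[OF \<eta>(1) _ i']) (rule uniform)
    then obtain E where E: "finite E" "E \<subseteq> {p 0 i..p 0 (Suc i)}" "paths (n * k) i \<le> 2 ^ k * real (card E)"
      "\<forall>x\<in>E. \<forall>y\<in>E. x \<noteq> y \<longrightarrow> (\<exists>j<k. \<eta> \<le> \<bar>G 0 (n * j) x - G 0 (n * j) y\<bar>)"
      by (elim exE conjE)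
    have E_unit: "x \<in> {0..1}" if "x \<in> E" for x
    proof -
      have "p 0 i \<le> x" "x \<le> p 0 (Suc i)" using E(2) that by auto
      moreover have "p 0 i \<in> {0..1}" "p 0 (Suc i) \<in> {0..1}" using p_range i' by simp_all
      ultimately show ?thesis by simp
    qed
    define E' where "E' = (\<lambda>x. (rot 0, x)) ` E"
    have "C ^ k = lambda q ^ (n * k) / 2 ^ k" by (simp add: C_def power_divide power_mult)
    also have "\<dots> \<le> real (card E)" using i(2) E(3) by (simp add: divide_le_eq mult.commute)
    also have "card E = card E'" unfolding E'_def by (subst card_image) (auto simp: inj_on_def)
    finally have "C ^ k \<le> real (card E')" .
    moreover have "finite E'" "E' \<subseteq> Omega" using E(1) E_unit by (auto simp: E'_def Omega_def)
    moreover have "\<exists>l<h * n * k. \<eta> \<le> \<bar>snd ((F ^^ l) u) - snd ((F ^^ l) v)\<bar>"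
      if uv: "u \<in> E'" "v \<in> E'" "u \<noteq> v" for u v
    proof -
      obtain x y where xy: "u = (rot 0, x)" "v = (rot 0, y)" "x \<in> E" "y \<in> E" "x \<noteq> y"
        using uv by (auto simp: E'_def)
      obtain j where j: "j < k" "\<eta> \<le> \<bar>G 0 (n * j) x - G 0 (n * j) y\<bar>"
        using E(4)[rule_format, OF xy(3-5)] by blast
      have "snd ((F ^^ (h * n * j)) (rot 0, w)) = G 0 (n * j) w" if "w \<in> E" for w
        using G_eq[OF E_unit[OF that], of "n * j" 0] by (simp add: T_def funpow_mult mult.assoc)
      then have "\<eta> \<le> \<bar>snd ((F ^^ (h * n * j)) u) - snd ((F ^^ (h * n * j)) v)\<bar>"
        using j(2) xy by simp
      moreover have "h * n * j < h * n * k" using j(1) h n by simp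
      ultimately show ?thesis by blast
    qed
    ultimately show "\<exists>E. finite E \<and> E \<subseteq> Omega \<and> C ^ k \<le> real (card E) \<and>
        (\<forall>x\<in>E. \<forall>y\<in>E. x \<noteq> y \<longrightarrow> (\<exists>i<h * n * k. \<eta> \<le> \<bar>snd ((F ^^ i) x) - snd ((F ^^ i) y)\<bar>))"
      by (intro exI[of _ E'] conjI ballI impI)
  qed
  moreover have "ln C = real n * ln (lambda q) - ln 2"
    using lambda_gt_1[OF q_ge_3] by (simp add: C_def ln_div ln_realpow)
  then have "ln C / real (h * n) = ln (lambda q) / real h - ln 2 / (real h * real n)"
    using h n by (simp add: field_simps)
  ultimately show ?thesis by simp
qed

lemma strips_entropy:
  assumes F: "F \<in> skew_products" and A: "periodic_strip F (h * q) A" and h: "h \<ge> 1"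
    and q: "odd q" "q \<ge> 3"
  shows "ereal (ln (lambda q) / real h) \<le> topological_entropy (top_of_set Omega) F"
proof (rule strip_orbit_points[OF F A h refl])
  define T where "T = F ^^ h"
  fix \<theta> P c \<delta>
  assume unit: "\<And>k j. j < q \<Longrightarrow> P k j \<in> {0..1}"
    and fst_T: "\<And>k z. z \<in> Omega \<Longrightarrow> fst (((F ^^ h) ^^ k) z) = rotation (real k * c) (fst z)"
    and step: "\<And>k j. j < q \<Longrightarrow> snd ((F ^^ h) (rotation (real k * c) \<theta>, P k j)) = P (Suc k) (Suc j mod q)"
    and \<delta>: "\<delta> > 0"
    and apart: "\<And>k i j. i < q \<Longrightarrow> j < q \<Longrightarrow> i \<noteq> j \<Longrightarrow> \<delta> \<le> \<bar>P k i - P k j\<bar>"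
    and order: "\<And>k i j. i < q \<Longrightarrow> j < q \<Longrightarrow> P k i < P k j \<longleftrightarrow> P 0 i < P 0 j"
  note fst_T = fst_T[folded T_def] and step = step[folded T_def]
  have "inj_on (P 0) {..<q}"
  proof (rule inj_onI)
    fix i j assume ij: "i \<in> {..<q}" "j \<in> {..<q}" "P 0 i = P 0 j"
    then show "i = j" using apart[of i j 0] \<delta> by fastforce
  qed
  then obtain \<rho> where \<rho>: "bij_betw \<rho> {..<q} {..<q}" "\<And>i j. i < j \<Longrightarrow> j < q \<Longrightarrow> P 0 (\<rho> i) < P 0 (\<rho> j)"
    using increasing_enumeration by blast
  define \<rho>' where "\<rho>' = inv_into {..<q} \<rho>"
  have \<rho>'_bij: "bij_betw \<rho>' {..<q} {..<q}" unfolding \<rho>'_def by (rule bij_betw_inv_into[OF \<rho>(1)])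
  have \<rho>\<rho>': "\<rho> (\<rho>' j) = j" if "j < q" for j
    unfolding \<rho>'_def using bij_betw_inv_into_right[OF \<rho>(1)] that by simp
  have \<rho>_less: "\<rho> i < q" if "i < q" for i using bij_betwE[OF \<rho>(1)] that by simp
  have \<rho>'_less: "\<rho>' i < q" if "i < q" for i using bij_betwE[OF \<rho>'_bij] that by simp
  \<comment> \<open>\<open>\<rho> i\<close> is the strip of rank \<open>i\<close> over
    \<open>\<theta>\<close>, and by \<open>order\<close> also at all later times. Conjugating the
    cyclic shift of the strips by \<open>\<rho>\<close> gives \<open>\<sigma>\<close>.\<close>
  define e where "e k = \<rho>' (k mod q)" for k
  define \<sigma> where "\<sigma> i = \<rho>' (Suc (\<rho> i) mod q)" for i
  define p where "p k i = P k (\<rho> i)" for k i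
  define g where "g k x = snd (T (rotation (real k * c) \<theta>, x))" for k x
  note maps = skew_product_maps[OF F] and cont = skew_product_continuous[OF F]
  have q0: "q > 0" using q by simp
  have fc: "forced_cycle \<sigma> e q p g \<delta>"
  proof
    show "\<sigma> (e k) = e (Suc k)" for k using q0 by (simp add: \<sigma>_def e_def \<rho>\<rho>' mod_Suc_eq)
    show "e (k + q) = e k" for k by (simp add: e_def)
    show "bij_betw e {..<q} {..<q}"
      using \<rho>'_bij by (rule bij_betw_cong[THEN iffD1, rotated]) (simp add: e_def)
    show "odd q" "q \<ge> 3" by (rule q)+
    show "g k x \<in> {0..1}" if "x \<in> {0..1}" for k x
    proof -
      have "T (rotation (real k * c) \<theta>, x) \<in> Omega"
        unfolding T_def by (rule funpow_mem[OF maps]) (use that in \<open>simp add: Omega_def\<close>)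
      then show ?thesis by (auto simp: g_def Omega_def mem_Times_iff)
    qed
    show "continuous_on {0..1} (g k)" for k
      unfolding g_def
    proof (intro continuous_on_snd)
      show "continuous_on {0..1} (\<lambda>x. T (rotation (real k * c) \<theta>, x))"
        unfolding T_def
        by (rule continuous_on_compose2[OF continuous_on_funpow[OF cont maps]])
          (auto simp: Omega_def intro!: continuous_intros)
    qed
    show "p k i \<in> {0..1}" if "i < q" for k i using unit[OF \<rho>_less[OF that]] by (simp add: p_def)
    show "p k i + \<delta> \<le> p k (Suc i)" if "Suc i < q" for k i
    proof -
      have l: "\<rho> i < q" "\<rho> (Suc i) < q" using \<rho>_less that by auto
      have "P k (\<rho> i) < P k (\<rho> (Suc i))" using order[OF l] \<rho>(2)[of i "Suc i"] that by simp
      moreover from this have "\<rho> i \<noteq> \<rho> (Suc i)" by auto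
      ultimately show ?thesis using apart[OF l, of k] unfolding p_def by linarith
    qed
    show "\<delta> > 0" by (rule \<delta>)
    show "g k (p k i) = p (Suc k) (\<sigma> i)" if "i < q" for k i
      using step[OF \<rho>_less[OF that]] q0 by (simp add: g_def p_def \<sigma>_def \<rho>\<rho>')
  qed
  have *: "ereal (ln (lambda q) / real h - ln 2 / (real h * real n)) \<le> topological_entropy (top_of_set Omega) F"
    if "n \<ge> 1" for n
    by (rule forced_cycle_entropy[OF F h T_def _ _ fc that, of c \<theta>]) (erule fst_T, rule g_def)
  \<comment> \<open>Long blocks make the loss of \<open>ln 2\<close> per block negligible.\<close>
  have "(\<lambda>n. ln (lambda q) / real h - ln 2 / (real h * real n)) \<longlonglongrightarrow> ln (lambda q) / real h - 0"
    by (intro tendsto_intros tendsto_divide_0[OF tendsto_const] filterlim_at_top_imp_at_infinity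
        filterlim_tendsto_pos_mult_at_top[OF tendsto_const _ filterlim_real_sequentially]) (use h in auto)
  then have "(\<lambda>n. ereal (ln (lambda q) / real h - ln 2 / (real h * real n))) \<longlonglongrightarrow> ereal (ln (lambda q) / real h)"
    by (simp add: lim_ereal)
  then show "ereal (ln (lambda q) / real h) \<le> topological_entropy (top_of_set Omega) F"
    by (rule LIMSEQ_le_const2) (use * in blast)
qed

section \<open>Upper bound for products with a rotation\<close>

text \<open>Bowen's way of counting orbits of length \<open>n\<close> at scale \<epsilon>, by pieces
  of small dynamical diameter.\<close>

definition orbit_cover :: "(real \<Rightarrow> real) \<Rightarrow> real set \<Rightarrow> nat \<Rightarrow> real \<Rightarrow> nat \<Rightarrow> bool"
  where "orbit_cover g S n \<epsilon> N \<longleftrightarrow> (\<exists>\<J>. finite \<J> \<and> card \<J> \<le> N \<and> \<Union>\<J> = S \<and>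
    (\<forall>J\<in>\<J>. \<forall>x\<in>J. \<forall>y\<in>J. \<forall>i<n. \<bar>(g ^^ i) x - (g ^^ i) y\<bar> \<le> \<epsilon>))"

text \<open>The polynomial factor disappears in the entropy. It leaves room for the middle third of
  a doubling, which raises the degree by one.\<close>

definition growth_rate_le :: "(real \<Rightarrow> real) \<Rightarrow> real \<Rightarrow> bool"
  where "growth_rate_le g r \<longleftrightarrow> (\<forall>\<epsilon>>0. \<exists>C\<ge>1. \<exists>a::nat. \<forall>n. \<exists>N.
    orbit_cover g {0..1} n \<epsilon> N \<and> real N \<le> C * (real n + 1) ^ a * r ^ n)"

definition product_map :: "real \<Rightarrow> (real \<Rightarrow> real) \<Rightarrow> circle \<times> real \<Rightarrow> circle \<times> real"
  where "product_map \<omega> g z = (rotation \<omega> (fst z), g (snd z))"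

lemma funpow_product_map:
  "(product_map \<omega> g ^^ i) (\<theta>, x) = (rotation (real i * \<omega>) \<theta>, (g ^^ i) x)"
  by (induction i) (auto simp: product_map_def rotation_0 rotation_rotation algebra_simps)

lemma min_subcover_card_le:
  assumes "\<V> \<subseteq> \<U>" "finite \<V>" "\<Union>\<V> = topspace X"
  shows "min_subcover_card X \<U> \<le> card \<V>"
  unfolding min_subcover_card_def by (rule Least_le) (use assms in blast)

text \<open>The ball is taken in the plane and may leave the unit square: horizontally
  \<open>lift\<close> wraps it around the circle, vertically the condition
  \<open>lift w \<in> Omega\<close> cuts it off.\<close>

lemma lebesgue_number:
  assumes "open_cover (top_of_set Omega) \<U>"
  shows "\<exists>\<epsilon>>0. \<forall>z\<in>{0..1} \<times> {0..1}. \<exists>U\<in>\<U>. \<forall>w\<in>ball z \<epsilon>. lift w \<in> Omega \<longrightarrow> lift w \<in> U"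
proof -
  define \<G> where "\<G> = {lift -` U | U. open U \<and> Omega \<inter> U \<in> \<U>}"
  have cov: "{0..1} \<times> {0..1} \<subseteq> \<Union>\<G>"
  proof
    fix z :: "real \<times> real" assume "z \<in> {0..1} \<times> {0..1}"
    then have "lift z \<in> Omega" using lift_square by blast
    then obtain V where V: "V \<in> \<U>" "lift z \<in> V" using assms unfolding open_cover_def by auto
    then have "openin (top_of_set Omega) V" using assms unfolding open_cover_def by blast
    then obtain U where U: "open U" "V = Omega \<inter> U" unfolding openin_open by blast
    then have "lift -` U \<in> \<G>" using V(1) by (auto simp: \<G>_def)
    then show "z \<in> \<Union>\<G>" using V(2) U by auto
  qed
  have op: "open G" if "G \<in> \<G>" for G
    using that open_vimage[OF _ continuous_lift] by (auto simp: \<G>_def)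
  have "compact ({0..1} \<times> {0..1} :: (real \<times> real) set)" by (rule compact_Times[OF compact_Icc compact_Icc])
  from Heine_Borel_lemma[OF this cov op] obtain \<epsilon> where
    \<epsilon>: "\<epsilon> > 0" "\<And>z. z \<in> {0..1} \<times> {0..1} \<Longrightarrow> \<exists>G\<in>\<G>. ball z \<epsilon> \<subseteq> G" by blast
  have "\<exists>U\<in>\<U>. \<forall>w\<in>ball z \<epsilon>. lift w \<in> Omega \<longrightarrow> lift w \<in> U" if z: "z \<in> {0..1} \<times> {0..1}" for z
  proof -
    obtain G where "G \<in> \<G>" "ball z \<epsilon> \<subseteq> G" using \<epsilon>(2)[OF z] by blast
    then obtain U where U: "open U" "Omega \<inter> U \<in> \<U>" "ball z \<epsilon> \<subseteq> lift -` U" by (auto simp: \<G>_def)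
    then show ?thesis by (intro bexI[of _ "Omega \<inter> U"]) auto
  qed
  then show ?thesis using \<epsilon>(1) by blast
qed

text \<open>The rotation is an isometry, so that finitely many arcs, independently of \<open>n\<close>, suffice in the
  direction of the circle.\<close>

lemma subcover_card_product_map_le:
  assumes g: "g ` {0..1} \<subseteq> {0..1}" and cover: "open_cover (top_of_set Omega) \<U>"
  shows "\<exists>\<epsilon>>0. \<exists>L::nat. L \<ge> 1 \<and> (\<forall>n N. orbit_cover g {0..1} n \<epsilon> N \<longrightarrow>
    min_subcover_card (top_of_set Omega) (iterated_join (top_of_set Omega) (product_map \<omega> g) \<U> n) \<le> L * N)"
proof -
  obtain \<epsilon> where \<epsilon>: "\<epsilon> > 0"
    and leb: "\<And>z. z \<in> {0..1} \<times> {0..1} \<Longrightarrow> \<exists>U\<in>\<U>. \<forall>w\<in>ball z \<epsilon>. lift w \<in> Omega \<longrightarrow> lift w \<in> U"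
    using lebesgue_number[OF cover] by blast
  obtain L :: nat where L: "3 / \<epsilon> < real L" using reals_Archimedean2 by blast
  have L0: "real L > 0" using L \<epsilon> by (meson divide_pos_pos less_trans zero_less_numeral)
  \<comment> \<open>One third of \<epsilon> is spent on the length of an arc and one on the
    oscillation in the fibre, so that their sum stays strictly below \<epsilon>.\<close>
  have L\<epsilon>: "1 / real L \<le> \<epsilon> / 3" using L L0 \<epsilon> by (simp add: field_simps)
  define arc where "arc b = abs_circle ` {real b / real L..real (Suc b) / real L}" for b :: nat
  have arcs: "\<exists>b<L. \<theta> \<in> arc b" for \<theta>
  proof -
    obtain s where s: "\<theta> = abs_circle s" using surj_abs_circle by metis
    define t where "t = frac s"
    have t: "0 \<le> t" "t < 1" "\<theta> = abs_circle t"
      using frac_ge_0 frac_lt_1 by (auto simp: t_def s abs_circle_eq_iff frac_def)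
    define b where "b = nat \<lfloor>t * real L\<rfloor>"
    have b: "real b \<le> t * real L" "t * real L < real (Suc b)"
    proof -
      have "real b = of_int \<lfloor>t * real L\<rfloor>" using t(1) L0 by (simp add: b_def)
      then show "real b \<le> t * real L" "t * real L < real (Suc b)"
        using floor_correct[of "t * real L"] unfolding of_nat_Suc by linarith+
    qed
    have "t * real L < real L" using t(2) L0 by simp
    then have "b < L" using b(1) by linarith
    moreover have "t \<in> {real b / real L..real (Suc b) / real L}"
      using b L0 by (auto simp: divide_le_eq le_divide_eq)
    ultimately show ?thesis using t(3) unfolding arc_def by blast
  qed
  have "min_subcover_card (top_of_set Omega) (iterated_join (top_of_set Omega) (product_map \<omega> g) \<U> n) \<le> L * N"
    if oc: "orbit_cover g {0..1} n (\<epsilon> / 3) N" for n N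
  proof -
    let ?join = "iterated_join (top_of_set Omega) (product_map \<omega> g) \<U> n"
    obtain \<J> where \<J>: "finite \<J>" "card \<J> \<le> N" "\<Union>\<J> = {0..1}"
      "\<forall>J\<in>\<J>. \<forall>x\<in>J. \<forall>y\<in>J. \<forall>i<n. \<bar>(g ^^ i) x - (g ^^ i) y\<bar> \<le> \<epsilon> / 3"
      using oc unfolding orbit_cover_def by (elim exE conjE)
    have g_it: "(g ^^ i) x \<in> {0..1}" if "x \<in> {0..1}" for i x by (rule funpow_mem[OF g that])
    have ex: "\<exists>V\<in>?join. arc b \<times> J \<subseteq> V" if J: "J \<in> \<J>" "J \<noteq> {}" for b J
    proof -
      obtain x0 where x0: "x0 \<in> J" using J(2) by blast
      have sub: "J \<subseteq> {0..1}" using J(1) \<J>(3) by blast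
      \<comment> \<open>\<open>frac\<close> puts the centre of the ball into the unit square, where
        the Lebesgue number applies; the displaced point \<open>t i + d\<close> may lie beyond
        1.\<close>
      define t where "t i = frac (real b / real L + real i * \<omega>)" for i
      have mem: "(t i, (g ^^ i) x0) \<in> {0..1} \<times> {0..1}" for i
        using g_it[of x0 i] x0 sub frac_ge_0 less_imp_le[OF frac_lt_1] by (auto simp: t_def)
      have "\<forall>i. \<exists>U. U \<in> \<U> \<and> (\<forall>w\<in>ball (t i, (g ^^ i) x0) \<epsilon>. lift w \<in> Omega \<longrightarrow> lift w \<in> U)"
        using leb[OF mem] unfolding Bex_def by (intro allI)
      then obtain s where s: "\<forall>i. s i \<in> \<U> \<and> (\<forall>w\<in>ball (t i, (g ^^ i) x0) \<epsilon>. lift w \<in> Omega \<longrightarrow> lift w \<in> s i)"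
        by (rule choice[THEN exE])
      define V where "V = {z \<in> Omega. \<forall>i<n. (product_map \<omega> g ^^ i) z \<in> s i}"
      have "V \<in> ?join" unfolding iterated_join_def V_def using s by auto
      moreover have "(\<theta>, x) \<in> V" if "\<theta> \<in> arc b" "x \<in> J" for \<theta> x
      proof -
        have x: "x \<in> {0..1}" using sub that(2) by blast
        obtain u where u: "\<theta> = abs_circle u" "u \<in> {real b / real L..real (Suc b) / real L}"
          using \<open>\<theta> \<in> arc b\<close> by (auto simp: arc_def)
        define d where "d = u - real b / real L"
        have "real (Suc b) / real L = real b / real L + 1 / real L" by (simp add: add_divide_distrib)
        then have d: "0 \<le> d" "d \<le> \<epsilon> / 3" using u(2) L\<epsilon> by (auto simp: d_def)
        have "(product_map \<omega> g ^^ i) (\<theta>, x) \<in> s i" if i: "i < n" for i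
        proof -
          have "rotation (real i * \<omega>) \<theta> = abs_circle (t i + d)"
            unfolding u(1) rotation_abs_circle abs_circle_eq_iff t_def frac_def d_def by simp
          then have eq: "(product_map \<omega> g ^^ i) (\<theta>, x) = lift (t i + d, (g ^^ i) x)"
            by (simp add: funpow_product_map lift_def)
          have "dist (t i, (g ^^ i) x0) (t i + d, (g ^^ i) x) \<le> \<bar>d\<bar> + \<bar>(g ^^ i) x0 - (g ^^ i) x\<bar>"
            unfolding dist_Pair_Pair dist_real_def using sqrt_sum_squares_le_sum_abs[of d] by simp
          also have "\<dots> < \<epsilon>" using d \<J>(4)[rule_format, OF J(1) x0 \<open>x \<in> J\<close> i] \<epsilon> by linarith
          finally have "(t i + d, (g ^^ i) x) \<in> ball (t i, (g ^^ i) x0) \<epsilon>" by simp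
          moreover have "lift (t i + d, (g ^^ i) x) \<in> Omega" using g_it[OF x] by (simp add: lift_def Omega_def)
          ultimately show ?thesis unfolding eq using s by blast
        qed
        then show ?thesis using x by (simp add: V_def Omega_def)
      qed
      ultimately show ?thesis by (intro bexI[of _ V]) auto
    qed
    define I where "I = {..<L} \<times> {J \<in> \<J>. J \<noteq> {}}"
    have fin: "finite I" using \<J>(1) by (simp add: I_def)
    have "\<forall>p\<in>I. \<exists>V. V \<in> ?join \<and> arc (fst p) \<times> snd p \<subseteq> V" using ex by (auto simp: I_def)
    then obtain V where V: "\<forall>p\<in>I. V p \<in> ?join \<and> arc (fst p) \<times> snd p \<subseteq> V p"
      by (rule bchoice[THEN exE])
    have join_sub: "W \<subseteq> Omega" if "W \<in> ?join" for W using that by (auto simp: iterated_join_def)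
    have "z \<in> \<Union>(V ` I)" if z: "z \<in> Omega" for z
    proof -
      obtain \<theta> x where zx: "z = (\<theta>, x)" "x \<in> {0..1}" using z by (auto simp: Omega_def)
      obtain b where b: "b < L" "\<theta> \<in> arc b" using arcs by blast
      obtain J where J: "J \<in> \<J>" "x \<in> J" using zx(2) \<J>(3) by blast
      then have "(b, J) \<in> I" using b(1) by (auto simp: I_def)
      moreover from this have "z \<in> V (b, J)" using V b(2) J(2) zx(1) by fastforce
      ultimately show ?thesis by blast
    qed
    then have "\<Union>(V ` I) = topspace (top_of_set Omega)" using V join_sub by fastforce
    then have "min_subcover_card (top_of_set Omega) ?join \<le> card (V ` I)"
      using V fin by (intro min_subcover_card_le) auto
    also have "\<dots> \<le> card I" by (rule card_image_le[OF fin])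
    also have "\<dots> \<le> L * card \<J>"
      unfolding I_def card_cartesian_product using \<J>(1) by (auto intro!: mult_le_mono2 card_mono)
    also have "\<dots> \<le> L * N" using \<J>(2) by simp
    finally show ?thesis .
  qed
  moreover have "\<epsilon> / 3 > 0" "L \<ge> 1" using \<epsilon> L0 by auto
  ultimately show ?thesis by blast
qed

lemma product_map_entropy_le:
  assumes g: "g ` {0..1} \<subseteq> {0..1}" and growth: "growth_rate_le g r" and r: "r \<ge> 1"
  shows "topological_entropy (top_of_set Omega) (product_map \<omega> g) \<le> ereal (ln r)"
  unfolding topological_entropy_def
proof (rule SUP_least)
  fix \<U> :: "(circle \<times> real) set set" assume "\<U> \<in> Collect (open_cover (top_of_set Omega))"
  then have cover: "open_cover (top_of_set Omega) \<U>" by simp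
  define m where "m n = min_subcover_card (top_of_set Omega)
    (iterated_join (top_of_set Omega) (product_map \<omega> g) \<U> n)" for n
  obtain \<epsilon> L where \<epsilon>: "\<epsilon> > 0" and L: "L \<ge> 1"
    and m_le: "\<And>n N. orbit_cover g {0..1} n \<epsilon> N \<Longrightarrow> m n \<le> L * N"
    using subcover_card_product_map_le[OF g cover, of \<omega>] unfolding m_def by blast
  obtain C a where C: "C \<ge> 1"
    and N: "\<And>n. \<exists>N. orbit_cover g {0..1} n \<epsilon> N \<and> real N \<le> C * (real n + 1) ^ a * r ^ n"
    using growth \<epsilon> unfolding growth_rate_le_def by blast
  have bound: "ln (real (m n)) / real n \<le> (ln (real L * C) + real a * ln (real n + 1) + real n * ln r) / real n" for n
  proof -
    obtain N where N: "orbit_cover g {0..1} n \<epsilon> N" "real N \<le> C * (real n + 1) ^ a * r ^ n"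
      using N by blast
    have "real (m n) \<le> real L * real N" using m_le[OF N(1)] by (metis of_nat_le_iff of_nat_mult)
    also have "\<dots> \<le> real L * (C * (real n + 1) ^ a * r ^ n)" using N(2) by (rule mult_left_mono) simp
    finally have le: "real (m n) \<le> (real L * C) * (real n + 1) ^ a * r ^ n" by (simp add: mult_ac)
    \<comment> \<open>Also covers a count of 0, where \<open>ln\<close> has the default value
      0.\<close>
    have "(real L * C) * (real n + 1) ^ a * r ^ n \<ge> 1"
      using L C r by (intro mult_ge1_I one_le_power) auto
    then have "ln (real (m n)) \<le> ln ((real L * C) * (real n + 1) ^ a * r ^ n)"
      using le by (cases "m n = 0") (auto intro!: ln_ge_zero)
    also have "\<dots> = ln (real L * C) + real a * ln (real n + 1) + real n * ln r"
      using L C r by (simp add: ln_mult ln_realpow)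
    finally show ?thesis by (rule divide_right_mono) simp
  qed
  have lim: "(\<lambda>n. (ln (real L * C) + real a * ln (real n + 1) + real n * ln r) / real n) \<longlonglongrightarrow> ln r"
    by real_asymp
  have "cover_entropy (top_of_set Omega) (product_map \<omega> g) \<U> \<le>
      limsup (\<lambda>n. ereal ((ln (real L * C) + real a * ln (real n + 1) + real n * ln r) / real n))"
    unfolding cover_entropy_def m_def[symmetric] using bound by (intro Limsup_mono) auto
  also have "\<dots> = ereal (ln r)"
    using lim by (intro lim_imp_Limsup) (auto simp: lim_ereal)
  finally show "cover_entropy (top_of_set Omega) (product_map \<omega> g) \<U> \<le> ereal (ln r)" .
qed

section \<open>Interval maps of prescribed period and entropy\<close>

lemma orbit_cover_Un:
  assumes "orbit_cover g S n \<epsilon> N" "orbit_cover g S' n \<epsilon> N'"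
  shows "orbit_cover g (S \<union> S') n \<epsilon> (N + N')"
proof -
  obtain \<J> where \<J>: "finite \<J>" "card \<J> \<le> N" "\<Union>\<J> = S"
    "\<forall>J\<in>\<J>. \<forall>x\<in>J. \<forall>y\<in>J. \<forall>i<n. \<bar>(g ^^ i) x - (g ^^ i) y\<bar> \<le> \<epsilon>"
    using assms(1) unfolding orbit_cover_def by (elim exE conjE)
  obtain \<J>' where \<J>': "finite \<J>'" "card \<J>' \<le> N'" "\<Union>\<J>' = S'"
    "\<forall>J\<in>\<J>'. \<forall>x\<in>J. \<forall>y\<in>J. \<forall>i<n. \<bar>(g ^^ i) x - (g ^^ i) y\<bar> \<le> \<epsilon>"
    using assms(2) unfolding orbit_cover_def by (elim exE conjE)
  have "card (\<J> \<union> \<J>') \<le> N + N'" using card_Un_le[of \<J> \<J>'] \<J>(2) \<J>'(2) by linarith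
  then show ?thesis unfolding orbit_cover_def
    by (intro exI[of _ "\<J> \<union> \<J>'"]) (use \<J>(1,3,4) \<J>'(1,3,4) in auto)
qed

lemma orbit_cover_mono:
  assumes "orbit_cover g S n \<epsilon> N" "m \<le> n" "N \<le> M" shows "orbit_cover g S m \<epsilon> M"
proof -
  obtain \<J> where \<J>: "finite \<J>" "card \<J> \<le> N" "\<Union>\<J> = S"
    "\<forall>J\<in>\<J>. \<forall>x\<in>J. \<forall>y\<in>J. \<forall>i<n. \<bar>(g ^^ i) x - (g ^^ i) y\<bar> \<le> \<epsilon>"
    using assms(1) unfolding orbit_cover_def by (elim exE conjE)
  then show ?thesis unfolding orbit_cover_def
    by (intro exI[of _ \<J>]) (use assms(2,3) in auto)
qed

lemma orbit_cover_image:
  assumes "orbit_cover g S n \<epsilon> N"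
    and "\<And>x y i. x \<in> S \<Longrightarrow> y \<in> S \<Longrightarrow> i < n' \<Longrightarrow> (\<And>j. j < n \<Longrightarrow> \<bar>(g ^^ j) x - (g ^^ j) y\<bar> \<le> \<epsilon>) \<Longrightarrow>
      \<bar>(g' ^^ i) (h x) - (g' ^^ i) (h y)\<bar> \<le> \<epsilon>"
  shows "orbit_cover g' (h ` S) n' \<epsilon> N"
proof -
  obtain \<J> where \<J>: "finite \<J>" "card \<J> \<le> N" "\<Union>\<J> = S"
    "\<forall>J\<in>\<J>. \<forall>x\<in>J. \<forall>y\<in>J. \<forall>i<n. \<bar>(g ^^ i) x - (g ^^ i) y\<bar> \<le> \<epsilon>"
    using assms(1) unfolding orbit_cover_def by (elim exE conjE)
  have "card ((`) h ` \<J>) \<le> N" using card_image_le[OF \<J>(1), of "(`) h"] \<J>(2) by linarith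
  moreover have "\<bar>(g' ^^ i) u - (g' ^^ i) v\<bar> \<le> \<epsilon>"
    if K: "K \<in> (`) h ` \<J>" "u \<in> K" "v \<in> K" and i: "i < n'" for K u v i
  proof -
    obtain J x y where J: "J \<in> \<J>" "x \<in> J" "y \<in> J" "u = h x" "v = h y" using K by auto
    then have "x \<in> S" "y \<in> S" using \<J>(3) by auto
    then show ?thesis unfolding J(4,5)
      by (rule assms(2)[OF _ _ i]) (use \<J>(4) J(1-3) in blast)
  qed
  moreover have "\<Union>((`) h ` \<J>) = h ` S" using \<J>(3) by auto
  ultimately show ?thesis unfolding orbit_cover_def
    by (intro exI[of _ "(`) h ` \<J>"] conjI ballI allI impI) (use \<J>(1) in auto)
qed

lemma funpow_lipschitz:
  assumes "\<And>x y. x \<in> S \<Longrightarrow> y \<in> S \<Longrightarrow> \<bar>g x - g y\<bar> \<le> r * \<bar>x - y\<bar>" "g ` S \<subseteq> S" "r \<ge> 0"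
    and "x \<in> S" "y \<in> S"
  shows "\<bar>(g ^^ i) x - (g ^^ i) y\<bar> \<le> r ^ i * \<bar>x - y :: real\<bar>"
proof (induction i)
  case (Suc i)
  have "\<bar>(g ^^ Suc i) x - (g ^^ Suc i) y\<bar> \<le> r * \<bar>(g ^^ i) x - (g ^^ i) y\<bar>"
    using assms(1)[OF funpow_mem[OF assms(2,4)] funpow_mem[OF assms(2,5)]] by simp
  also have "\<dots> \<le> r * (r ^ i * \<bar>x - y\<bar>)" using Suc assms(3) by (rule mult_left_mono)
  finally show ?case by (simp add: mult.assoc)
qed simp

lemma orbit_cover_lipschitz:
  assumes lip: "\<And>x y. x \<in> {0..1} \<Longrightarrow> y \<in> {0..1} \<Longrightarrow> \<bar>g x - g y\<bar> \<le> r * \<bar>x - y\<bar>"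
    and g: "g ` {0..1} \<subseteq> {0..1}" and r: "r \<ge> 1" and \<epsilon>: "\<epsilon> > 0" and N: "r ^ n / \<epsilon> < real N"
  shows "orbit_cover g {0..1} n \<epsilon> N"
proof -
  have N0: "real N > 0" using N \<epsilon> r by (smt (verit) divide_nonneg_pos zero_le_power)
  define J where "J b = {real b / real N..real (Suc b) / real N} \<inter> {0..1}" for b
  have small: "\<bar>(g ^^ i) x - (g ^^ i) y\<bar> \<le> \<epsilon>" if "x \<in> J b" "y \<in> J b" "i < n" for b x y i
  proof -
    have "real (Suc b) / real N = real b / real N + 1 / real N" by (simp add: add_divide_distrib)
    moreover have "x \<in> {real b / real N..real (Suc b) / real N}" "y \<in> {real b / real N..real (Suc b) / real N}"
      using that unfolding J_def by blast+
    ultimately have "\<bar>x - y\<bar> \<le> 1 / real N" unfolding atLeastAtMost_iff by linarith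
    moreover have "x \<in> {0..1}" "y \<in> {0..1}" using that unfolding J_def by blast+
    ultimately have xy: "\<bar>x - y\<bar> \<le> 1 / real N" "x \<in> {0..1}" "y \<in> {0..1}" .
    have "\<bar>(g ^^ i) x - (g ^^ i) y\<bar> \<le> r ^ i * \<bar>x - y\<bar>"
      using r by (intro funpow_lipschitz[OF lip g _ xy(2,3)]) auto
    also have "\<dots> \<le> r ^ n * (1 / real N)"
      using xy(1) r that(3) by (intro mult_mono power_increasing) auto
    also have "\<dots> \<le> \<epsilon>" using N N0 \<epsilon> by (simp add: field_simps)
    finally show ?thesis .
  qed
  have "x \<in> \<Union>(J ` {..<N})" if x: "x \<in> {0..1}" for x
  \<comment> \<open>At the right end point the floor would give the index \<open>N\<close>, which is
    out of range.\<close>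
  proof (cases "x = 1")
    case True
    then show ?thesis using N0 by (intro UN_I[of "N - 1"]) (auto simp: J_def of_nat_diff divide_le_eq)
  next
    case False
    define b where "b = nat \<lfloor>x * real N\<rfloor>"
    have "real b = of_int \<lfloor>x * real N\<rfloor>" using x N0 by (simp add: b_def)
    then have b: "real b \<le> x * real N" "x * real N < real (Suc b)"
      using floor_correct[of "x * real N"] unfolding of_nat_Suc by linarith+
    have "x * real N < real N" using x False N0 by simp
    then have "b < N" using b(1) by linarith
    moreover have "x \<in> J b" using b N0 x by (auto simp: J_def divide_le_eq le_divide_eq)
    ultimately show ?thesis by blast
  qed
  moreover have "J b \<subseteq> {0..1}" for b unfolding J_def by blast
  ultimately have "\<Union>(J ` {..<N}) = {0..1}" by blast
  moreover have "card (J ` {..<N}) \<le> N" using card_image_le[of "{..<N}" J] by simp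
  ultimately show ?thesis unfolding orbit_cover_def
    by (intro exI[of _ "J ` {..<N}"]) (use small in auto)
qed

lemma orbit_cover_one_step:
  assumes "\<epsilon> > 0" shows "\<exists>N. orbit_cover h {1/3..2/3} 1 \<epsilon> N"
proof -
  obtain N :: nat where N: "1 ^ 1 / \<epsilon> < real N" using reals_Archimedean2 by blast
  have "orbit_cover id {0..1} 1 \<epsilon> N" by (rule orbit_cover_lipschitz[OF _ _ _ assms N]) auto
  then obtain \<J> where \<J>: "finite \<J>" "card \<J> \<le> N" "\<Union>\<J> = {0..1}"
    "\<forall>J\<in>\<J>. \<forall>x\<in>J. \<forall>y\<in>J. \<forall>i<1. \<bar>(id ^^ i) x - (id ^^ i) y\<bar> \<le> \<epsilon>"
    unfolding orbit_cover_def by (elim exE conjE)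
  let ?K = "(\<lambda>J. J \<inter> {1/3..2/3}) ` \<J>"
  have "\<Union>?K = {0..1} \<inter> {1/3..2/3}" unfolding \<J>(3)[symmetric] by auto
  then have "\<Union>?K = {1/3..2/3}" by auto
  moreover have "card ?K \<le> N" using card_image_le[OF \<J>(1)] \<J>(2) order_trans by blast
  ultimately show ?thesis unfolding orbit_cover_def
    by (intro exI[of _ N] exI[of _ ?K]) (use \<J>(1,4) in auto)
qed

lemma growth_rate_le_lipschitz:
  assumes lip: "\<And>x y. x \<in> {0..1} \<Longrightarrow> y \<in> {0..1} \<Longrightarrow> \<bar>g x - g y\<bar> \<le> r * \<bar>x - y\<bar>"
    and g: "g ` {0..1} \<subseteq> {0..1}" and r: "r \<ge> 1"
  shows "growth_rate_le g r"
  unfolding growth_rate_le_def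
proof (intro allI impI)
  fix \<epsilon> :: real assume \<epsilon>: "\<epsilon> > 0"
  have "\<exists>N. orbit_cover g {0..1} n \<epsilon> N \<and> real N \<le> (1 / \<epsilon> + 1) * (real n + 1) ^ 0 * r ^ n" for n
  proof -
    define N where "N = nat \<lfloor>r ^ n / \<epsilon>\<rfloor> + 1"
    have "r ^ n / \<epsilon> \<ge> 0" using r \<epsilon> by simp
    then have "real N = of_int \<lfloor>r ^ n / \<epsilon>\<rfloor> + 1" by (simp add: N_def)
    then have N: "r ^ n / \<epsilon> < real N" "real N \<le> r ^ n / \<epsilon> + 1"
      using floor_correct[of "r ^ n / \<epsilon>"] by linarith+
    have "real N \<le> r ^ n / \<epsilon> + r ^ n" using N(2) one_le_power[OF r, of n] by linarith
    then have "real N \<le> (1 / \<epsilon> + 1) * (real n + 1) ^ 0 * r ^ n" by (simp add: algebra_simps)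
    then show ?thesis using orbit_cover_lipschitz[OF lip g r \<epsilon> N(1)] by blast
  qed
  moreover have "1 / \<epsilon> + 1 \<ge> 1" using \<epsilon> by simp
  ultimately show "\<exists>C\<ge>1. \<exists>a. \<forall>n. \<exists>N. orbit_cover g {0..1} n \<epsilon> N \<and> real N \<le> C * (real n + 1) ^ a * r ^ n"
    by blast
qed

text \<open>The doubling of \<open>g\<close>: the outer thirds of the interval are interchanged, and the second iterate
  is a copy of \<open>g\<close> on each of them. The middle third is expanded, so that it contributes only
  linearly to the number of orbits.\<close>

definition doubling :: "(real \<Rightarrow> real) \<Rightarrow> real \<Rightarrow> real"
  where "doubling g x = (if x \<le> 1/3 then 2/3 + g (3 * x) / 3
    else if x \<ge> 2/3 then x - 2/3 else (2/3 + g 1 / 3) * (2 - 3 * x))"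

section \<open>Orbits of a doubled map\<close>

locale interval_map =
  fixes g :: "real \<Rightarrow> real"
  assumes cont: "continuous_on {0..1} g" and maps: "g ` {0..1} \<subseteq> {0..1}"
begin

lemma g_unit: "x \<in> {0..1} \<Longrightarrow> g x \<in> {0..1}"
  using maps by blast

lemma doubling_middle: "x \<in> {1/3..2/3} \<Longrightarrow> doubling g x = (2/3 + g 1 / 3) * (2 - 3 * x)"
proof -
  assume x: "x \<in> {1/3..2/3}"
  consider "x = 1/3" | "x = 2/3" | "1/3 < x" "x < 2/3" using x by fastforce
  then show ?thesis
  proof cases
    case 1
    show ?thesis unfolding 1 by (simp add: doubling_def)
  next
    case 2
    show ?thesis unfolding 2 by (simp add: doubling_def)
  qed (simp add: doubling_def)
qed

lemma doubling_maps: "doubling g ` {0..1} \<subseteq> {0..1}"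
proof
  fix y assume "y \<in> doubling g ` {0..1}"
  then obtain x where x: "x \<in> {0..1}" "y = doubling g x" by auto
  consider "x \<le> 1/3" | "x \<ge> 2/3" | "x \<in> {1/3..2/3}" by fastforce
  then show "y \<in> {0..1}"
  proof cases
    case 1
    then show ?thesis using g_unit[of "3 * x"] x by (auto simp: doubling_def)
  next
    case 2
    then show ?thesis using x by (auto simp: doubling_def)
  next
    case 3
    have "0 \<le> g 1" "g 1 \<le> 1" using g_unit[of 1] by auto
    then have "0 \<le> 2/3 + g 1 / 3" "2/3 + g 1 / 3 \<le> 1" "0 \<le> 2 - 3 * x" "2 - 3 * x \<le> 1"
      using 3 by auto
    then have "0 \<le> (2/3 + g 1 / 3) * (2 - 3 * x)" "(2/3 + g 1 / 3) * (2 - 3 * x) \<le> 1 * 1"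
      using mult_nonneg_nonneg[of "2/3 + g 1 / 3" "2 - 3 * x"] mult_mono[of "2/3 + g 1 / 3" 1 "2 - 3 * x" 1]
      by linarith+
    then show ?thesis using x(2) doubling_middle[OF 3] by simp
  qed
qed

lemma doubling_continuous: "continuous_on {0..1} (doubling g)"
proof -
  have "continuous_on {0..1/3} (doubling g)"
  proof (rule continuous_on_eq)
    show "continuous_on {0..1/3} (\<lambda>x. 2/3 + g (3 * x) / 3)"
      by (intro continuous_intros continuous_on_compose2[OF cont]) auto
  qed (auto simp: doubling_def)
  moreover have "continuous_on {1/3..2/3} (doubling g)"
  proof (rule continuous_on_eq)
    show "continuous_on {1/3..2/3} (\<lambda>x. (2/3 + g 1 / 3) * (2 - 3 * x))"
      by (intro continuous_intros)
  qed (simp add: doubling_middle)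
  moreover have "continuous_on {2/3..1} (doubling g)"
  proof (rule continuous_on_eq)
    show "continuous_on {2/3..1} (\<lambda>x::real. x - 2/3)" by (intro continuous_intros)
  qed (auto simp: doubling_def)
  ultimately have "continuous_on ({0..1/3} \<union> ({1/3..2/3} \<union> {2/3..1})) (doubling g)"
    by (intro continuous_on_closed_Un closed_Un closed_atLeastAtMost)
  moreover have "{0..1/3} \<union> ({1/3..2/3} \<union> {2/3..1}) = {0..1::real}" by auto
  ultimately show ?thesis by simp
qed

lemma funpow_doubling:
  assumes x: "x \<in> {0..1}"
  shows "(doubling g ^^ i) (x / 3) =
    (if even i then (g ^^ (i div 2)) x / 3 else 2/3 + (g ^^ ((i + 1) div 2)) x / 3)"
proof (induction i)
  case (Suc i)
  have unit: "(g ^^ k) x \<in> {0..1}" for k by (rule funpow_mem[OF maps x])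
  show ?case
  proof (cases "even i")
    case True
    then have "(doubling g ^^ i) (x / 3) = (g ^^ (i div 2)) x / 3" using Suc by (simp only: if_True)
    then have "(doubling g ^^ Suc i) (x / 3) = doubling g ((g ^^ (i div 2)) x / 3)"
      by (simp only: funpow.simps(2) o_apply)
    also have "\<dots> = 2/3 + (g ^^ (Suc (i div 2))) x / 3" using unit[of "i div 2"] by (simp add: doubling_def)
    finally show ?thesis using True by simp
  next
    case False
    then have "(doubling g ^^ i) (x / 3) = 2/3 + (g ^^ ((i + 1) div 2)) x / 3"
      using Suc by (simp only: if_False)
    then have "(doubling g ^^ Suc i) (x / 3) = doubling g (2/3 + (g ^^ ((i + 1) div 2)) x / 3)"
      by (simp only: funpow.simps(2) o_apply)
    also have "\<dots> = (g ^^ ((i + 1) div 2)) x / 3" using unit[of "(i + 1) div 2"] by (simp add: doubling_def)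
    finally show ?thesis using False by simp
  qed
qed simp

text \<open>The doubled map runs through the orbit of \<open>g\<close> at half speed, scaled by 1/3:
  at time \<open>i\<close> the iterate of index \<open>(i + 1) div 2\<close> is seen, which is at
  most \<open>n div 2\<close> for \<open>i < n\<close>.\<close>

lemma orbit_cover_left:
  assumes "orbit_cover g {0..1} (n div 2 + 1) \<epsilon> N"
  shows "orbit_cover (doubling g) {0..1/3} n \<epsilon> N"
proof -
  have "orbit_cover (doubling g) ((\<lambda>x. x / 3) ` {0..1}) n \<epsilon> N"
  proof (rule orbit_cover_image[OF assms])
    fix x y i assume xy: "x \<in> {0..1}" "y \<in> {0..1}" and i: "i < n"
      and small: "\<And>j. j < n div 2 + 1 \<Longrightarrow> \<bar>(g ^^ j) x - (g ^^ j) y\<bar> \<le> \<epsilon>"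
    have "(i + 1) div 2 < n div 2 + 1" using i by linarith
    note small = small[OF this]
    have "(doubling g ^^ i) (x / 3) - (doubling g ^^ i) (y / 3) =
        ((g ^^ ((i + 1) div 2)) x - (g ^^ ((i + 1) div 2)) y) / 3"
      unfolding funpow_doubling[OF xy(1)] funpow_doubling[OF xy(2)]
      by (cases "even i") (simp_all add: diff_divide_distrib)
    moreover have "\<bar>d / 3\<bar> \<le> \<bar>d\<bar>" for d :: real by simp
    ultimately show "\<bar>(doubling g ^^ i) (x / 3) - (doubling g ^^ i) (y / 3)\<bar> \<le> \<epsilon>"
      using small order_trans by metis
  qed
  moreover have "(\<lambda>x. x / 3) ` {0..1} = {0..1/3::real}"
    using image_divide_atLeastAtMost[of 3 0 "1::real"] by simp
  ultimately show ?thesis by simp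
qed

lemma orbit_cover_right:
  assumes "orbit_cover (doubling g) {0..1/3} n \<epsilon> N"
  shows "orbit_cover (doubling g) {2/3..1} n \<epsilon> N"
proof -
  have "orbit_cover (doubling g) ((\<lambda>x. x + 2/3) ` {0..1/3}) n \<epsilon> N"
  proof (rule orbit_cover_image[OF assms])
    fix x y i assume xy: "x \<in> {0..1/3}" "y \<in> {0..1/3}" and i: "i < n"
      and small: "\<And>j. j < n \<Longrightarrow> \<bar>(doubling g ^^ j) x - (doubling g ^^ j) y\<bar> \<le> \<epsilon>"
    show "\<bar>(doubling g ^^ i) (x + 2/3) - (doubling g ^^ i) (y + 2/3)\<bar> \<le> \<epsilon>"
    proof (cases i)
      case 0
      then show ?thesis using small[of 0] i by simp
    next
      case (Suc j)
      have "doubling g (x + 2/3) = x" "doubling g (y + 2/3) = y" using xy by (auto simp: doubling_def)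
      then show ?thesis using small[of j] i Suc by (simp add: funpow_swap1)
    qed
  qed
  moreover have "(\<lambda>x. x + 2/3) ` {0..1/3} = {2/3..1::real}" by simp
  ultimately show ?thesis by simp
qed

text \<open>The pieces are pulled back through one step. Time 0, which precedes the pulled back
  times, costs nothing because the map expands the middle third.\<close>

lemma orbit_cover_middle:
  assumes "orbit_cover (doubling g) {0..1} n \<epsilon> N" "n \<ge> 1"
  shows "orbit_cover (doubling g) {1/3..2/3} (n + 1) \<epsilon> N"
proof -
  let ?D = "doubling g" and ?M = "{1/3..2/3::real}"
  obtain \<J> where \<J>: "finite \<J>" "card \<J> \<le> N" "\<Union>\<J> = {0..1}"
    "\<forall>J\<in>\<J>. \<forall>x\<in>J. \<forall>y\<in>J. \<forall>i<n. \<bar>(?D ^^ i) x - (?D ^^ i) y\<bar> \<le> \<epsilon>"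
    using assms(1) unfolding orbit_cover_def by (elim exE conjE)
  define K where "K J = {x \<in> ?M. ?D x \<in> J}" for J
  have expand: "\<bar>x - y\<bar> \<le> \<bar>?D x - ?D y\<bar>" if "x \<in> ?M" "y \<in> ?M" for x y
  proof -
    have "0 \<le> g 1" using g_unit[of 1] by auto
    have "?D x - ?D y = (2 + g 1) * (y - x)"
      unfolding doubling_middle[OF that(1)] doubling_middle[OF that(2)] by (simp add: algebra_simps)
    then have "\<bar>?D x - ?D y\<bar> = (2 + g 1) * \<bar>x - y\<bar>" using \<open>0 \<le> g 1\<close> by (simp add: abs_mult)
    moreover have "1 * \<bar>x - y\<bar> \<le> (2 + g 1) * \<bar>x - y\<bar>" using \<open>0 \<le> g 1\<close> by (intro mult_right_mono) auto
    ultimately show ?thesis by simp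
  qed
  have small: "\<bar>(?D ^^ i) x - (?D ^^ i) y\<bar> \<le> \<epsilon>" if "J \<in> \<J>" "x \<in> K J" "y \<in> K J" "i < n + 1" for J x y i
  proof (cases i)
    case 0
    have "\<bar>(?D ^^ 0) (?D x) - (?D ^^ 0) (?D y)\<bar> \<le> \<epsilon>"
      using \<J>(4)[rule_format, of J "?D x" "?D y" 0] that assms(2) by (simp add: K_def)
    then show ?thesis using expand[of x y] that 0 by (simp add: K_def)
  next
    case (Suc j)
    then show ?thesis using \<J>(4)[rule_format, of J "?D x" "?D y" j] that by (simp add: K_def funpow_swap1)
  qed
  have "x \<in> \<Union>(K ` \<J>)" if "x \<in> ?M" for x
  proof -
    have "x \<in> {0..1}" using that by auto
    then have "?D x \<in> \<Union>\<J>" unfolding \<J>(3) using doubling_maps by blast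
    then show ?thesis using that by (auto simp: K_def)
  qed
  then have "\<Union>(K ` \<J>) = ?M" by (auto simp: K_def)
  moreover have "card (K ` \<J>) \<le> N" using card_image_le[OF \<J>(1), of K] \<J>(2) by linarith
  ultimately show ?thesis unfolding orbit_cover_def
    by (intro exI[of _ "K ` \<J>"]) (use small \<J>(1) in auto)
qed

text \<open>The union of the outer thirds is never left again, so each further time step adds to the
  count for the middle third only the \<open>2 * l n\<close> pieces of the outer thirds. Half speed
  in the outer thirds gives the square root, and the sum over the times raises the degree from
  \<open>a\<close> to \<open>a + 1\<close>.\<close>

lemma growth_rate_le_doubling:
  assumes growth: "growth_rate_le g r" and r: "r \<ge> 1"
  shows "growth_rate_le (doubling g) (sqrt r)"
  unfolding growth_rate_le_def
proof (intro allI impI)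
  fix \<epsilon> :: real assume \<epsilon>: "\<epsilon> > 0"
  obtain C a where C: "C \<ge> 1"
    and ex: "\<forall>n. \<exists>N. orbit_cover g {0..1} n \<epsilon> N \<and> real N \<le> C * (real n + 1) ^ a * r ^ n"
    using growth \<epsilon> unfolding growth_rate_le_def by blast
  from choice[OF ex] obtain N where
    N: "\<And>n. orbit_cover g {0..1} n \<epsilon> (N n)" "\<And>n. real (N n) \<le> C * (real n + 1) ^ a * r ^ n" by blast
  define l where "l n = N (n div 2 + 1)" for n
  have left: "orbit_cover (doubling g) {0..1/3} n \<epsilon> (l n)" for n
    unfolding l_def by (rule orbit_cover_left[OF N(1)])
  obtain M where M: "orbit_cover (doubling g) {1/3..2/3} 1 \<epsilon> M" using orbit_cover_one_step[OF \<epsilon>] by blast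
  have whole: "orbit_cover (doubling g) {0..1} n \<epsilon> (l n + (m + l n))"
    if "orbit_cover (doubling g) {1/3..2/3} n \<epsilon> m" for n m
  proof -
    have "{0..1/3} \<union> ({1/3..2/3} \<union> {2/3..1}) = {0..1::real}" by auto
    then show ?thesis
      using orbit_cover_Un[OF left orbit_cover_Un[OF that orbit_cover_right[OF left]]] by simp
  qed
  have middle: "orbit_cover (doubling g) {1/3..2/3} n \<epsilon> (M + 2 * (\<Sum>k<n. l k))" for n
  proof (induction n)
    case 0
    show ?case by (rule orbit_cover_mono[OF M]) auto
  next
    case (Suc n)
    show ?case
    proof (cases "n = 0")
      case True
      then show ?thesis using orbit_cover_mono[OF M, of 1 "M + 2 * l 0"] by simp
    next
      case False
      then have "n \<ge> 1" by simp
      from orbit_cover_middle[OF whole[OF Suc] this] show ?thesis by (simp add: algebra_simps)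
    qed
  qed
  define s where "s = sqrt r"
  have s: "s \<ge> 1" "s ^ 2 = r" using r by (auto simp: s_def)
  \<comment> \<open>The bound is uniform in \<open>k \<le> n\<close>, so that the sum costs just a
    factor \<open>n + 1\<close>. The constants \<open>2 ^ a\<close> and \<open>r\<close> absorb the
    additional iterate in \<open>n div 2 + 1\<close>.\<close>
  have l_le: "real (l k) \<le> C * 2 ^ a * r * (real n + 1) ^ a * s ^ n" if "k \<le> n" for k n
  proof -
    have "r ^ (k div 2) = s ^ (2 * (k div 2))" unfolding power_mult s(2) ..
    also have "\<dots> \<le> s ^ n" using s(1) that by (intro power_increasing) auto
    finally have pow: "r ^ (k div 2 + 1) \<le> r * s ^ n" using r by simp
    have "k div 2 \<le> n" using that by linarith
    then have "real (k div 2 + 1) + 1 \<le> 2 * (real n + 1)" by simp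
    then have "(real (k div 2 + 1) + 1) ^ a \<le> (2 * (real n + 1)) ^ a" by (intro power_mono) auto
    then have "(real (k div 2 + 1) + 1) ^ a * r ^ (k div 2 + 1) \<le> (2 * (real n + 1)) ^ a * (r * s ^ n)"
      using pow r by (intro mult_mono) auto
    then have "C * ((real (k div 2 + 1) + 1) ^ a * r ^ (k div 2 + 1)) \<le> C * ((2 * (real n + 1)) ^ a * (r * s ^ n))"
      using C by (intro mult_left_mono) auto
    moreover have "real (l k) \<le> C * ((real (k div 2 + 1) + 1) ^ a * r ^ (k div 2 + 1))"
      using N(2)[of "k div 2 + 1"] by (simp only: l_def mult.assoc)
    moreover have "C * ((2 * (real n + 1)) ^ a * (r * s ^ n)) = C * 2 ^ a * r * (real n + 1) ^ a * s ^ n"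
      by (simp only: power_mult_distrib mult_ac)
    ultimately show ?thesis by linarith
  qed
  define B where "B = C * 2 ^ a * r"
  have B: "B \<ge> 1" unfolding B_def using C r by (intro mult_ge1_I) auto
  have total: "orbit_cover (doubling g) {0..1} n \<epsilon> (l n + (M + 2 * (\<Sum>k<n. l k) + l n)) \<and>
      real (l n + (M + 2 * (\<Sum>k<n. l k) + l n)) \<le> (real M + 2 * B) * (real n + 1) ^ (a + 1) * s ^ n" for n
  proof
    have "(\<Sum>k<Suc n. real (l k)) \<le> (\<Sum>k<Suc n. B * (real n + 1) ^ a * s ^ n)"
      by (rule sum_mono) (use l_le in \<open>auto simp: B_def\<close>)
    also have "\<dots> = B * (real n + 1) ^ (a + 1) * s ^ n" by (simp add: algebra_simps)
    finally have 1: "(\<Sum>k<Suc n. real (l k)) \<le> B * (real n + 1) ^ (a + 1) * s ^ n" .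
    have "(real n + 1) ^ (a + 1) * s ^ n \<ge> 1" using s(1) by (intro mult_ge1_I one_le_power) auto
    then have "real M * 1 \<le> real M * ((real n + 1) ^ (a + 1) * s ^ n)" by (intro mult_left_mono) auto
    then have "real M + 2 * (\<Sum>k<Suc n. real (l k)) \<le>
        real M * ((real n + 1) ^ (a + 1) * s ^ n) + 2 * (B * (real n + 1) ^ (a + 1) * s ^ n)"
      using 1 by linarith
    also have "\<dots> = (real M + 2 * B) * (real n + 1) ^ (a + 1) * s ^ n" by (simp only: algebra_simps)
    finally show "real (l n + (M + 2 * (\<Sum>k<n. l k) + l n)) \<le> (real M + 2 * B) * (real n + 1) ^ (a + 1) * s ^ n"
      by simp
  qed (rule whole[OF middle])
  have "real M + 2 * B \<ge> 1" using B by simp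
  then show "\<exists>C\<ge>1. \<exists>a. \<forall>n. \<exists>N. orbit_cover (doubling g) {0..1} n \<epsilon> N \<and>
      real N \<le> C * (real n + 1) ^ a * sqrt r ^ n"
    using total unfolding s_def by blast
qed

end

section \<open>Interval maps with prescribed least period\<close>

definition has_period :: "(real \<Rightarrow> real) \<Rightarrow> nat \<Rightarrow> bool"
  where "has_period g m \<longleftrightarrow> (\<exists>x\<in>{0..1}. (g ^^ m) x = x \<and> (\<forall>k. 0 < k \<longrightarrow> k < m \<longrightarrow> (g ^^ k) x \<noteq> x))"

text \<open>At odd times the orbit is in the right third, away from \<open>x / 3\<close>; at even
  times it is the scaled orbit of \<open>g\<close>.\<close>

lemma (in interval_map) has_period_doubling:
  assumes "has_period g m" shows "has_period (doubling g) (2 * m)"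
proof -
  obtain x where x: "x \<in> {0..1}" "(g ^^ m) x = x" "\<And>k. 0 < k \<Longrightarrow> k < m \<Longrightarrow> (g ^^ k) x \<noteq> x"
    using assms unfolding has_period_def by blast
  have "(doubling g ^^ k) (x / 3) \<noteq> x / 3" if k: "0 < k" "k < 2 * m" for k
  proof (cases "even k")
    case True
    then have "0 < k div 2" "k div 2 < m" using k by auto
    then show ?thesis using x(3) True by (simp add: funpow_doubling[OF x(1)])
  next
    case False
    have "(g ^^ ((k + 1) div 2)) x \<in> {0..1}" by (rule funpow_mem[OF maps x(1)])
    then show ?thesis using False x(1) by (simp add: funpow_doubling[OF x(1)])
  qed
  moreover have "(doubling g ^^ (2 * m)) (x / 3) = x / 3" using x(2) by (simp add: funpow_doubling[OF x(1)])
  ultimately show ?thesis unfolding has_period_def using x(1) by (intro bexI[of _ "x / 3"]) auto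
qed

text \<open>Normalized so that the turning value is 1 for every slope; slopes up to 2 keep the
  interval invariant.\<close>

definition tent :: "real \<Rightarrow> real \<Rightarrow> real"
  where "tent s x = 1 - s * \<bar>x - 1/2\<bar>"

lemma interval_map_tent:
  assumes "0 \<le> s" "s \<le> 2" shows "interval_map (tent s)"
proof
  show "continuous_on {0..1} (tent s)" unfolding tent_def by (intro continuous_intros)
  show "tent s ` {0..1} \<subseteq> {0..1}"
  proof
    fix y assume "y \<in> tent s ` {0..1}"
    then obtain x where x: "x \<in> {0..1}" "y = tent s x" by auto
    have "\<bar>x - 1/2\<bar> \<le> 1/2" using x(1)[unfolded atLeastAtMost_iff] by linarith
    then have "s * \<bar>x - 1/2\<bar> \<le> 2 * (1/2)" using assms by (intro mult_mono) auto
    then show "y \<in> {0..1}" using x(2) assms by (simp add: tent_def)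
  qed
qed

lemma growth_rate_le_tent: "1 \<le> s \<Longrightarrow> s \<le> 2 \<Longrightarrow> growth_rate_le (tent s) s"
proof (rule growth_rate_le_lipschitz)
  assume s: "1 \<le> s" "s \<le> 2"
  show "\<bar>tent s x - tent s y\<bar> \<le> s * \<bar>x - y\<bar>" for x y
  proof -
    have "tent s x - tent s y = s * (\<bar>y - 1/2\<bar> - \<bar>x - 1/2\<bar>)" by (simp add: tent_def algebra_simps)
    then have "\<bar>tent s x - tent s y\<bar> = s * \<bar>\<bar>y - 1/2\<bar> - \<bar>x - 1/2\<bar>\<bar>" using s by (simp add: abs_mult)
    also have "\<dots> \<le> s * \<bar>x - y\<bar>" using s by (intro mult_left_mono) auto
    finally show ?thesis .
  qed
  show "tent s ` {0..1} \<subseteq> {0..1}" using interval_map.maps[OF interval_map_tent] s by simp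
qed

text \<open>The orbit of the turning point \<open>1/2\<close>, started at its third iterate, spirals away from the fixed
  point \<open>1/2 + p\<close> until it returns to the turning point after \<open>q - 3\<close> steps.\<close>

lemma has_period_tent:
  assumes q: "odd q" "q \<ge> 3" shows "has_period (tent (lambda q)) q"
proof -
  define s where "s = lambda q"
  have s: "s > 1" unfolding s_def by (rule lambda_gt_1[OF q(2)])
  \<comment> \<open>\<open>1/2 + p\<close> is the fixed point on the decreasing branch, where
    \<open>1 - s * p = 1/2 + p\<close>.\<close>
  define p where "p = 1 / (2 * (1 + s))"
  have p: "p > 0" "p * (1 + s) = 1/2" using s by (auto simp: p_def field_simps)
  define d where "d = p / s ^ (q - 3)"
  have d: "d > 0" "d * s ^ (q - 3) = p" using p s by (auto simp: d_def)
  have right: "tent s (1/2 + p + y) = 1/2 + p - s * y" if "p + y \<ge> 0" for y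
    using that p(2) by (simp add: tent_def algebra_simps)
  have left: "tent s (1/2 + p + y) = 1 + s * (p + y)" if "p + y \<le> 0" for y
    using that by (simp add: tent_def algebra_simps)
  have spiral: "(tent s ^^ j) (1/2 + p - d) = 1/2 + p - (- s) ^ j * d" if "j \<le> q - 1" for j
    using that
  proof (induction j)
    case (Suc j)
    \<comment> \<open>The orbit stays on the decreasing branch. Only even \<open>j\<close> are
      critical, and since \<open>q - 2\<close> is odd these satisfy \<open>j \<le> q - 3\<close>,
      with equality exactly at the turning point.\<close>
    have "p - (- s) ^ j * d \<ge> 0"
    proof (cases "even j")
      case True
      have "j \<noteq> q - 2" using q True by auto
      then have "s ^ j * d \<le> s ^ (q - 3) * d"
        using Suc.prems s d(1) by (intro mult_right_mono power_increasing) auto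
      then show ?thesis using True d(2) by (simp add: mult.commute)
    next
      case False
      then show ?thesis using p(1) d(1) s by (simp add: add_nonneg_nonneg)
    qed
    then show ?case using Suc right[of "- ((- s) ^ j * d)"] by simp
  qed simp
  have ev: "even (q - 1)" using q by simp
  have "Suc (q - 1) = q" using q by simp
  then have "(tent s ^^ q) (1/2 + p - d) = tent s (1/2 + p - (- s) ^ (q - 1) * d)"
    using spiral[of "q - 1"] by (metis funpow.simps(2) o_apply order_refl)
  also have e: "(- s) ^ (q - 1) * d = s\<^sup>2 * p"
  proof -
    have "q - 1 = (q - 3) + 2" using q by simp
    then have "s ^ (q - 1) = s ^ (q - 3) * s\<^sup>2" by (metis power_add)
    then have "(- s) ^ (q - 1) * d = s\<^sup>2 * (d * s ^ (q - 3))" using ev by (simp add: mult_ac)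
    then show ?thesis by (simp only: d(2))
  qed
  also have "tent s (1/2 + p - s\<^sup>2 * p) = 1 + s * (p - s\<^sup>2 * p)"
  proof -
    have "p * 1 \<le> p * s\<^sup>2" using p(1) s by (intro mult_left_mono) auto
    then show ?thesis using left[of "- (s\<^sup>2 * p)"] by (simp add: mult.commute)
  qed
  \<comment> \<open>The orbit closes up because of the equation for \<open>lambda q\<close>, which
    reads \<open>s ^ (q - 3) * (s ^ 3 - 2 * s) = 1\<close>.\<close>
  also have "\<dots> = 1/2 + p - d"
  proof -
    have "q - 3 + 3 = q" "q - 3 + 1 = q - 2" using q by auto
    then have "s ^ q = s ^ (q - 3) * s ^ 3" "s ^ (q - 2) = s ^ (q - 3) * s"
      by (metis power_add, metis power_add power_one_right)
    then have "s ^ (q - 3) * (s ^ 3 - 2 * s) = 1"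
      using lambda_root(1)[OF q(2)] by (simp add: s_def algebra_simps)
    then have "d * (s ^ (q - 3) * (s ^ 3 - 2 * s)) = d" by simp
    then have "p * (s ^ 3 - 2 * s) = d" using d(2) by (simp add: mult.assoc[symmetric])
    then show ?thesis using p(2) by (simp add: algebra_simps power2_eq_square power3_eq_cube)
  qed
  finally have cycle: "(tent s ^^ q) (1/2 + p - d) = 1/2 + p - d" .
  have "(tent s ^^ k) (1/2 + p - d) \<noteq> 1/2 + p - d" if k: "0 < k" "k < q" for k
  proof
    assume "(tent s ^^ k) (1/2 + p - d) = 1/2 + p - d"
    then have "(- s) ^ k * d = d" using spiral[of k] k by simp
    then have "\<bar>(- s) ^ k\<bar> = 1" using d(1) by simp
    then have "s ^ k = 1" using s by (simp add: power_abs)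
    then show False using one_less_power[OF s k(1)] by simp
  qed
  moreover have "1/2 + p - d \<in> {0..1}"
  proof -
    have "p / s ^ (q - 3) \<le> p / 1" using p(1) s by (intro divide_left_mono one_le_power) auto
    then have "d \<le> p" by (simp add: d_def)
    moreover have "p \<le> 1/2" using p s by (simp add: p_def divide_le_eq)
    ultimately show ?thesis using d(1) by auto
  qed
  ultimately show ?thesis using cycle unfolding has_period_def s_def by blast
qed

lemma map_with_period_exists:
  assumes "odd q"
  shows "\<exists>g r. interval_map g \<and> has_period g (2 ^ n * q) \<and> growth_rate_le g r \<and> r \<ge> 1 \<and>
    ln r = ln (lambda q) / 2 ^ n"
proof (induction n)
  case 0
  show ?case
  proof (cases "q = 1")
    case True
    have "interval_map (\<lambda>x. x)" by standard auto
    moreover have "has_period (\<lambda>x. x) 1" unfolding has_period_def by (intro bexI[of _ 0]) auto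
    moreover have "growth_rate_le (\<lambda>x. x) 1" by (rule growth_rate_le_lipschitz) auto
    ultimately show ?thesis using True by (intro exI[of _ "\<lambda>x. x"] exI[of _ 1]) (auto simp: lambda_def)
  next
    case False
    then have q: "q \<ge> 3" using assms by (cases q rule: nat.exhaust) (auto elim!: oddE)
    have s: "lambda q > 1" "lambda q \<le> 2" using lambda_gt_1[OF q] lambda_root(3)[OF q] by auto
    show ?thesis
      using interval_map_tent[of "lambda q"] has_period_tent[OF assms q] growth_rate_le_tent[of "lambda q"] s
      by (intro exI[of _ "tent (lambda q)"] exI[of _ "lambda q"]) auto
  qed
next
  case (Suc n)
  then obtain g r where g: "interval_map g" "has_period g (2 ^ n * q)" "growth_rate_le g r" "r \<ge> 1"
    "ln r = ln (lambda q) / 2 ^ n" by blast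
  interpret interval_map g by (rule g(1))
  have "interval_map (doubling g)" by standard (fact doubling_continuous doubling_maps)+
  moreover have "has_period (doubling g) (2 ^ Suc n * q)"
    using has_period_doubling[OF g(2)] by (simp add: mult.assoc)
  moreover have "growth_rate_le (doubling g) (sqrt r)" by (rule growth_rate_le_doubling[OF g(3,4)])
  moreover have "ln (sqrt r) = ln (lambda q) / 2 ^ Suc n" using g(4,5) by (simp add: ln_sqrt)
  ultimately show ?case using g(4) by (intro exI[of _ "doubling g"] exI[of _ "sqrt r"]) auto
qed

section \<open>Horizontal bands\<close>

text \<open>The core loses nothing, since residual subsets of the circle are dense.\<close>

lemma horizontal_band: "band (UNIV \<times> {x})" if "x \<in> {0..1}"
proof -
  have fib: "fibre (UNIV \<times> {x}) \<theta> = {x..x}" for \<theta> by (auto simp: fibre_def)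
  have res: "residual (UNIV :: circle set)" unfolding residual_def by (auto intro!: exI[of _ "{}"])
  have "closed (UNIV \<times> {x} :: (circle \<times> real) set)" by (intro closed_Times) auto
  moreover have "UNIV \<times> {x} \<subseteq> Omega" using that by (auto simp: Omega_def)
  moreover have "fst ` (UNIV \<times> {x} :: (circle \<times> real) set) = UNIV" by force
  ultimately have strip: "strip (UNIV \<times> {x})"
    unfolding strip_def using res fib by blast
  have "closure ((UNIV \<times> {x}) \<inter> fst -` G) = UNIV \<times> {x}" if "residual G" for G :: "circle set"
  proof -
    have "(UNIV \<times> {x}) \<inter> fst -` G = G \<times> {x}" by auto
    then show ?thesis using residual_circle_dense[OF that] by (simp add: closure_Times)
  qed
  then have "core (UNIV \<times> {x}) = UNIV \<times> {x}" unfolding core_def using res by auto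
  then show ?thesis using strip by (simp add: band_def)
qed

lemma horizontal_bands_ordered:
  assumes "x \<noteq> y" shows "strips_ordered (UNIV \<times> {x}) (UNIV \<times> {y})"
proof -
  have fib: "fibre (UNIV \<times> {x}) \<theta> = {x}" for \<theta> x by (auto simp: fibre_def)
  have bd: "upper_bd (UNIV \<times> {x}) \<theta> = x" "lower_bd (UNIV \<times> {x}) \<theta> = x" for \<theta> x
    unfolding upper_bd_def lower_bd_def fib by (auto intro!: Greatest_equality Least_equality)
  have "residual (UNIV :: circle set)" unfolding residual_def by (auto intro!: exI[of _ "{}"])
  then have "strip_less (UNIV \<times> {x}) (UNIV \<times> {y})" if "x < y" for x y
    unfolding strip_less_def bd using that by blast
  then show ?thesis using assms unfolding strips_ordered_def by (metis linorder_neqE)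
qed

lemma image_product_map: "(product_map \<omega> g ^^ i) ` (UNIV \<times> {x}) = UNIV \<times> {(g ^^ i) x}"
proof
  show "UNIV \<times> {(g ^^ i) x} \<subseteq> (product_map \<omega> g ^^ i) ` (UNIV \<times> {x})"
  proof
    fix z :: "circle \<times> real" assume "z \<in> UNIV \<times> {(g ^^ i) x}"
    then obtain \<theta> where z: "z = (\<theta>, (g ^^ i) x)" by auto
    obtain \<theta>' where "\<theta> = rotation (real i * \<omega>) \<theta>'" using surjD[OF surj_rotation] by blast
    then show "z \<in> (product_map \<omega> g ^^ i) ` (UNIV \<times> {x})"
      unfolding z by (intro image_eqI[of _ _ "(\<theta>', x)"]) (auto simp: funpow_product_map)
  qed
qed (auto simp: funpow_product_map)

lemma (in interval_map) product_map_skew_product: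
  assumes "\<omega> \<notin> \<rat>" shows "product_map \<omega> g \<in> skew_products"
proof -
  have "continuous_on Omega (\<lambda>z. g (snd z))"
    by (rule continuous_on_compose2[OF cont continuous_on_snd[OF continuous_on_id]]) (auto simp: Omega_def)
  moreover have "(\<lambda>z. g (snd z)) ` Omega \<subseteq> {0..1}" using maps by (auto simp: Omega_def)
  moreover have "\<forall>\<theta> x. (\<theta>, x) \<in> Omega \<longrightarrow> product_map \<omega> g (\<theta>, x) = (rotation \<omega> \<theta>, g (snd (\<theta>, x)))"
    by (simp add: product_map_def)
  ultimately show ?thesis unfolding skew_products_def using assms
    by (intro CollectI exI[of _ \<omega>] exI[of _ "\<lambda>z. g (snd z)"] conjI)
qed

lemma (in interval_map) product_map_periodic_bands:
  assumes "has_period g m" "m \<ge> 1" shows "\<exists>P. periodic_orbit_of_bands (product_map \<omega> g) m P"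
proof -
  obtain x where x: "x \<in> {0..1}" "(g ^^ m) x = x" "\<And>k. 0 < k \<Longrightarrow> k < m \<Longrightarrow> (g ^^ k) x \<noteq> x"
    using assms unfolding has_period_def by blast
  have neq: "(g ^^ i) x \<noteq> (g ^^ j) x" if "i < j" "j < m" for i j
  proof
    assume "(g ^^ i) x = (g ^^ j) x"
    then have "(g ^^ (m - j)) ((g ^^ i) x) = (g ^^ (m - j)) ((g ^^ j) x)" by simp
    then have "(g ^^ (m - j + i)) x = (g ^^ (m - j + j)) x" unfolding funpow_add o_apply .
    then have "(g ^^ (m - j + i)) x = x" using that x(2) by simp
    moreover have "0 < m - j + i" "m - j + i < m" using that by arith+
    ultimately show False using x(3)[of "m - j + i"] by simp
  qed
  have neq: "(g ^^ i) x \<noteq> (g ^^ j) x" if "i < m" "j < m" "i \<noteq> j" for i j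
    using neq[of i j] neq[of j i] that by (metis linorder_neqE_nat)
  let ?F = "product_map \<omega> g" and ?A = "UNIV \<times> {x} :: (circle \<times> real) set"
  have bands: "band ((?F ^^ i) ` ?A)" for i
    unfolding image_product_map by (rule horizontal_band[OF funpow_mem[OF maps x(1)]])
  have "periodic_strip ?F m ?A"
    unfolding periodic_strip_def
  proof (intro conjI allI impI)
    show "(?F ^^ m) ` ?A = ?A" by (simp add: image_product_map x(2))
    show "strip ((?F ^^ i) ` ?A)" for i
      using bands[of i] unfolding band_def by (rule conjunct1)
    show "(?F ^^ i) ` ?A \<inter> (?F ^^ j) ` ?A = {}" if "i < m" "j < m" "i \<noteq> j" for i j
      using neq[OF that] by (auto simp: image_product_map)
    show "strips_ordered ((?F ^^ i) ` ?A) ((?F ^^ j) ` ?A)" if "i < m" "j < m" "i \<noteq> j" for i j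
      unfolding image_product_map by (rule horizontal_bands_ordered[OF neq[OF that]])
  qed (rule assms(2))
  then have "periodic_orbit_of_strips ?F m ((\<lambda>i. (?F ^^ i) ` ?A) ` {..<m})"
    unfolding periodic_orbit_of_strips_def by (intro exI[of _ ?A] conjI refl)
  moreover have "\<forall>B\<in>(\<lambda>i. (?F ^^ i) ` ?A) ` {..<m}. band B" using bands by (intro ballI) auto
  ultimately show ?thesis unfolding periodic_orbit_of_bands_def by (intro exI conjI)
qed

lemma topological_entropy_nonneg: "topological_entropy (top_of_set S) T \<ge> 0"
proof -
  have "open_cover (top_of_set S) {S}" by (simp add: open_cover_def)
  then have "cover_entropy (top_of_set S) T {S} \<le> topological_entropy (top_of_set S) T"
    unfolding topological_entropy_def by (intro SUP_upper) simp
  moreover have "0 \<le> ln (real k) / real n" for k n :: nat by (cases "k = 0") auto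
  then have "0 \<le> cover_entropy (top_of_set S) T {S}"
    unfolding cover_entropy_def by (intro le_Limsup) auto
  ultimately show ?thesis by (rule order_trans[rotated])
qed

lemma entropy_lower_bound:
  assumes F: "F \<in> skew_products" and q: "odd q" and P: "periodic_orbit_of_strips F (2 ^ n * q) P"
  shows "ereal (ln (lambda q) / 2 ^ n) \<le> topological_entropy (top_of_set Omega) F"
proof (cases "q = 1")
  \<comment> \<open>The bound is \<open>ln 1 = 0\<close>.\<close>
  case True
  then show ?thesis using topological_entropy_nonneg by (simp add: lambda_def zero_ereal_def)
next
  case False
  then have q3: "q \<ge> 3" using q by (cases q rule: nat.exhaust) (auto elim!: oddE)
  obtain A where "periodic_strip F (2 ^ n * q) A" using P unfolding periodic_orbit_of_strips_def by blast
  from strips_entropy[OF F this _ q q3] show ?thesis by simp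
qed

lemma entropy_attained:
  assumes q: "odd q"
  shows "\<exists>F\<in>skew_products. (\<exists>P. periodic_orbit_of_bands F (2 ^ n * q) P) \<and>
    topological_entropy (top_of_set Omega) F = ereal (ln (lambda q) / 2 ^ n)"
proof -
  obtain g r where g: "interval_map g" "has_period g (2 ^ n * q)" "growth_rate_le g r" "r \<ge> 1"
    "ln r = ln (lambda q) / 2 ^ n" using map_with_period_exists[OF q] by blast
  interpret interval_map g by (rule g(1))
  have "uncountable (UNIV - \<rat> :: real set)"
    using uncountable_UNIV_real countable_rat by (intro uncountable_minus_countable)
  then have "UNIV - \<rat> \<noteq> ({} :: real set)" by (metis countable_empty)
  then obtain \<omega> :: real where \<omega>: "\<omega> \<notin> \<rat>" by blast
  have skew: "product_map \<omega> g \<in> skew_products" by (rule product_map_skew_product[OF \<omega>])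
  have "2 ^ n * q \<ge> 1" using q by (auto elim!: oddE)
  then obtain P where P: "periodic_orbit_of_bands (product_map \<omega> g) (2 ^ n * q) P"
    using product_map_periodic_bands[OF g(2)] by blast
  then have "periodic_orbit_of_strips (product_map \<omega> g) (2 ^ n * q) P"
    by (simp add: periodic_orbit_of_bands_def)
  from entropy_lower_bound[OF skew q this] product_map_entropy_le[OF maps g(3,4), of \<omega>]
  have "topological_entropy (top_of_set Omega) (product_map \<omega> g) = ereal (ln (lambda q) / 2 ^ n)"
    unfolding g(5) by (rule antisym[rotated])
  then show ?thesis using skew P by blast
qed

theorem corollary2p34:
  "(\<forall>F n q. F \<in> skew_products \<and> odd q \<and> (\<exists>P. periodic_orbit_of_strips F (2 ^ n * q) P) \<longrightarrow>
      topological_entropy (top_of_set Omega) F \<ge> ereal (ln (lambda q) / 2 ^ n)) \<and>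
   (\<forall>m n q :: nat. odd q \<and> m = 2 ^ n * q \<longrightarrow>
      (\<exists>F\<in>skew_products. (\<exists>P. periodic_orbit_of_bands F m P) \<and>
         topological_entropy (top_of_set Omega) F = ereal (ln (lambda q) / 2 ^ n)))"
proof (intro conjI allI impI)
  fix F n q
  assume "F \<in> skew_products \<and> odd q \<and> (\<exists>P. periodic_orbit_of_strips F (2 ^ n * q) P)"
  then show "topological_entropy (top_of_set Omega) F \<ge> ereal (ln (lambda q) / 2 ^ n)"
    by (elim conjE exE) (rule entropy_lower_bound)
next
  fix m n q :: nat
  assume "odd q \<and> m = 2 ^ n * q"
  then show "\<exists>F\<in>skew_products. (\<exists>P. periodic_orbit_of_bands F m P) \<and>
      topological_entropy (top_of_set Omega) F = ereal (ln (lambda q) / 2 ^ n)"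
    using entropy_attained[of q n] by simp
qed
end
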